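(* Let $\mathbb{F}$ be a finite field with $\mathbf{f} = |\mathbb{F}|$, $\chi$ a fixed non-trivial additive character of $\mathbb{F}$, and $G_1, \dots, G_k, H$ finite-dimensional $\mathbb{F}$-vector spaces. Let $\rho : G_{[k]} \to \mathbb{F}$ and $\beta_i : G_{I_i} \to \mathbb{F}$, $i \in [m]$ ($I_i \subset [k]$), be multilinear forms, and write $\mathcal{I} = \{i \in [m] : I_i = [k]\}$. Let $B = \{x_{[k]} \in G_{[k]} : \beta_i(x_{I_i}) = 0 \ \forall i \in [m]\}$ and $B^0 = \{x_{[k]} \in B : \rho(x_{[k]}) = 0\}$. Let $\phi : B^0 \to H$ be a multilinear map, i.e. whenever $x_{[k]}, y_{[k]} \in B^0$ differ in a single coordinate, $\phi((x \ominus y)_{[k]}) = \phi(x_{[k]}) - \phi(y_{[k]})$. Suppose that for each $\lambda \in \mathbb{F}^{\mathcal{I}}$, \[\mathbb{E}_{x_{[k]}} \chi\Big(\rho(x_{[k]}) + \sum_{i \in \mathcal{I}} \lambda_i \beta_i(x_{[k]})\Big) < \frac{1}{2k^2} \mathbf{f}^{-(2k^2 + k + 1)(m+1)2^{2k+3}}.\] Then for each $z_{[k]} \in B \setminus B^0$ and each $h_0 \in H$ there is a unique multilinear map $\phi^{\mathrm{ext}} : B \to H$ (in the same sense: $\phi^{\mathrm{ext}}((x\ominus y)_{[k]}) = \phi^{\mathrm{ext}}(x_{[k]}) - \phi^{\mathrm{ext}}(y_{[k]})$ whenever $x_{[k]}, y_{[k]} \in B$ differ in a single coordinate) such that $\phi^{\mathrm{ext}}$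 restricted to $B^0$ equals $\phi$ and $\phi^{\mathrm{ext}}(z_{[k]}) = h_0$.
   Context: For $I \subset [k]$, $G_I = \prod_{j \in I} G_j$ and $x_I = (x_j)_{j\in I}$. When $x_{[k]}, y_{[k]}$ differ in a single coordinate $d$, $(x \ominus y)_{[k]}$ denotes the point with $i$-th coordinate $x_i = y_i$ for $i \neq d$ and $d$-th coordinate $x_d - y_d$.
   Formalization: "Multilinear" for φ and φ^ext means the subtraction identity (x = y included) plus F-homogeneity in each coordinate; over prime fields homogeneity is automatic, while over non-prime fields uniqueness fails without it (compose ρ with an additive, non-F-linear map F → H). *)

theory Defs
  imports Complex_Main "HOL-Library.FuncSet" "HOL-Library.Cardinality"
    "HOL-Number_Theory.Residues"
begin

text \<open>
  The spaces \<open>G\<^sub>1, \<dots>, G\<^sub>k\<close> are finite-dimensional subspaces of an ambient vector space of arbitrary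
  dimension. This is no restriction: any family of vector spaces embeds into its direct sum.
\<close>

definition fin_dim_subspace ::
    "('f::field \<Rightarrow> 'v::ab_group_add \<Rightarrow> 'v) \<Rightarrow> 'v set \<Rightarrow> bool" where
  "fin_dim_subspace s V \<longleftrightarrow> module.subspace s V \<and> (\<exists>b. finite b \<and> module.span s b = V)"

definition nontrivial_additive_character :: "('f::field \<Rightarrow> complex) \<Rightarrow> bool" where
  "nontrivial_additive_character \<chi> \<longleftrightarrow>
     (\<forall>a. norm (\<chi> a) = 1) \<and> (\<forall>a b. \<chi> (a + b) = \<chi> a * \<chi> b) \<and> (\<exists>a. \<chi> a \<noteq> 1)"

definition avg :: "'a set \<Rightarrow> ('a \<Rightarrow> complex) \<Rightarrow> complex" where
  "avg S f = (\<Sum>x\<in>S. f x) / of_nat (card S)"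

text \<open>
  Points \<open>x\<^sub>J\<close> of \<open>G\<^sub>J\<close> are extensional functions in \<^term>\<open>Pi\<^sub>E J G\<close>. The point \<open>x \<ominus> y\<close> depends on
  the coordinate \<open>d\<close> in which \<open>x\<close> and \<open>y\<close> differ, which is therefore an argument.
\<close>

definition ominus :: "'i \<Rightarrow> ('i \<Rightarrow> 'v::minus) \<Rightarrow> ('i \<Rightarrow> 'v) \<Rightarrow> ('i \<Rightarrow> 'v)" where
  "ominus d x y = x(d := x d - y d)"

text \<open>
  The case \<open>x = y\<close> is included, so that a multi-additive map vanishes at points of its domain
  having a zero coordinate, also when a fibre of the domain is trivial.
\<close>

definition multiadditive_on ::
    "'i set \<Rightarrow> ('i \<Rightarrow> 'v::ab_group_add) set \<Rightarrow> (('i \<Rightarrow> 'v) \<Rightarrow> 'w::ab_group_add) \<Rightarrow> bool" where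
  "multiadditive_on J S \<phi> \<longleftrightarrow>
     (\<forall>d\<in>J. \<forall>x\<in>S. \<forall>y\<in>S. (\<forall>i\<in>J - {d}. x i = y i) \<longrightarrow> \<phi> (ominus d x y) = \<phi> x - \<phi> y)"

text \<open>
  Over a field of prime order, homogeneity is a consequence of the subtraction identity (lemma
  \<open>multilinear_on_iff_multiadditive_on\<close> below). Over other finite fields it has to be required:
  an additive map \<open>\<bbbF> \<rightarrow> H\<close> composed with a multilinear form satisfies the subtraction identity,
  so this identity alone does not give unique extensions.
\<close>

definition multilinear_on ::
    "('f \<Rightarrow> 'v::ab_group_add \<Rightarrow> 'v) \<Rightarrow> ('f \<Rightarrow> 'w::ab_group_add \<Rightarrow> 'w) \<Rightarrow>
     'i set \<Rightarrow> ('i \<Rightarrow> 'v) set \<Rightarrow> (('i \<Rightarrow> 'v) \<Rightarrow> 'w) \<Rightarrow> bool" where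
  "multilinear_on s t J S \<phi> \<longleftrightarrow>
     multiadditive_on J S \<phi> \<and>
     (\<forall>d\<in>J. \<forall>x\<in>S. \<forall>c. \<phi> (x(d := s c (x d))) = t c (\<phi> x))"

lemma prime_card_imp_of_nat:
  fixes c :: "'f::{field,finite}"
  assumes "prime CARD('f)"
  shows "\<exists>n. c = of_nat n"
proof -
  have pos: "CHAR('f) > 0" by (rule finite_imp_CHAR_pos) simp
  have "CHAR('f) dvd CARD('f)" by (rule CHAR_dvd_CARD)
  moreover have "CHAR('f) \<noteq> 1" by simp
  ultimately have eq: "CHAR('f) = CARD('f)"
    using assms by (metis prime_nat_iff)
  have "inj_on (of_nat :: nat \<Rightarrow> 'f) {..<CARD('f)}"
    by (auto simp: inj_on_def of_nat_eq_iff_cong_CHAR eq cong_def)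
  then have "card ((of_nat :: nat \<Rightarrow> 'f) ` {..<CARD('f)}) = CARD('f)"
    by (simp add: card_image)
  then have "(of_nat :: nat \<Rightarrow> 'f) ` {..<CARD('f)} = UNIV"
    by (intro card_subset_eq) auto
  then show ?thesis by blast
qed

lemma multilinear_on_iff_multiadditive_on:
  fixes s :: "'f::{field,finite} \<Rightarrow> 'v::ab_group_add \<Rightarrow> 'v"
    and t :: "'f \<Rightarrow> 'w::ab_group_add \<Rightarrow> 'w"
  assumes "prime CARD('f)" and s: "vector_space s" and t: "vector_space t"
    and closed: "\<And>d x c. d \<in> J \<Longrightarrow> x \<in> S \<Longrightarrow> x(d := s c (x d)) \<in> S"
  shows "multilinear_on s t J S \<phi> \<longleftrightarrow> multiadditive_on J S \<phi>"
proof
  assume add: "multiadditive_on J S \<phi>"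
  interpret s: vector_space s by (rule s)
  interpret t: vector_space t by (rule t)
  have "\<phi> (x(d := s c (x d))) = t c (\<phi> x)" if d: "d \<in> J" and x: "x \<in> S" for d x c
  proof -
    have diff: "\<phi> (x(d := s (a - b) (x d))) = \<phi> (x(d := s a (x d))) - \<phi> (x(d := s b (x d)))" for a b
    proof -
      have "\<phi> (ominus d (x(d := s a (x d))) (x(d := s b (x d)))) =
          \<phi> (x(d := s a (x d))) - \<phi> (x(d := s b (x d)))"
        using add closed[OF d x] d unfolding multiadditive_on_def by simp
      then show ?thesis by (simp add: ominus_def s.scale_left_diff_distrib)
    qed
    have "\<phi> (x(d := s (of_nat n) (x d))) = t (of_nat n) (\<phi> x)" for n
    proof (induction n)
      case 0
      then show ?case using diff[of 0 0] by (simp add: fun_upd_def)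
    next
      case (Suc n)
      then show ?case
        using diff[of "of_nat (Suc n)" 1] by (simp add: t.scale_left_distrib algebra_simps fun_upd_def)
    qed
    then show ?thesis using prime_card_imp_of_nat[OF assms(1), of c] by auto
  qed
  with add show "multilinear_on s t J S \<phi>" by (auto simp: multilinear_on_def)
qed (simp add: multilinear_on_def)

end

theory Submission
  imports Defs "HOL-Library.Function_Algebras"
begin

text \<open>
  The bias hypothesis is used in the form: for every form \<open>\<rho> + \<gamma>\<close> with \<open>\<gamma>\<close> in the span of the full
  \<open>\<beta>\<^sub>i\<close>, few points of \<open>G\<^sub>2 \<times> \<dots> \<times> G\<^sub>k\<close> make it vanish identically in the first coordinate. The theorem is
  proved by induction on \<open>k\<close>, fixing the last coordinate \<open>b\<close>. For almost all triples of values of the last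
  coordinate the corresponding slices of \<open>\<rho>\<close> and of the \<open>\<beta>\<^sub>i\<close> satisfy the bias hypothesis jointly.
  Inductively the slice of \<open>\<phi>\<close> at a generic \<open>b\<close> extends to a map \<open>\<psi> b\<close>, uniquely up to multiples of the slice
  \<open>\<rho>\<^sub>b\<close>; hence \<open>\<psi> (b + c) - \<psi> b - \<psi> c = \<kappa> b c \<cdot> \<rho>\<^sub>b + \<kappa> c b \<cdot> \<rho>\<^sub>c\<close>. Independence of generic triples turns
  associativity into a cocycle identity for \<open>\<kappa>\<close>, and correcting \<open>\<psi>\<close> by the resulting coboundary makes it
  additive in \<open>b\<close>. The failure of homogeneity in \<open>b\<close> is then a derivation of a finite field, so it vanishes.
  Finally \<open>\<psi>\<close> is transported to an arbitrary last coordinate \<open>a\<close> as \<open>\<psi> (a + b) - \<psi> b\<close> with \<open>b\<close> generic.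
\<close>

section \<open>Multilinear forms and their slices\<close>

text \<open>The slices are extended one at a time by arbitrary choices, so all coherence must come
  from comparing identities at well-chosen points. The points that do this are those where two of
  three slices of \<open>\<rho>\<close> vanish and the third does not: there a single unknown
  coefficient survives. Triples are forced by associativity. To find such points one works with
  three slices of every form and two slices of \<open>\<rho>\<close>, that is with
  \<open>3 * m + 2\<close> forms in one coordinate fewer; this growth determines \<open>req\<close>.
  The rest of the budget is spent on genericity, counted in powers of \<open>CARD('f)\<close>. A
  last coordinate must be found in two fibres and in a zero set of \<open>\<rho>\<close>, which
  together impose \<open>2 * m + 1\<close> additive conditions, outside four exceptional sets. This
  fixes the exponent \<open>2 * m + 4\<close> in \<open>small\<close>. The triples that satisfy a
  relation of low rank are counted by a union bound, and two averaging steps pass from them to pairs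
  and then to single coordinates.\<close>

interpretation fun_space: vector_space "\<lambda>(c::'f::field) (f::'a \<Rightarrow> 'f) x. c * f x"
  by unfold_locales (auto simp: fun_eq_iff algebra_simps)

section \<open>Counting kernels and spans over a finite field\<close>

text \<open>Translation by one point of a fibre carries that fibre injectively into the kernel, and
  there are \<open>CARD('f)\<close> fibres. Sets closed under subtraction are the right generality
  for the next lemma, where \<open>A\<close> is itself a common kernel.\<close>

lemma card_additive_le_ker:
  fixes f :: "'v::ab_group_add \<Rightarrow> 'f::{finite,ab_group_add}"
  assumes "finite A" and diff: "\<And>u v. u \<in> A \<Longrightarrow> v \<in> A \<Longrightarrow> u - v \<in> A"
    and f: "\<And>u v. u \<in> A \<Longrightarrow> v \<in> A \<Longrightarrow> f (u - v) = f u - f v"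
  shows "card A \<le> CARD('f) * card {u \<in> A. f u = 0}"
proof -
  have fibre: "card {u \<in> A. f u = c} \<le> card {u \<in> A. f u = 0}" for c
  proof (cases "{u \<in> A. f u = c} = {}")
    case False
    then obtain v where v: "v \<in> A" "f v = c" by auto
    have "inj_on (\<lambda>u. u - v) {u \<in> A. f u = c}" by (auto simp: inj_on_def)
    moreover have "(\<lambda>u. u - v) ` {u \<in> A. f u = c} \<subseteq> {u \<in> A. f u = 0}"
    proof safe
      fix u assume "u \<in> A" "c = f u"
      then show "u - v \<in> A" "f (u - v) = 0" using v diff[of u v] f[of u v] by simp_all
    qed
    moreover have "finite {u \<in> A. f u = 0}" using assms(1) by simp
    ultimately show ?thesis by (rule card_inj_on_le)
  next
    case True
    then show ?thesis by (metis card.empty le0)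
  qed
  have "A = (\<Union>c\<in>UNIV. {u \<in> A. f u = c})" by auto
  then have "card A \<le> (\<Sum>c\<in>UNIV. card {u \<in> A. f u = c})"
    by (metis (no_types) card_UN_le finite_class.finite_UNIV)
  also have "\<dots> \<le> (\<Sum>c\<in>(UNIV::'f set). card {u \<in> A. f u = 0})"
    by (intro sum_mono fibre)
  finally show ?thesis by simp
qed

lemma card_additive_le_common_ker:
  fixes \<Phi> :: "('v::ab_group_add \<Rightarrow> 'f::{finite,ab_group_add}) set"
  assumes "finite \<Phi>" "finite A"
    and "\<And>u v. u \<in> A \<Longrightarrow> v \<in> A \<Longrightarrow> u - v \<in> A"
    and "\<And>f u v. f \<in> \<Phi> \<Longrightarrow> u \<in> A \<Longrightarrow> v \<in> A \<Longrightarrow> f (u - v) = f u - f v"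
  shows "card A \<le> CARD('f) ^ card \<Phi> * card {u \<in> A. \<forall>f\<in>\<Phi>. f u = 0}"
  using assms
proof (induction \<Phi> rule: finite_induct)
  case (insert g \<Phi>)
  let ?K = "{u \<in> A. \<forall>f\<in>\<Phi>. f u = 0}"
  have "card A \<le> CARD('f) ^ card \<Phi> * card ?K"
    using insert.IH insert.prems by simp
  also have "card ?K \<le> CARD('f) * card {u \<in> ?K. g u = 0}"
  proof (rule card_additive_le_ker)
    fix u v assume "u \<in> ?K" "v \<in> ?K"
    then have "f (u - v) = 0" if "f \<in> \<Phi>" for f
    proof -
      have "f u = 0" "f v = 0" "f (u - v) = f u - f v"
        using that \<open>u \<in> ?K\<close> \<open>v \<in> ?K\<close> insert.prems(3)[of f u v] by blast+
      then show ?thesis by simp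
    qed
    moreover have "u - v \<in> A" using \<open>u \<in> ?K\<close> \<open>v \<in> ?K\<close> insert.prems(2) by simp
    ultimately show "u - v \<in> ?K" by blast
    show "g (u - v) = g u - g v" using insert.prems(3)[of g u v] \<open>u \<in> ?K\<close> \<open>v \<in> ?K\<close> by simp
  qed (use insert.prems(1) in simp)
  also have "{u \<in> ?K. g u = 0} = {u \<in> A. \<forall>f\<in>insert g \<Phi>. f u = 0}" by auto
  finally show ?case using insert.hyps by (simp add: mult_ac)
qed simp

text \<open>Bounds the number of parameters in the union bound over relations between slices, and
  gives the finiteness of the spaces \<open>G j\<close>.\<close>

lemma (in vector_space) card_span_le:
  assumes "finite (UNIV :: 'a set)" "finite S"
  shows "finite (span S) \<and> card (span S) \<le> CARD('a) ^ card S"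
  using assms(2)
proof (induction S rule: finite_induct)
  case (insert a S)
  have "span (insert a S) = (\<lambda>(c, x). scale c a + x) ` (UNIV \<times> span S)"
  proof (intro equalityI subsetI)
    fix x assume "x \<in> span (insert a S)"
    then obtain c where "x - scale c a \<in> span S" by (auto simp: span_insert)
    then show "x \<in> (\<lambda>(c, x). scale c a + x) ` (UNIV \<times> span S)"
      by (intro image_eqI[of _ _ "(c, x - scale c a)"]) auto
  next
    fix x assume "x \<in> (\<lambda>(c, x). scale c a + x) ` (UNIV \<times> span S)"
    then obtain c y where "y \<in> span S" "x = scale c a + y" by auto
    then show "x \<in> span (insert a S)" by (auto simp: span_insert intro!: exI[of _ c])
  qed
  moreover have "card ((\<lambda>(c, x). scale c a + x) ` (UNIV \<times> span S)) \<le> card ((UNIV::'a set) \<times> span S)"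
    using insert assms by (intro card_image_le) auto
  moreover have "card ((UNIV::'a set) \<times> span S) \<le> CARD('a) * CARD('a) ^ card S"
    using insert by (simp add: card_cartesian_product)
  ultimately have "card (span (insert a S)) \<le> CARD('a) * CARD('a) ^ card S" by (metis le_trans)
  moreover have "finite (span (insert a S))" using \<open>span (insert a S) = _\<close> insert assms by simp
  ultimately show ?case using insert.hyps by simp
qed simp

text \<open>Coordinates are varied through \<open>x(d := u)\<close>, where \<open>x\<close> itself
  may lie outside \<open>S\<close>; slicing then is plain substitution. The action \<open>t\<close>
  on the target is a parameter, so that scalar forms and maps into \<open>H\<close> share the
  notion.\<close>

definition mlin ::
    "('f \<Rightarrow> 'v \<Rightarrow> 'v) \<Rightarrow> ('f \<Rightarrow> 'w \<Rightarrow> 'w) \<Rightarrow> 'i set \<Rightarrow> ('i \<Rightarrow> 'v::plus) set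
      \<Rightarrow> (('i \<Rightarrow> 'v) \<Rightarrow> 'w::plus) \<Rightarrow> bool" where
  "mlin s t D S \<phi> \<longleftrightarrow>
     (\<forall>d\<in>D. \<forall>x u v. x(d := u) \<in> S \<longrightarrow> x(d := v) \<in> S \<longrightarrow>
        \<phi> (x(d := u + v)) = \<phi> (x(d := u)) + \<phi> (x(d := v))) \<and>
     (\<forall>d\<in>D. \<forall>x u c. x(d := u) \<in> S \<longrightarrow> \<phi> (x(d := s c u)) = t c (\<phi> (x(d := u))))"

lemma mlin_subset: "mlin s t D S \<phi> \<Longrightarrow> D' \<subseteq> D \<Longrightarrow> S' \<subseteq> S \<Longrightarrow> mlin s t D' S' \<phi>"
  unfolding mlin_def by (meson subsetD)

definition slice :: "nat \<Rightarrow> 'v \<Rightarrow> ((nat \<Rightarrow> 'v) \<Rightarrow> 'w) \<Rightarrow> (nat \<Rightarrow> 'v) \<Rightarrow> 'w" where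
  "slice k b f = (\<lambda>x. f (x(Suc k := b)))"

lemma slice_mlin:
  assumes "mlin s t D S \<phi>" "Suc k \<notin> D'" "D' \<subseteq> D" "\<And>x. x \<in> S' \<Longrightarrow> x(Suc k := b) \<in> S"
  shows "mlin s t D' S' (slice k b \<phi>)"
proof -
  have "x(d := u, Suc k := b) = (x(Suc k := b))(d := u)" if "d \<in> D'" for x d u
    using assms(2) that by (auto simp: fun_upd_twist)
  then show ?thesis
    using assms(1,3) assms(4) unfolding mlin_def slice_def by (smt (verit, ccfv_SIG) subsetD)
qed

text \<open>\<open>V\<close> is indexed by all naturals and no \<open>k\<close> is fixed, so that
  the inductions on \<open>k\<close> stay inside one context. In the application the spaces beyond
  \<open>k\<close> are trivial.\<close>

locale finite_spaces = G: vector_space sG + H: vector_space sH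
  for sG :: "'f::{field,finite} \<Rightarrow> 'v::ab_group_add \<Rightarrow> 'v"
    and sH :: "'f \<Rightarrow> 'w::ab_group_add \<Rightarrow> 'w" +
  fixes V :: "nat \<Rightarrow> 'v set"
  assumes subspace_V: "G.subspace (V j)" and finite_V [simp]: "finite (V j)"
begin

lemma card_field_ge_2: "CARD('f) \<ge> 2"
proof -
  have "card {0, 1 :: 'f} \<le> CARD('f)" by (intro card_mono) auto
  then show ?thesis by simp
qed

lemma V_simps [simp]:
  "0 \<in> V j" "u \<in> V j \<Longrightarrow> v \<in> V j \<Longrightarrow> u + v \<in> V j" "u \<in> V j \<Longrightarrow> v \<in> V j \<Longrightarrow> u - v \<in> V j"
  "u \<in> V j \<Longrightarrow> sG c u \<in> V j" "u \<in> V j \<Longrightarrow> - u \<in> V j"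
  using subspace_V by (auto simp: G.subspace_0 G.subspace_add G.subspace_diff G.subspace_scale G.subspace_neg)

section \<open>Points and forms in the first \<open>k\<close> coordinates\<close>

definition points :: "nat \<Rightarrow> (nat \<Rightarrow> 'v) set" where
  "points k = Pi\<^sub>E {1..k} V"

lemma points_upd: "x \<in> points k \<Longrightarrow> d \<in> {1..k} \<Longrightarrow> u \<in> V d \<Longrightarrow> x(d := u) \<in> points k"
  by (auto simp: points_def PiE_iff extensional_def)

lemma points_updD: "x(d := u) \<in> points k \<Longrightarrow> d \<in> {1..k} \<Longrightarrow> u \<in> V d"
  unfolding points_def by (metis PiE_mem fun_upd_same)

lemma points_upd_other: "x(d := u) \<in> points k \<Longrightarrow> d \<in> {1..k} \<Longrightarrow> v \<in> V d \<Longrightarrow> x(d := v) \<in> points k"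
  by (metis fun_upd_upd points_upd)

lemma points_Suc: "x \<in> points k \<Longrightarrow> b \<in> V (Suc k) \<Longrightarrow> x(Suc k := b) \<in> points (Suc k)"
  by (auto simp: points_def PiE_iff extensional_def)

lemma points_SucE:
  assumes "x \<in> points (Suc k)"
  obtains y b where "y \<in> points k" "b \<in> V (Suc k)" "x = y(Suc k := b)"
proof
  show "restrict x {1..k} \<in> points k" using assms by (auto simp: points_def PiE_iff)
  show "x (Suc k) \<in> V (Suc k)" using assms by (auto simp: points_def PiE_iff)
  show "x = (restrict x {1..k})(Suc k := x (Suc k))"
    using assms by (auto simp: points_def PiE_iff extensional_def fun_eq_iff)
qed

lemma points_restrict:
  assumes "y \<in> points k"
  shows "restrict (y(Suc k := b)) {1..k} = y"
  using assms by (auto simp: points_def PiE_iff extensional_def fun_eq_iff)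

abbreviation ml :: "nat set \<Rightarrow> (nat \<Rightarrow> 'v) set \<Rightarrow> ((nat \<Rightarrow> 'v) \<Rightarrow> 'w) \<Rightarrow> bool" where
  "ml \<equiv> mlin sG sH"

text \<open>A form on the coordinates \<open>I\<close> is kept as a function on all of
  \<open>points k\<close>, pulled back from \<open>I\<close>. The common domain lets forms with
  different index sets be sliced and compared uniformly.\<close>

definition form :: "nat \<Rightarrow> nat set \<Rightarrow> ((nat \<Rightarrow> 'v) \<Rightarrow> 'f) \<Rightarrow> bool" where
  "form k I f \<longleftrightarrow> I \<subseteq> {1..k} \<and> mlin sG (*) I (points k) f \<and>
     (\<forall>x\<in>points k. \<forall>y\<in>points k. (\<forall>i\<in>I. x i = y i) \<longrightarrow> f x = f y)"

lemma form_add: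
  "form k I f \<Longrightarrow> d \<in> I \<Longrightarrow> x(d := u) \<in> points k \<Longrightarrow> x(d := v) \<in> points k \<Longrightarrow>
    f (x(d := u + v)) = f (x(d := u)) + f (x(d := v))"
  unfolding form_def mlin_def by blast

lemma form_scale:
  "form k I f \<Longrightarrow> d \<in> I \<Longrightarrow> x(d := u) \<in> points k \<Longrightarrow> f (x(d := sG c u)) = c * f (x(d := u))"
  unfolding form_def mlin_def by blast

lemma form_indep:
  "form k I f \<Longrightarrow> d \<notin> I \<Longrightarrow> x(d := u) \<in> points k \<Longrightarrow> x(d := v) \<in> points k \<Longrightarrow>
    f (x(d := u)) = f (x(d := v))"
  unfolding form_def by (smt (verit, ccfv_SIG) fun_upd_other)

lemma form_index: "form k I f \<Longrightarrow> I \<subseteq> {1..k}"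
  by (simp add: form_def)

lemma form_diff:
  assumes "form k I f" "d \<in> I" "x(d := u) \<in> points k" "x(d := v) \<in> points k"
  shows "f (x(d := u - v)) = f (x(d := u)) - f (x(d := v))"
proof -
  have d: "d \<in> {1..k}" using assms form_index[OF assms(1)] by blast
  have "x(d := sG (-1) v) \<in> points k"
    using assms d points_updD points_upd_other by (metis V_simps(4))
  then have "f (x(d := u + sG (-1) v)) = f (x(d := u)) + f (x(d := sG (-1) v))"
    using assms form_add by blast
  then show ?thesis using form_scale[OF assms(1,2,4), of "-1"] by simp
qed

lemma form_0:
  assumes "form k I f" "d \<in> I" "x(d := u) \<in> points k"
  shows "f (x(d := 0)) = 0"
  using form_diff[OF assms(1,2,3,3)] by simp

lemma form_zero_fun: "I \<subseteq> {1..k} \<Longrightarrow> form k I 0"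
  by (auto simp: form_def mlin_def)

lemma form_fun_add:
  assumes f: "form k I f" and g: "form k I g"
  shows "form k I (f + g)"
  unfolding form_def mlin_def
proof (intro conjI ballI allI impI)
  fix x y assume "x \<in> points k" "y \<in> points k" "\<forall>i\<in>I. x i = y i"
  then have "f x = f y" "g x = g y" using assms unfolding form_def by blast+
  then show "(f + g) x = (f + g) y" by simp
qed (use form_index[OF f] in \<open>simp_all add: form_add[OF f] form_add[OF g] form_scale[OF f] form_scale[OF g] algebra_simps\<close>)

lemma form_fun_scale:
  assumes f: "form k I f"
  shows "form k I (\<lambda>x. c * f x)"
  unfolding form_def mlin_def
proof (intro conjI ballI allI impI)
  fix x y assume "x \<in> points k" "y \<in> points k" "\<forall>i\<in>I. x i = y i"
  then have "f x = f y" using assms unfolding form_def by blast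
  then show "c * f x = c * f y" by simp
qed (use form_index[OF f] in \<open>simp_all add: form_add[OF f] form_scale[OF f] algebra_simps\<close>)

lemma form_span:
  assumes "\<And>f. f \<in> S \<Longrightarrow> form k I f" "I \<subseteq> {1..k}" "g \<in> fun_space.span S"
  shows "form k I g"
proof -
  have "fun_space.subspace {f. form k I f}"
    using assms(2) form_fun_add form_fun_scale form_zero_fun
    by (auto simp: fun_space.subspace_def)
  then show ?thesis using assms fun_space.span_minimal[of S "{f. form k I f}"] by blast
qed

lemma form_slice:
  assumes "form (Suc k) I f" "b \<in> V (Suc k)"
  shows "form k (I - {Suc k}) (slice k b f)"
  unfolding form_def
proof (intro conjI ballI impI)
  show "I - {Suc k} \<subseteq> {1..k}" using form_index[OF assms(1)] by auto
  show "mlin sG (*) (I - {Suc k}) (points k) (slice k b f)"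
    by (rule slice_mlin[of _ _ I "points (Suc k)"]) (use assms points_Suc in \<open>auto simp: form_def\<close>)
  fix x y assume "x \<in> points k" "y \<in> points k" "\<forall>i\<in>I - {Suc k}. x i = y i"
  then have "x(Suc k := b) \<in> points (Suc k)" "y(Suc k := b) \<in> points (Suc k)"
    "\<forall>i\<in>I. (x(Suc k := b)) i = (y(Suc k := b)) i"
    using assms(2) points_Suc by auto
  then show "slice k b f x = slice k b f y"
    using assms(1) unfolding slice_def form_def by blast
qed

section \<open>Varieties cut out by forms\<close>

type_synonym (in -) ('a, 'b) form = "nat set \<times> ((nat \<Rightarrow> 'a) \<Rightarrow> 'b)"

definition forms :: "nat \<Rightarrow> ('v, 'f) form set \<Rightarrow> bool" where
  "forms k \<Gamma> \<longleftrightarrow> finite \<Gamma> \<and> (\<forall>(I, f)\<in>\<Gamma>. form k I f)"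

definition variety :: "nat \<Rightarrow> ('v, 'f) form set \<Rightarrow> (nat \<Rightarrow> 'v) set" where
  "variety k \<Gamma> = {x \<in> points k. \<forall>(I, f)\<in>\<Gamma>. f x = 0}"

text \<open>The index set is stored beside each form in order to single these out: they are
  multilinear in the same coordinates as \<open>\<rho>\<close> and can be added to it in the rank
  condition.\<close>

definition full :: "nat \<Rightarrow> ('v, 'f) form set \<Rightarrow> ((nat \<Rightarrow> 'v) \<Rightarrow> 'f) set" where
  "full k \<Gamma> = {f. ({1..k}, f) \<in> \<Gamma>}"

text \<open>Slicing creates full forms in two ways: from full ones, and from those with index set
  \<open>{1..k}\<close>, whose slices do not depend on \<open>b\<close>.\<close>

definition slices :: "nat \<Rightarrow> 'v \<Rightarrow> ('v, 'f) form set \<Rightarrow> ('v, 'f) form set" where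
  "slices k b \<Gamma> = (\<lambda>(I, f). (I - {Suc k}, slice k b f)) ` \<Gamma>"

lemma forms_slices: "forms (Suc k) \<Gamma> \<Longrightarrow> b \<in> V (Suc k) \<Longrightarrow> forms k (slices k b \<Gamma>)"
  by (auto simp: forms_def slices_def form_slice)

lemma forms_Un [simp]: "forms k (\<Gamma> \<union> \<Delta>) \<longleftrightarrow> forms k \<Gamma> \<and> forms k \<Delta>"
  by (auto simp: forms_def)

lemma forms_insert [simp]: "forms k (insert (I, f) \<Gamma>) \<longleftrightarrow> form k I f \<and> forms k \<Gamma>"
  by (auto simp: forms_def)

lemma variety_Un: "variety k (\<Gamma> \<union> \<Delta>) = variety k \<Gamma> \<inter> variety k \<Delta>"
  by (auto simp: variety_def)

lemma variety_insert: "variety k (insert (I, f) \<Gamma>) = {x \<in> variety k \<Gamma>. f x = 0}"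
  by (auto simp: variety_def)

lemma variety_points: "x \<in> variety k \<Gamma> \<Longrightarrow> x \<in> points k"
  by (simp add: variety_def)

lemma variety_slices:
  assumes "b \<in> V (Suc k)"
  shows "x \<in> variety k (slices k b \<Gamma>) \<longleftrightarrow> x \<in> points k \<and> x(Suc k := b) \<in> variety (Suc k) \<Gamma>"
  using assms points_Suc by (fastforce simp: variety_def slices_def slice_def)

lemma card_slices: "finite \<Gamma> \<Longrightarrow> card (slices k b \<Gamma>) \<le> card \<Gamma>"
  by (simp add: slices_def card_image_le)

text \<open>Along the coordinate \<open>d\<close> every form is either additive or constant.\<close>

lemma variety_add:
  assumes "forms k \<Gamma>" "d \<in> {1..k}" "x(d := u) \<in> variety k \<Gamma>" "x(d := v) \<in> variety k \<Gamma>"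
  shows "x(d := u + v) \<in> variety k \<Gamma>"
proof -
  have p: "x(d := u) \<in> points k" "x(d := v) \<in> points k" using assms by (auto simp: variety_def)
  then have p3: "x(d := u + v) \<in> points k"
    using assms(2) points_updD points_upd_other by (metis V_simps(2))
  have "f (x(d := u + v)) = 0" if "(I, f) \<in> \<Gamma>" for I f
  proof -
    have f: "form k I f" "f (x(d := u)) = 0" "f (x(d := v)) = 0"
      using that assms by (auto simp: forms_def variety_def)
    show ?thesis
      by (cases "d \<in> I") (use f p p3 form_add[of k I f d x u v] form_indep[of k I f d x u "u + v"] in auto)
  qed
  then show ?thesis using p3 by (auto simp: variety_def)
qed

lemma variety_scale:
  assumes "forms k \<Gamma>" "d \<in> {1..k}" "x(d := u) \<in> variety k \<Gamma>"
  shows "x(d := sG c u) \<in> variety k \<Gamma>"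
proof -
  have p: "x(d := u) \<in> points k" using assms by (auto simp: variety_def)
  then have p3: "x(d := sG c u) \<in> points k"
    using assms(2) points_updD points_upd_other by (metis V_simps(4))
  have "f (x(d := sG c u)) = 0" if "(I, f) \<in> \<Gamma>" for I f
  proof -
    have f: "form k I f" "f (x(d := u)) = 0"
      using that assms by (auto simp: forms_def variety_def)
    show ?thesis
      by (cases "d \<in> I") (use f p p3 form_scale[of k I f d x u c] form_indep[of k I f d x u "sG c u"] in auto)
  qed
  then show ?thesis using p3 by (auto simp: variety_def)
qed

lemma variety_diff:
  assumes "forms k \<Gamma>" "d \<in> {1..k}" "x(d := u) \<in> variety k \<Gamma>" "x(d := v) \<in> variety k \<Gamma>"
  shows "x(d := u - v) \<in> variety k \<Gamma>"
  using variety_add[OF assms(1-3) variety_scale[OF assms(1,2,4), of "-1"]] by simp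

definition zero_pt :: "nat \<Rightarrow> nat \<Rightarrow> 'v" where
  "zero_pt k = restrict (\<lambda>_. 0) {1..k}"

lemma zero_pt_points [simp]: "zero_pt k \<in> points k"
  by (auto simp: zero_pt_def points_def)

lemma zero_pt_Suc: "zero_pt (Suc k) = (zero_pt k)(Suc k := 0)"
  by (auto simp: zero_pt_def fun_eq_iff)

lemma form_zero_pt: "form k I f \<Longrightarrow> I \<noteq> {} \<Longrightarrow> f (zero_pt k) = 0"
proof -
  assume f: "form k I f" "I \<noteq> {}"
  then obtain d where d: "d \<in> I" by auto
  then have "d \<in> {1..k}" using form_index[OF f(1)] by blast
  then have "(zero_pt k)(d := 0) = zero_pt k" by (auto simp: zero_pt_def fun_eq_iff)
  then show ?thesis using form_0[OF f(1) d, of "zero_pt k" 0] by simp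
qed

lemma form_empty_const: "form k {} f \<Longrightarrow> x \<in> points k \<Longrightarrow> y \<in> points k \<Longrightarrow> f x = f y"
  unfolding form_def by blast

text \<open>A form with empty index set is a constant, and the given point \<open>x\<close> forces
  that constant to be 0; every other form vanishes at the zero point anyway.\<close>

lemma zero_pt_variety:
  assumes "forms k \<Gamma>" "x \<in> variety k \<Gamma>"
  shows "zero_pt k \<in> variety k \<Gamma>"
proof -
  have "f (zero_pt k) = 0" if "(I, f) \<in> \<Gamma>" for I f
  proof (cases "I = {}")
    case True
    then have "form k {} f" "f x = 0" "x \<in> points k"
      using that assms by (auto simp: forms_def variety_def)
    then show ?thesis using form_empty_const[of k f "zero_pt k" x] by simp
  next
    case False
    moreover have "form k I f" using that assms by (auto simp: forms_def)
    ultimately show ?thesis using form_zero_pt by blast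
  qed
  then show ?thesis by (auto simp: variety_def)
qed

text \<open>The analytic bias of a multilinear form on the first \<open>k\<close> coordinates is the proportion
  of points at which it vanishes identically in the first coordinate; \<open>null_count\<close> is the numerator.\<close>

definition null_count :: "nat \<Rightarrow> ((nat \<Rightarrow> 'v) \<Rightarrow> 'f) \<Rightarrow> nat" where
  "null_count k f = card {y \<in> Pi\<^sub>E {2..k} V. \<forall>a\<in>V 1. f (y(1 := a)) = 0}"

definition total_count :: "nat \<Rightarrow> nat" where
  "total_count k = card (Pi\<^sub>E {2..k} V)"

text \<open>Bias below the \<open>-e\<close>-th power of \<open>CARD('f)\<close>, with the division
  cleared. The coefficient of \<open>\<rho>\<close> is 1; other nonzero coefficients reduce to it by
  \<open>null_count_scale\<close>.\<close>

definition rank_cond :: "nat \<Rightarrow> nat \<Rightarrow> ('v, 'f) form set \<Rightarrow> ((nat \<Rightarrow> 'v) \<Rightarrow> 'f) \<Rightarrow> bool" where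
  "rank_cond k e \<Gamma> \<rho> \<longleftrightarrow>
     (\<forall>\<gamma> \<in> fun_space.span (full k \<Gamma>). CARD('f) ^ e * null_count k (\<rho> + \<gamma>) < total_count k)"

lemma rank_cond_mono:
  assumes "rank_cond k e \<Gamma> \<rho>" "e' \<le> e" "\<Gamma>' \<subseteq> \<Gamma>"
  shows "rank_cond k e' \<Gamma>' \<rho>"
  unfolding rank_cond_def
proof
  fix \<gamma> assume "\<gamma> \<in> fun_space.span (full k \<Gamma>')"
  moreover have "full k \<Gamma>' \<subseteq> full k \<Gamma>" using assms(3) by (auto simp: full_def)
  ultimately have "CARD('f) ^ e * null_count k (\<rho> + \<gamma>) < total_count k"
    using assms(1) fun_space.span_mono unfolding rank_cond_def by blast
  moreover have "CARD('f) ^ e' \<le> CARD('f) ^ e" using assms(2) card_field_ge_2 by (intro power_increasing) auto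
  ultimately show "CARD('f) ^ e' * null_count k (\<rho> + \<gamma>) < total_count k"
    by (meson le_less_trans mult_le_mono1)
qed

lemma PiE_point: "k \<ge> 1 \<Longrightarrow> y \<in> Pi\<^sub>E {2..k} V \<Longrightarrow> a \<in> V 1 \<Longrightarrow> y(1 := a) \<in> points k"
  by (auto simp: points_def PiE_iff extensional_def)

lemma null_count_cong:
  "k \<ge> 1 \<Longrightarrow> (\<And>x. x \<in> points k \<Longrightarrow> f x = g x) \<Longrightarrow> null_count k f = null_count k g"
  unfolding null_count_def using PiE_point
  by (metis (no_types, lifting))

lemma null_count_scale: "c \<noteq> 0 \<Longrightarrow> null_count k (\<lambda>x. c * f x) = null_count k f"
  by (simp add: null_count_def)

lemma PiE_Suc_bij:
  assumes "k \<ge> 1"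
  shows "bij_betw (\<lambda>(y, b). y(Suc k := b)) (Pi\<^sub>E {2..k} V \<times> V (Suc k)) (Pi\<^sub>E {2..Suc k} V)"
proof (rule bij_betwI[where g = "\<lambda>x. (restrict x {2..k}, x (Suc k))"])
  show "(\<lambda>(y, b). y(Suc k := b)) \<in> Pi\<^sub>E {2..k} V \<times> V (Suc k) \<rightarrow> Pi\<^sub>E {2..Suc k} V"
    using assms by (auto simp: PiE_iff extensional_def)
  show "(\<lambda>x. (restrict x {2..k}, x (Suc k))) \<in> Pi\<^sub>E {2..Suc k} V \<rightarrow> Pi\<^sub>E {2..k} V \<times> V (Suc k)"
    using assms by (auto simp: PiE_iff)
qed (use assms in \<open>auto simp: PiE_iff extensional_def fun_eq_iff\<close>)

lemma total_count_Suc: "k \<ge> 1 \<Longrightarrow> total_count (Suc k) = total_count k * card (V (Suc k))"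
  unfolding total_count_def using bij_betw_same_card[OF PiE_Suc_bij] by (metis card_cartesian_product)

lemma total_count_pos: "total_count k > 0"
proof -
  have "Pi\<^sub>E {2..k} V \<noteq> {}" using V_simps(1) unfolding PiE_eq_empty_iff by blast
  moreover have "finite (Pi\<^sub>E {2..k} V)" by (auto intro!: finite_PiE)
  ultimately show ?thesis by (simp add: total_count_def card_gt_0_iff)
qed

lemma null_count_Suc:
  assumes "k \<ge> 1"
  shows "null_count (Suc k) F =
    (\<Sum>y\<in>Pi\<^sub>E {2..k} V. card {b \<in> V (Suc k). \<forall>a\<in>V 1. F (y(1 := a, Suc k := b)) = 0})"
proof -
  have tw: "y(1 := a, Suc k := b) = y(Suc k := b, 1 := a)" for y :: "nat \<Rightarrow> 'v" and a b
    using assms by (simp add: fun_upd_twist)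
  let ?S = "SIGMA y:Pi\<^sub>E {2..k} V. {b \<in> V (Suc k). \<forall>a\<in>V 1. F (y(1 := a, Suc k := b)) = 0}"
  have bij: "bij_betw (\<lambda>(y, b). y(Suc k := b)) ?S ((\<lambda>(y, b). y(Suc k := b)) ` ?S)"
    by (rule bij_betw_subset[OF PiE_Suc_bij[OF assms]]) auto
  have img: "(\<lambda>(y, b). y(Suc k := b)) ` ?S =
      {y \<in> Pi\<^sub>E {2..Suc k} V. \<forall>a\<in>V 1. F (y(1 := a)) = 0}" (is "?L = ?R")
  proof
    show "?L \<subseteq> ?R"
    proof
      fix x assume "x \<in> ?L"
      then obtain p where p: "p \<in> ?S" "x = (\<lambda>(y, b). y(Suc k := b)) p" by (rule imageE)
      obtain y b where "p = (y, b)" by (cases p)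
      with p have yb: "(y, b) \<in> ?S" "x = y(Suc k := b)" by simp_all
      then have "x \<in> Pi\<^sub>E {2..Suc k} V"
        using bij_betw_apply[OF PiE_Suc_bij[OF assms], of "(y, b)"] by auto
      moreover have "F (x(1 := a)) = 0" if "a \<in> V 1" for a
        using yb that unfolding yb(2) tw[symmetric] by blast
      ultimately show "x \<in> ?R" by blast
    qed
    show "?R \<subseteq> ?L"
    proof
      fix x assume x: "x \<in> ?R"
      then obtain y b where yb: "y \<in> Pi\<^sub>E {2..k} V" "b \<in> V (Suc k)" "x = y(Suc k := b)"
        using bij_betw_imp_surj_on[OF PiE_Suc_bij[OF assms], symmetric] by auto
      have "\<forall>a\<in>V 1. F (y(1 := a, Suc k := b)) = 0" using x unfolding yb(3) tw by blast
      then have "(y, b) \<in> ?S" using yb by blast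
      then show "x \<in> ?L" using yb(3) by (intro image_eqI[of _ _ "(y, b)"]) simp_all
    qed
  qed
  have "card ?S = null_count (Suc k) F"
    using bij_betw_same_card[OF bij] unfolding null_count_def img .
  then show ?thesis by (simp add: card_SigmaI finite_PiE)
qed

text \<open>For fixed \<open>y\<close> the admissible \<open>b\<close> form a coset of the solution space of the homogeneous
  problem, so a perturbation that does not depend on the last coordinate cannot increase the bias.\<close>

lemma sum_null_count_slice_le:
  assumes "k \<ge> 1" and F: "form (Suc k) {1..Suc k} F"
  shows "(\<Sum>b\<in>V (Suc k). null_count k (\<lambda>x. \<gamma> x + F (x(Suc k := b)))) \<le> null_count (Suc k) F"
proof -
  have fin: "finite (Pi\<^sub>E {2..k} V)" by (auto intro!: finite_PiE)
  have "(\<Sum>b\<in>V (Suc k). null_count k (\<lambda>x. \<gamma> x + F (x(Suc k := b)))) =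
    (\<Sum>b\<in>V (Suc k). \<Sum>y\<in>Pi\<^sub>E {2..k} V. of_bool (\<forall>a\<in>V 1. \<gamma> (y(1 := a)) + F (y(1 := a, Suc k := b)) = 0))"
    unfolding null_count_def using fin by (simp add: sum.If_cases of_bool_def Int_def)
  also have "\<dots> = (\<Sum>y\<in>Pi\<^sub>E {2..k} V. card {b \<in> V (Suc k). \<forall>a\<in>V 1. \<gamma> (y(1 := a)) + F (y(1 := a, Suc k := b)) = 0})"
    by (subst sum.swap) (simp add: sum.If_cases of_bool_def Int_def)
  also have "\<dots> \<le> (\<Sum>y\<in>Pi\<^sub>E {2..k} V. card {b \<in> V (Suc k). \<forall>a\<in>V 1. F (y(1 := a, Suc k := b)) = 0})"
  proof (rule sum_mono)
    fix y assume y: "y \<in> Pi\<^sub>E {2..k} V"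
    let ?S = "{b \<in> V (Suc k). \<forall>a\<in>V 1. \<gamma> (y(1 := a)) + F (y(1 := a, Suc k := b)) = 0}"
    let ?T = "{b \<in> V (Suc k). \<forall>a\<in>V 1. F (y(1 := a, Suc k := b)) = 0}"
    show "card ?S \<le> card ?T"
    proof (cases "?S = {}")
      case False
      then obtain c where c: "c \<in> ?S" by blast
      have "b - c \<in> ?T" if b: "b \<in> ?S" for b
      proof -
        have "F (y(1 := a, Suc k := b - c)) = 0" if a: "a \<in> V 1" for a
        proof -
          have "y(1 := a, Suc k := v) \<in> points (Suc k)" if "v \<in> V (Suc k)" for v
            using PiE_point[OF assms(1) y a] points_Suc that by blast
          then have "F (y(1 := a, Suc k := b - c)) = F (y(1 := a, Suc k := b)) - F (y(1 := a, Suc k := c))"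
            using b c by (intro form_diff[OF F]) auto
          moreover have "\<gamma> (y(1 := a)) + F (y(1 := a, Suc k := b)) = 0"
            "\<gamma> (y(1 := a)) + F (y(1 := a, Suc k := c)) = 0" using a b c by auto
          ultimately show ?thesis by (metis add_left_cancel right_minus_eq)
        qed
        then show ?thesis using b c by simp
      qed
      then show ?thesis
        by (intro card_inj_on_le[of "\<lambda>b. b - c"]) (auto simp: inj_on_def)
    next
      case True
      then show ?thesis by (metis card.empty le0)
    qed
  qed
  also have "\<dots> = null_count (Suc k) F" by (rule null_count_Suc[OF assms(1), symmetric])
  finally show ?thesis .
qed

end

section \<open>Generic triples of slices\<close>

text \<open>Markov's inequality with denominators cleared: of the factor \<open>K * L\<close> in the
  density of bad pairs, \<open>L\<close> is given up to pass to single points.\<close>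

lemma card_exceptional_le:
  assumes "finite X" "finite Y" "card Y > 0"
    and "card {(x, y). x \<in> X \<and> y \<in> Y \<and> P x y} * (K * L) \<le> card X * card Y"
  shows "card {x \<in> X. card {y \<in> Y. P x y} * L > card Y} * K \<le> card X"
proof -
  let ?Z = "{x \<in> X. card {y \<in> Y. P x y} * L > card Y}"
  have "{(x, y). x \<in> X \<and> y \<in> Y \<and> P x y} = (SIGMA x:X. {y \<in> Y. P x y})" by auto
  then have total: "card {(x, y). x \<in> X \<and> y \<in> Y \<and> P x y} = (\<Sum>x\<in>X. card {y \<in> Y. P x y})"
    using assms by (simp add: card_SigmaI)
  have "card ?Z * card Y = (\<Sum>x\<in>?Z. card Y)" by simp
  also have "\<dots> \<le> (\<Sum>x\<in>?Z. card {y \<in> Y. P x y} * L)" by (rule sum_mono) auto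
  also have "\<dots> \<le> (\<Sum>x\<in>X. card {y \<in> Y. P x y} * L)" using assms by (intro sum_mono2) auto
  also have "\<dots> = card {(x, y). x \<in> X \<and> y \<in> Y \<and> P x y} * L"
    by (simp add: total sum_distrib_right)
  finally have "card ?Z * card Y * K \<le> card {(x, y). x \<in> X \<and> y \<in> Y \<and> P x y} * L * K"
    by (rule mult_le_mono1)
  also have "\<dots> \<le> card X * card Y" using assms(4) by (simp only: mult_ac)
  finally have "card ?Z * card Y * K \<le> card X * card Y" .
  then show ?thesis using assms(3) by (simp add: mult.assoc mult.commute)
qed

lemma card_triples_le:
  assumes "finite W" "\<And>b c. b \<in> W \<Longrightarrow> c \<in> W \<Longrightarrow> card {d \<in> W. P b c d} * K \<le> card W"
  shows "card {(b, c, d). b \<in> W \<and> c \<in> W \<and> d \<in> W \<and> P b c d} * K \<le> card W ^ 3"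
proof -
  have "{(b, c, d). b \<in> W \<and> c \<in> W \<and> d \<in> W \<and> P b c d} =
      (SIGMA b:W. SIGMA c:W. {d \<in> W. P b c d})" by auto
  then have "card {(b, c, d). b \<in> W \<and> c \<in> W \<and> d \<in> W \<and> P b c d} * K =
      (\<Sum>b\<in>W. \<Sum>c\<in>W. card {d \<in> W. P b c d} * K)"
    using assms by (simp add: card_SigmaI sum_distrib_right)
  also have "\<dots> \<le> (\<Sum>b\<in>W. \<Sum>c\<in>W. card W)" by (intro sum_mono assms)
  finally show ?thesis by (simp add: power3_eq_cube)
qed

text \<open>Brings the coordinate to be averaged over into the last place, where
  \<open>card_triples_le\<close> expects it.\<close>

lemma card_rotate:
  "card {(b, c, d). b \<in> W \<and> c \<in> W \<and> d \<in> W \<and> P b c d} =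
   card {(c, d, b). c \<in> W \<and> d \<in> W \<and> b \<in> W \<and> P b c d}"
  by (rule bij_betw_same_card[of "\<lambda>(b, c, d). (c, d, b)"], rule bij_betwI[where g = "\<lambda>(c, d, b). (b, c, d)"]) auto

context finite_spaces
begin

section \<open>The budget of the induction\<close>

text \<open>One step of the induction replaces \<open>m\<close> by \<open>3 * m + 2\<close>, and
  \<open>3 * m + 3 = 3 * (m + 1)\<close>. With a factor 4 per level this uses three quarters of the
  requirement and leaves one quarter for the choice of generic slices.\<close>

definition req :: "nat \<Rightarrow> nat \<Rightarrow> nat" where
  "req k m = 4 ^ Suc k * (m + 1)"

text \<open>The spare quarter is \<open>4 ^ Suc k * (m + 1)\<close>, at least
  \<open>16 * (m + 1)\<close> because \<open>k \<ge> 1\<close>.\<close>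

lemma req_Suc: "k \<ge> 1 \<Longrightarrow> req k (3 * m + 2) + 16 * (m + 1) \<le> req (Suc k) m"
proof -
  assume "k \<ge> 1"
  then have "(4::nat) ^ 2 \<le> 4 ^ Suc k" by (intro power_increasing) auto
  then have "16 * (m + 1) \<le> 4 ^ Suc k * (m + 1)" by (intro mult_le_mono1) simp
  then show ?thesis by (simp add: req_def algebra_simps)
qed

end

locale rank_step = finite_spaces sG sH V
  for sG :: "'f::{field,finite} \<Rightarrow> 'v::ab_group_add \<Rightarrow> 'v"
    and sH :: "'f \<Rightarrow> 'w::ab_group_add \<Rightarrow> 'w" and V +
  fixes k m :: nat and \<Gamma> :: "('v, 'f) form set" and \<rho> :: "(nat \<Rightarrow> 'v) \<Rightarrow> 'f"
  assumes k_pos: "k \<ge> 1" and forms_\<Gamma>: "forms (Suc k) \<Gamma>" and card_\<Gamma>: "card \<Gamma> \<le> m"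
    and form_\<rho>: "form (Suc k) {1..Suc k} \<rho>"
    and rank: "rank_cond (Suc k) (req (Suc k) m) \<Gamma> \<rho>"
begin

section \<open>Linear independence of slices modulo low rank\<close>

abbreviation W :: "'v set" where "W \<equiv> V (Suc k)"

definition A :: "((nat \<Rightarrow> 'v) \<Rightarrow> 'f) set" where
  "A = fun_space.span (full (Suc k) \<Gamma>)"

text \<open>Forms that do not involve the last coordinate look the same in every slice. They enter a
  relation between slices once, as \<open>g\<close> in \<open>ind\<close>, evaluated with last
  coordinate 0.\<close>

definition C :: "((nat \<Rightarrow> 'v) \<Rightarrow> 'f) set" where
  "C = fun_space.span {f. ({1..k}, f) \<in> \<Gamma>}"

definition comb :: "'f \<Rightarrow> ((nat \<Rightarrow> 'v) \<Rightarrow> 'f) \<Rightarrow> 'v \<Rightarrow> (nat \<Rightarrow> 'v) \<Rightarrow> 'f" where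
  "comb t a b x = t * \<rho> (x(Suc k := b)) + a (x(Suc k := b))"

text \<open>The threshold is the one demanded of a slice that is accompanied by
  \<open>3 * m + 2\<close> forms.\<close>

definition high_rank :: "((nat \<Rightarrow> 'v) \<Rightarrow> 'f) \<Rightarrow> bool" where
  "high_rank f \<longleftrightarrow> CARD('f) ^ req k (3 * m + 2) * null_count k f < total_count k"

text \<open>Linear independence of three slices of \<open>\<rho>\<close> modulo forms of low rank.
  The separate perturbations \<open>a1\<close>, \<open>a2\<close>, \<open>a3\<close> keep it stable
  under invertible changes such as replacing \<open>b\<close> by \<open>b + c\<close>, because full
  forms are additive in the last coordinate too.\<close>

definition ind :: "'v \<Rightarrow> 'v \<Rightarrow> 'v \<Rightarrow> bool" where
  "ind b c d \<longleftrightarrow> (\<forall>t1 t2 t3. \<forall>a1\<in>A. \<forall>a2\<in>A. \<forall>a3\<in>A. \<forall>g\<in>C. t1 \<noteq> 0 \<or> t2 \<noteq> 0 \<or> t3 \<noteq> 0 \<longrightarrow>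
     high_rank (\<lambda>x. comb t1 a1 b x + comb t2 a2 c x + comb t3 a3 d x + g (x(Suc k := 0))))"

lemma finite_\<Gamma>: "finite \<Gamma>"
  using forms_\<Gamma> by (simp add: forms_def)

lemma A_form: "a \<in> A \<Longrightarrow> form (Suc k) {1..Suc k} a"
  unfolding A_def using forms_\<Gamma> by (rule_tac form_span) (auto simp: full_def forms_def)

lemma A_simps: "0 \<in> A" "a \<in> A \<Longrightarrow> b \<in> A \<Longrightarrow> a + b \<in> A" "a \<in> A \<Longrightarrow> b \<in> A \<Longrightarrow> a - b \<in> A"
  "a \<in> A \<Longrightarrow> (\<lambda>x. c * a x) \<in> A"
  unfolding A_def using fun_space.span_zero fun_space.span_add fun_space.span_diff fun_space.span_scale by blast+

lemma C_simps: "0 \<in> C" "a \<in> C \<Longrightarrow> b \<in> C \<Longrightarrow> a + b \<in> C" "a \<in> C \<Longrightarrow> (\<lambda>x. c * a x) \<in> C"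
  unfolding C_def using fun_space.span_zero fun_space.span_add fun_space.span_scale by blast+

lemma card_index_le: "finite {f. (J, f) \<in> \<Gamma>} \<and> card {f. (J, f) \<in> \<Gamma>} \<le> m"
proof -
  have "{f. (J, f) \<in> \<Gamma>} \<subseteq> snd ` \<Gamma>" by force
  moreover have "card (snd ` \<Gamma>) \<le> card \<Gamma>" using finite_\<Gamma> by (rule card_image_le)
  ultimately show ?thesis
    using finite_\<Gamma> card_\<Gamma> by (meson card_mono finite_imageI finite_subset order_trans)
qed

lemma card_A: "finite A \<and> card A \<le> CARD('f) ^ m"
proof -
  have "finite A \<and> card A \<le> CARD('f) ^ card (full (Suc k) \<Gamma>)"
    unfolding A_def using card_index_le by (intro fun_space.card_span_le) (auto simp: full_def)
  moreover have "CARD('f) ^ card (full (Suc k) \<Gamma>) \<le> CARD('f) ^ m"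
    using card_index_le card_field_ge_2 by (intro power_increasing) (auto simp: full_def)
  ultimately show ?thesis by linarith
qed

lemma card_C: "finite C \<and> card C \<le> CARD('f) ^ m"
proof -
  have "finite C \<and> card C \<le> CARD('f) ^ card {f. ({1..k}, f) \<in> \<Gamma>}"
    unfolding C_def using card_index_le by (intro fun_space.card_span_le) auto
  moreover have "CARD('f) ^ card {f. ({1..k}, f) \<in> \<Gamma>} \<le> CARD('f) ^ m"
    using card_index_le card_field_ge_2 by (intro power_increasing) auto
  ultimately show ?thesis by linarith
qed

lemma comb_form: "a \<in> A \<Longrightarrow> form (Suc k) {1..Suc k} (\<lambda>x. t * \<rho> x + a x)"
  using form_fun_add[OF form_fun_scale[OF form_\<rho>, of t] A_form] by (simp add: plus_fun_def)

lemma comb_add_pt: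
  assumes "a \<in> A" "x \<in> points k" "b \<in> W" "c \<in> W"
  shows "comb t a (b + c) x = comb t a b x + comb t a c x"
  using form_add[OF comb_form[OF assms(1)], of "Suc k" x b c t] points_Suc assms by (simp add: comb_def)

lemma comb_scale_pt:
  assumes "a \<in> A" "x \<in> points k" "b \<in> W"
  shows "comb t a (sG s b) x = s * comb t a b x"
  using form_scale[OF comb_form[OF assms(1)], of "Suc k" x b t s] points_Suc assms by (simp add: comb_def)

lemma comb_plus: "comb (t + t') (a + a') b x = comb t a b x + comb t' a' b x"
  by (simp add: comb_def algebra_simps)

lemma comb_times: "comb (s * t) (\<lambda>x. s * a x) b x = s * comb t a b x"
  by (simp add: comb_def algebra_simps)

lemma high_rank_cong: "(\<And>x. x \<in> points k \<Longrightarrow> f x = g x) \<Longrightarrow> high_rank f \<Longrightarrow> high_rank g"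
  unfolding high_rank_def using null_count_cong[OF k_pos] by metis

lemma indD:
  assumes "ind b c d" "a1 \<in> A" "a2 \<in> A" "a3 \<in> A" "g \<in> C" "t1 \<noteq> 0 \<or> t2 \<noteq> 0 \<or> t3 \<noteq> 0"
  shows "high_rank (\<lambda>x. comb t1 a1 b x + comb t2 a2 c x + comb t3 a3 d x + g (x(Suc k := 0)))"
  using assms unfolding ind_def by blast

lemma ind_swap12:
  assumes "ind b c d" shows "ind c b d"
  unfolding ind_def
proof (intro allI ballI impI)
  fix t1 t2 t3 :: 'f and a1 a2 a3 g
  assume *: "a1 \<in> A" "a2 \<in> A" "a3 \<in> A" "g \<in> C" "t1 \<noteq> 0 \<or> t2 \<noteq> 0 \<or> t3 \<noteq> 0"
  have "high_rank (\<lambda>x. comb t2 a2 b x + comb t1 a1 c x + comb t3 a3 d x + g (x(Suc k := 0)))"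
    using assms * by (intro indD) auto
  then show "high_rank (\<lambda>x. comb t1 a1 c x + comb t2 a2 b x + comb t3 a3 d x + g (x(Suc k := 0)))"
    by (rule high_rank_cong[rotated]) simp
qed

lemma ind_swap23:
  assumes "ind b c d" shows "ind b d c"
  unfolding ind_def
proof (intro allI ballI impI)
  fix t1 t2 t3 :: 'f and a1 a2 a3 g
  assume *: "a1 \<in> A" "a2 \<in> A" "a3 \<in> A" "g \<in> C" "t1 \<noteq> 0 \<or> t2 \<noteq> 0 \<or> t3 \<noteq> 0"
  have "high_rank (\<lambda>x. comb t1 a1 b x + comb t3 a3 c x + comb t2 a2 d x + g (x(Suc k := 0)))"
    using assms * by (intro indD) auto
  then show "high_rank (\<lambda>x. comb t1 a1 b x + comb t2 a2 d x + comb t3 a3 c x + g (x(Suc k := 0)))"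
    by (rule high_rank_cong[rotated]) simp
qed

lemma ind_scale1:
  assumes "ind b c d" "s \<noteq> 0" "b \<in> W" shows "ind (sG s b) c d"
  unfolding ind_def
proof (intro allI ballI impI)
  fix t1 t2 t3 :: 'f and a1 a2 a3 g
  assume *: "a1 \<in> A" "a2 \<in> A" "a3 \<in> A" "g \<in> C" "t1 \<noteq> 0 \<or> t2 \<noteq> 0 \<or> t3 \<noteq> 0"
  have "high_rank (\<lambda>x. comb (s * t1) (\<lambda>x. s * a1 x) b x + comb t2 a2 c x + comb t3 a3 d x + g (x(Suc k := 0)))"
    using assms * A_simps by (intro indD) auto
  then show "high_rank (\<lambda>x. comb t1 a1 (sG s b) x + comb t2 a2 c x + comb t3 a3 d x + g (x(Suc k := 0)))"
    by (rule high_rank_cong[rotated]) (use * assms in \<open>simp add: comb_times comb_scale_pt\<close>)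
qed

text \<open>The slice at \<open>b + c\<close> splits into a sum, so the coefficients become
  \<open>t1\<close>, \<open>t1 + t2\<close>, \<open>t3\<close>: an invertible substitution, which
  keeps a nonzero vector nonzero.\<close>

lemma ind_add1:
  assumes "ind b c d" "b \<in> W" "c \<in> W" shows "ind (b + c) c d"
  unfolding ind_def
proof (intro allI ballI impI)
  fix t1 t2 t3 :: 'f and a1 a2 a3 g
  assume *: "a1 \<in> A" "a2 \<in> A" "a3 \<in> A" "g \<in> C" "t1 \<noteq> 0 \<or> t2 \<noteq> 0 \<or> t3 \<noteq> 0"
  have "high_rank (\<lambda>x. comb t1 a1 b x + comb (t1 + t2) (a1 + a2) c x + comb t3 a3 d x + g (x(Suc k := 0)))"
    using assms(1) *(1) A_simps(2)[OF *(1,2)] *(3,4)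
    by (rule indD) (use *(5) in auto)
  then show "high_rank (\<lambda>x. comb t1 a1 (b + c) x + comb t2 a2 c x + comb t3 a3 d x + g (x(Suc k := 0)))"
    by (rule high_rank_cong[rotated]) (use * assms in \<open>simp add: comb_plus comb_add_pt\<close>)
qed

lemma ind_add2: "ind b c d \<Longrightarrow> b \<in> W \<Longrightarrow> c \<in> W \<Longrightarrow> ind b (b + c) d"
  by (metis add.commute ind_add1 ind_swap12)

lemma ind_scale2: "ind b c d \<Longrightarrow> s \<noteq> 0 \<Longrightarrow> c \<in> W \<Longrightarrow> ind b (sG s c) d"
  by (metis ind_scale1 ind_swap12)

lemma ind_diff2:
  assumes "ind b c d" "b \<in> W" "c \<in> W" shows "ind b (c - b) d"
proof -
  have "ind (sG (-1) b) (sG (-1) b + c) d"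
    using assms by (intro ind_add2 ind_scale1) auto
  then have "ind (sG (-1) (sG (-1) b)) (sG (-1) b + c) d"
    by (rule ind_scale1) (use assms in auto)
  then show ?thesis by simp
qed

subsection \<open>Almost all triples are independent\<close>

text \<open>The null counts over all \<open>d\<close> add up to at most that of
  \<open>t * \<rho> + a\<close> one level higher, and each \<open>d\<close> of low rank contributes
  a large share of it. The slack in \<open>req_Suc\<close> is the resulting bound.\<close>

lemma card_low_rank_le:
  assumes "t \<noteq> 0" "a \<in> A"
  shows "card {d \<in> W. \<not> high_rank (\<lambda>x. \<gamma> x + comb t a d x)} * CARD('f) ^ (16 * (m + 1)) \<le> card W"
proof -
  let ?e = "req k (3 * m + 2)"
  let ?X = "{d \<in> W. \<not> high_rank (\<lambda>x. \<gamma> x + comb t a d x)}"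
  let ?F = "\<lambda>x. t * \<rho> x + a x"
  \<comment> \<open>Dividing by \<open>t\<close> gives coefficient 1 at \<open>\<rho>\<close>, the
    case that the rank hypothesis covers.\<close>
  have "?F = (\<lambda>x. t * (\<rho> + (\<lambda>x. inverse t * a x)) x)"
    using assms(1) by (auto simp: fun_eq_iff algebra_simps)
  then have "null_count (Suc k) ?F = null_count (Suc k) (\<rho> + (\<lambda>x. inverse t * a x))"
    using null_count_scale[OF assms(1)] by metis
  moreover have "(\<lambda>x. inverse t * a x) \<in> fun_space.span (full (Suc k) \<Gamma>)"
    using A_simps(4)[OF assms(2)] by (simp add: A_def)
  ultimately have F: "CARD('f) ^ req (Suc k) m * null_count (Suc k) ?F < total_count (Suc k)"
    using rank unfolding rank_cond_def by metis
  have "card ?X * total_count k = (\<Sum>d\<in>?X. total_count k)" by simp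
  also have "\<dots> \<le> (\<Sum>d\<in>?X. CARD('f) ^ ?e * null_count k (\<lambda>x. \<gamma> x + comb t a d x))"
    by (rule sum_mono) (auto simp: high_rank_def)
  also have "\<dots> \<le> (\<Sum>d\<in>W. CARD('f) ^ ?e * null_count k (\<lambda>x. \<gamma> x + comb t a d x))"
    by (intro sum_mono2) auto
  also have "\<dots> = CARD('f) ^ ?e * (\<Sum>d\<in>W. null_count k (\<lambda>x. \<gamma> x + ?F (x(Suc k := d))))"
    by (simp add: sum_distrib_left comb_def)
  also have "\<dots> \<le> CARD('f) ^ ?e * null_count (Suc k) ?F"
    by (intro mult_le_mono2 sum_null_count_slice_le k_pos comb_form assms)
  finally have "card ?X * total_count k * CARD('f) ^ (16 * (m + 1)) \<le>
      CARD('f) ^ ?e * null_count (Suc k) ?F * CARD('f) ^ (16 * (m + 1))"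
    by (rule mult_le_mono1)
  also have "\<dots> = CARD('f) ^ (?e + 16 * (m + 1)) * null_count (Suc k) ?F"
    by (simp only: power_add mult_ac)
  also have "\<dots> \<le> CARD('f) ^ req (Suc k) m * null_count (Suc k) ?F"
    using req_Suc[OF k_pos] card_field_ge_2 by (intro mult_le_mono1 power_increasing) auto
  also have "\<dots> \<le> total_count k * card W" using F by (simp add: total_count_Suc[OF k_pos])
  finally have "total_count k * (card ?X * CARD('f) ^ (16 * (m + 1))) \<le> total_count k * card W"
    by (simp only: mult_ac)
  then show ?thesis using total_count_pos by simp
qed

text \<open>Some slice has a nonzero coefficient. The other two are frozen and absorbed, together
  with \<open>g\<close>, into the arbitrary \<open>\<gamma>\<close> of
  \<open>card_low_rank_le\<close>.\<close>

lemma card_low_rank_triples_le: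
  assumes "a1 \<in> A" "a2 \<in> A" "a3 \<in> A" "t1 \<noteq> 0 \<or> t2 \<noteq> 0 \<or> t3 \<noteq> 0"
  shows "card {(b, c, d). b \<in> W \<and> c \<in> W \<and> d \<in> W \<and>
      \<not> high_rank (\<lambda>x. comb t1 a1 b x + comb t2 a2 c x + comb t3 a3 d x + g (x(Suc k := 0)))}
    * CARD('f) ^ (16 * (m + 1)) \<le> card W ^ 3"
  using assms(4)
proof (elim disjE)
  assume t: "t3 \<noteq> 0"
  show ?thesis
  proof (rule card_triples_le)
    fix b c
    show "card {d \<in> W. \<not> high_rank (\<lambda>x. comb t1 a1 b x + comb t2 a2 c x + comb t3 a3 d x + g (x(Suc k := 0)))}
      * CARD('f) ^ (16 * (m + 1)) \<le> card W"
      using card_low_rank_le[OF t assms(3), of "\<lambda>x. comb t1 a1 b x + comb t2 a2 c x + g (x(Suc k := 0))"]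
      by (simp add: algebra_simps)
  qed simp
next
  assume t: "t1 \<noteq> 0"
  show ?thesis
  proof (subst card_rotate, rule card_triples_le)
    fix c d
    show "card {b \<in> W. \<not> high_rank (\<lambda>x. comb t1 a1 b x + comb t2 a2 c x + comb t3 a3 d x + g (x(Suc k := 0)))}
      * CARD('f) ^ (16 * (m + 1)) \<le> card W"
      using card_low_rank_le[OF t assms(1), of "\<lambda>x. comb t2 a2 c x + comb t3 a3 d x + g (x(Suc k := 0))"]
      by (simp add: algebra_simps)
  qed simp
next
  assume t: "t2 \<noteq> 0"
  show ?thesis
  proof (subst card_rotate, subst card_rotate, rule card_triples_le)
    fix d b
    show "card {c \<in> W. \<not> high_rank (\<lambda>x. comb t1 a1 b x + comb t2 a2 c x + comb t3 a3 d x + g (x(Suc k := 0)))}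
      * CARD('f) ^ (16 * (m + 1)) \<le> card W"
      using card_low_rank_le[OF t assms(2), of "\<lambda>x. comb t1 a1 b x + comb t3 a3 d x + g (x(Suc k := 0))"]
      by (simp add: algebra_simps)
  qed simp
qed

text \<open>Union bound over all relations: three scalars, three elements of \<open>A\<close> and
  one of \<open>C\<close> give at most \<open>CARD('f) ^ (4 * m + 3)\<close> of them, and
  \<open>16 * (m + 1)\<close> exceeds \<open>4 * m + 3\<close> by
  \<open>12 * m + 13\<close>.\<close>

lemma card_dependent_triples_le:
  "card {(b, c, d). b \<in> W \<and> c \<in> W \<and> d \<in> W \<and> \<not> ind b c d} * CARD('f) ^ (12 * m + 13) \<le> card W ^ 3"
proof -
  define P where "P = ((UNIV :: 'f set) \<times> (UNIV :: 'f set) \<times> (UNIV :: 'f set) - {(0, 0, 0)}) \<times> A \<times> A \<times> A \<times> C"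
  define T where "T = (\<lambda>((t1, t2, t3), a1, a2, a3, g). {(b, c, d). b \<in> W \<and> c \<in> W \<and> d \<in> W \<and>
      \<not> high_rank (\<lambda>x. comb t1 a1 b x + comb t2 a2 c x + comb t3 a3 d x + g (x(Suc k := 0)))})"
  let ?Q = "CARD('f) ^ (16 * (m + 1))"
  have finP: "finite P" using card_A card_C by (auto simp: P_def)
  have finT: "finite (T p)" for p
    by (rule finite_subset[of _ "W \<times> W \<times> W"]) (auto simp: T_def split: prod.splits)
  have cardT: "card (T p) * ?Q \<le> card W ^ 3" if "p \<in> P" for p
  proof -
    obtain t1 t2 t3 a1 a2 a3 g where p: "p = ((t1, t2, t3), a1, a2, a3, g)" by (metis prod.exhaust)
    then have "a1 \<in> A" "a2 \<in> A" "a3 \<in> A" "t1 \<noteq> 0 \<or> t2 \<noteq> 0 \<or> t3 \<noteq> 0"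
      using that by (auto simp: P_def)
    from card_low_rank_triples_le[OF this] show ?thesis by (simp only: p T_def prod.case)
  qed
  have "card P \<le> card ((UNIV :: 'f set) \<times> (UNIV :: 'f set) \<times> (UNIV :: 'f set)) * (card A * (card A * (card A * card C)))"
    unfolding P_def card_cartesian_product by (intro mult_le_mono1 card_mono) auto
  also have "\<dots> \<le> CARD('f) ^ 3 * (CARD('f) ^ m * (CARD('f) ^ m * (CARD('f) ^ m * CARD('f) ^ m)))"
    using card_A card_C by (intro mult_le_mono) (auto simp: card_cartesian_product power3_eq_cube)
  also have "\<dots> = CARD('f) ^ (4 * m + 3)"
    by (simp add: power_add[symmetric] algebra_simps)
  finally have cardP: "card P \<le> CARD('f) ^ (4 * m + 3)" .
  let ?D = "{(b, c, d). b \<in> W \<and> c \<in> W \<and> d \<in> W \<and> \<not> ind b c d}"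
  have "?D \<subseteq> (\<Union>p\<in>P. T p)"
  proof
    fix y assume "y \<in> ?D"
    then obtain b c d where y: "y = (b, c, d)" "b \<in> W" "c \<in> W" "d \<in> W" "\<not> ind b c d" by blast
    then obtain t1 t2 t3 a1 a2 a3 g where *: "a1 \<in> A" "a2 \<in> A" "a3 \<in> A" "g \<in> C"
      "t1 \<noteq> 0 \<or> t2 \<noteq> 0 \<or> t3 \<noteq> 0"
      "\<not> high_rank (\<lambda>x. comb t1 a1 b x + comb t2 a2 c x + comb t3 a3 d x + g (x(Suc k := 0)))"
      unfolding ind_def by blast
    then have "((t1, t2, t3), a1, a2, a3, g) \<in> P" by (auto simp: P_def)
    moreover have "y \<in> T ((t1, t2, t3), a1, a2, a3, g)" using y * by (simp add: T_def)
    ultimately show "y \<in> (\<Union>p\<in>P. T p)" by blast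
  qed
  then have "card ?D \<le> card (\<Union>p\<in>P. T p)" using finP finT by (intro card_mono) auto
  also have "\<dots> \<le> (\<Sum>p\<in>P. card (T p))" using finP by (rule card_UN_le)
  finally have "card ?D * ?Q \<le> (\<Sum>p\<in>P. card (T p) * ?Q)"
    by (simp add: sum_distrib_right[symmetric])
  also have "\<dots> \<le> (\<Sum>p\<in>P. card W ^ 3)" by (intro sum_mono cardT)
  also have "\<dots> \<le> CARD('f) ^ (4 * m + 3) * card W ^ 3" using cardP by simp
  finally have "card ?D * CARD('f) ^ (12 * m + 13) * CARD('f) ^ (4 * m + 3) \<le> card W ^ 3 * CARD('f) ^ (4 * m + 3)"
    by (simp add: power_add[symmetric] mult.assoc) (simp add: algebra_simps)
  then show ?thesis by simp
qed

subsection \<open>Generic last coordinates\<close>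

text \<open>The exponent is tied to \<open>fib_pick\<close>: four such sets cannot cover a set whose
  density is at least the \<open>-(2 * m + 1)\<close>-th power of \<open>CARD('f)\<close>.\<close>

definition small :: "'v set \<Rightarrow> bool" where
  "small X \<longleftrightarrow> card X * CARD('f) ^ (2 * m + 4) \<le> card W"

definition fib :: "(nat \<Rightarrow> 'v) \<Rightarrow> 'v set" where
  "fib x = {b \<in> W. x(Suc k := b) \<in> variety (Suc k) \<Gamma>}"

lemma fib_W: "b \<in> fib x \<Longrightarrow> b \<in> W"
  by (simp add: fib_def)

lemma fib_add: "b \<in> fib x \<Longrightarrow> c \<in> fib x \<Longrightarrow> b + c \<in> fib x"
  using variety_add[OF forms_\<Gamma>, of "Suc k" x b c] by (auto simp: fib_def)

lemma fib_diff: "b \<in> fib x \<Longrightarrow> c \<in> fib x \<Longrightarrow> b - c \<in> fib x"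
  using variety_diff[OF forms_\<Gamma>, of "Suc k" x b c] by (auto simp: fib_def)

lemma fib_scale: "b \<in> fib x \<Longrightarrow> sG s b \<in> fib x"
  using variety_scale[OF forms_\<Gamma>, of "Suc k" x b s] by (auto simp: fib_def)

lemma fib_slices: "b \<in> W \<Longrightarrow> x \<in> points k \<Longrightarrow> x \<in> variety k (slices k b \<Gamma>) \<longleftrightarrow> b \<in> fib x"
  by (simp add: fib_def variety_slices)

text \<open>A nonempty slice of the variety contains the zero point. Hence the fibre of the zero
  point collects all last coordinates that occur.\<close>

lemma fib_zero: "b \<in> fib x \<Longrightarrow> x \<in> points k \<Longrightarrow> b \<in> fib (zero_pt k)"
  using fib_slices zero_pt_variety[OF forms_slices[OF forms_\<Gamma>]] by (metis fib_W zero_pt_points)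

lemma W_pos: "card W > 0"
  using V_simps(1) finite_V by (metis card_gt_0_iff empty_iff)

text \<open>The set on the right contains the common kernel of at most \<open>2 * m + 1\<close>
  additive functions on \<open>W\<close>: the forms over \<open>x\<close>, the forms over
  \<open>y\<close>, and \<open>\<rho>\<close> over \<open>x\<close>.\<close>

lemma card_fib_le:
  assumes x: "x \<in> points k" "fib x \<noteq> {}" and y: "y \<in> points k" "fib y \<noteq> {}"
  shows "card W \<le> CARD('f) ^ (2 * m + 1) * card {b \<in> fib x \<inter> fib y. \<rho> (x(Suc k := b)) = 0}"
proof -
  \<comment> \<open>A form that does not involve the last coordinate is constant in \<open>b\<close>
    and is replaced by the zero function; the nonempty fibre shows that the constant is 0.\<close>
  define \<Psi> where "\<Psi> z = (\<lambda>(I, f) b. if Suc k \<in> I then f (z(Suc k := b)) else (0::'f)) ` \<Gamma>" for z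
  let ?\<Phi> = "insert (\<lambda>b. \<rho> (x(Suc k := b))) (\<Psi> x \<union> \<Psi> y)"
  have fin: "finite (\<Psi> z)" "card (\<Psi> z) \<le> m" for z
    using finite_\<Gamma> card_\<Gamma> card_image_le[OF finite_\<Gamma>] unfolding \<Psi>_def by (auto intro: order_trans)
  have card: "card ?\<Phi> \<le> 2 * m + 1"
    using fin[of x] fin[of y] card_Un_le[of "\<Psi> x" "\<Psi> y"] by (auto simp: card_insert_if)
  have "card W \<le> CARD('f) ^ card ?\<Phi> * card {b \<in> W. \<forall>f\<in>?\<Phi>. f b = 0}"
  proof (rule card_additive_le_common_ker)
    fix f u v assume f: "f \<in> ?\<Phi>" and uv: "u \<in> W" "v \<in> W"
    have \<Psi>: "f (u - v) = f u - f v" if "f \<in> \<Psi> z" "z \<in> points k" for z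
      using that uv forms_\<Gamma> points_Suc form_diff[of "Suc k" _ _ "Suc k" z u v]
      unfolding \<Psi>_def forms_def by fastforce
    show "f (u - v) = f u - f v"
      using f \<Psi> x y form_diff[OF form_\<rho>, of "Suc k" x u v] points_Suc uv by auto
  qed (use fin in auto)
  also have "\<dots> \<le> CARD('f) ^ (2 * m + 1) * card {b \<in> W. \<forall>f\<in>?\<Phi>. f b = 0}"
    using card card_field_ge_2 by (intro mult_le_mono1 power_increasing) auto
  also have "{b \<in> W. \<forall>f\<in>?\<Phi>. f b = 0} \<subseteq> {b \<in> fib x \<inter> fib y. \<rho> (x(Suc k := b)) = 0}"
  proof -
    have "b \<in> fib z" if b: "b \<in> W" "\<forall>f\<in>\<Psi> z. f b = 0" and z: "z \<in> points k" "fib z \<noteq> {}" for z b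
    proof -
      obtain c where c: "c \<in> fib z" using z by auto
      have "f (z(Suc k := b)) = 0" if f: "(I, f) \<in> \<Gamma>" for I f
      proof (cases "Suc k \<in> I")
        case True
        then show ?thesis using b(2) f unfolding \<Psi>_def by force
      next
        case False
        then have "f (z(Suc k := b)) = f (z(Suc k := c))"
          using f forms_\<Gamma> b c fib_W z points_Suc by (intro form_indep[of "Suc k" I]) (auto simp: forms_def)
        then show ?thesis using c f by (auto simp: fib_def variety_def)
      qed
      then show ?thesis using b z points_Suc by (auto simp: fib_def variety_def)
    qed
    then show ?thesis using x y by auto
  qed
  then have "card {b \<in> W. \<forall>f\<in>?\<Phi>. f b = 0} \<le> card {b \<in> fib x \<inter> fib y. \<rho> (x(Suc k := b)) = 0}"
    by (intro card_mono) (auto simp: fib_def)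
  finally show ?thesis by simp
qed

text \<open>Since \<open>CARD('f) ^ 3 \<ge> 8\<close>, four small sets have at most half the size
  that \<open>card_fib_le\<close> guarantees. Four is the number that
  \<open>\<psi>'_difference_const\<close> consumes.\<close>

lemma fib_pick:
  assumes x: "x \<in> points k" "fib x \<noteq> {}" and y: "y \<in> points k" "fib y \<noteq> {}"
    and small: "small X1" "small X2" "small X3" "small X4"
    and sub: "X1 \<subseteq> W" "X2 \<subseteq> W" "X3 \<subseteq> W" "X4 \<subseteq> W"
  obtains b where "b \<in> fib x" "b \<in> fib y" "\<rho> (x(Suc k := b)) = 0"
    "b \<notin> X1" "b \<notin> X2" "b \<notin> X3" "b \<notin> X4"
proof -
  let ?F = "{b \<in> fib x \<inter> fib y. \<rho> (x(Suc k := b)) = 0}"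
  let ?X = "X1 \<union> X2 \<union> X3 \<union> X4"
  have "card ?X \<le> card X1 + card X2 + card X3 + card X4"
    by (meson card_Un_le add_le_mono order_refl order_trans)
  then have "card ?X * CARD('f) ^ (2 * m + 4) \<le>
      (card X1 + card X2 + card X3 + card X4) * CARD('f) ^ (2 * m + 4)" by (rule mult_le_mono1)
  also have "\<dots> \<le> 4 * card W" using small by (simp add: small_def algebra_simps)
  also have "\<dots> \<le> 4 * (CARD('f) ^ (2 * m + 1) * card ?F)" using card_fib_le[OF x y] by simp
  finally have "CARD('f) ^ (2 * m + 1) * (card ?X * CARD('f) ^ 3) \<le> CARD('f) ^ (2 * m + 1) * (4 * card ?F)"
    by (simp add: power_add power3_eq_cube algebra_simps numeral_eq_Suc)
  then have "card ?X * CARD('f) ^ 3 \<le> 4 * card ?F" by simp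
  moreover have "8 \<le> CARD('f) ^ 3"
    using power_mono[OF card_field_ge_2, of 3] by simp
  then have "card ?X * 8 \<le> card ?X * CARD('f) ^ 3" by (rule mult_le_mono2)
  moreover have "card ?F > 0"
  proof (rule gr0I)
    assume "card ?F = 0"
    then have "card W \<le> CARD('f) ^ (2 * m + 1) * 0" using card_fib_le[OF x y] by (simp only:)
    then show False using W_pos by simp
  qed
  ultimately have "card ?X < card ?F" by linarith
  moreover have "finite ?X" using sub finite_V by (meson finite_subset Un_least)
  ultimately have "\<not> ?F \<subseteq> ?X" by (metis card_mono not_less)
  then show ?thesis using that by blast
qed

lemma small_empty: "small {}"
  by (simp add: small_def)

text \<open>Two averaging steps pass from triples to pairs and from pairs to single coordinates.
  Each spends \<open>2 * m + 4\<close>: the exponent falls from \<open>12 * m + 13\<close> to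
  \<open>10 * m + 9\<close> and to \<open>8 * m + 5\<close>, which is still at least
  \<open>2 * m + 4\<close>.\<close>

lemma ex_generic_base:
  assumes "zero_pt (Suc k) \<in> variety (Suc k) \<Gamma>"
  obtains b0 where "b0 \<in> fib (zero_pt k)" "small {b \<in> W. \<not> small {c \<in> W. \<not> ind b0 b c}}"
proof -
  let ?q = "CARD('f)"
  let ?X = "{p \<in> W \<times> W. card {c \<in> W. \<not> ind (fst p) (snd p) c} * ?q ^ (2 * m + 4) > card W}"
  have "{(p, c). p \<in> W \<times> W \<and> c \<in> W \<and> \<not> ind (fst p) (snd p) c} =
      (\<lambda>(b, c, d). ((b, c), d)) ` {(b, c, d). b \<in> W \<and> c \<in> W \<and> d \<in> W \<and> \<not> ind b c d}"
    by force
  moreover have "inj (\<lambda>(b :: 'v, c :: 'v, d :: 'v). ((b, c), d))" by (auto simp: inj_def)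
  ultimately have "card {(p, c). p \<in> W \<times> W \<and> c \<in> W \<and> \<not> ind (fst p) (snd p) c} * ?q ^ (12 * m + 13) \<le> card (W \<times> W) * card W"
    using card_dependent_triples_le
    by (simp add: card_image inj_on_subset card_cartesian_product power3_eq_cube)
  moreover have "?q ^ (12 * m + 13) = ?q ^ (10 * m + 9) * ?q ^ (2 * m + 4)"
    by (simp add: power_add[symmetric])
  ultimately have "card ?X * ?q ^ (10 * m + 9) \<le> card (W \<times> W)"
    using W_pos by (intro card_exceptional_le) auto
  moreover have "?X = {(b, c). b \<in> W \<and> c \<in> W \<and> \<not> small {d \<in> W. \<not> ind b c d}}"
    by (auto simp: small_def)
  moreover have "?q ^ (10 * m + 9) = ?q ^ (8 * m + 5) * ?q ^ (2 * m + 4)"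
    by (simp add: power_add[symmetric])
  ultimately have "card {b \<in> W. card {c \<in> W. \<not> small {d \<in> W. \<not> ind b c d}} * ?q ^ (2 * m + 4) > card W} * ?q ^ (8 * m + 5) \<le> card W"
    using W_pos by (intro card_exceptional_le) (auto simp: card_cartesian_product)
  then have "card {b \<in> W. \<not> small {c \<in> W. \<not> small {d \<in> W. \<not> ind b c d}}} * ?q ^ (8 * m + 5) \<le> card W"
    by (simp add: small_def[of "{c \<in> W. _ c}"] not_le)
  moreover have "?q ^ (2 * m + 4) \<le> ?q ^ (8 * m + 5)"
    using card_field_ge_2 by (intro power_increasing) auto
  ultimately have sm: "small {b \<in> W. \<not> small {c \<in> W. \<not> small {d \<in> W. \<not> ind b c d}}}"
    unfolding small_def[of "{b \<in> W. _ b}"] by (meson mult_le_mono2 order_trans)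
  have ne: "fib (zero_pt k) \<noteq> {}"
    using assms V_simps(1)[of "Suc k"] unfolding fib_def zero_pt_Suc by blast
  let ?Y = "{b \<in> W. \<not> small {c \<in> W. \<not> small {d \<in> W. \<not> ind b c d}}}"
  have sub: "?Y \<subseteq> W" by blast
  obtain b0 where "b0 \<in> fib (zero_pt k)" "b0 \<notin> ?Y"
    by (rule fib_pick[OF zero_pt_points ne zero_pt_points ne sm small_empty small_empty small_empty
        sub empty_subsetI empty_subsetI empty_subsetI]) (rule that)
  then show ?thesis using that[of b0] fib_W[of b0 "zero_pt k"] by blast
qed

lemma small_shift:
  assumes "small {b \<in> W. \<not> P b}" "a \<in> W"
  shows "small {b \<in> W. \<not> P (a + b)}"
proof -
  have "card {b \<in> W. \<not> P (a + b)} \<le> card {b \<in> W. \<not> P b}"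
    using assms(2) by (intro card_inj_on_le[of "\<lambda>b. a + b"]) (auto simp: inj_on_def)
  then show ?thesis using assms(1) unfolding small_def by (meson mult_le_mono1 order_trans)
qed

subsection \<open>Slices at independent points\<close>

text \<open>The slices of \<open>\<rho>\<close> at \<open>b\<close> and \<open>c\<close> are
  adjoined to the forms, while the one at \<open>d\<close> takes over the role of
  \<open>\<rho>\<close>. A point of this variety with nonzero value there isolates the coefficient
  that belongs to \<open>d\<close>.\<close>

definition triple_forms :: "'v \<Rightarrow> 'v \<Rightarrow> 'v \<Rightarrow> ('v, 'f) form set" where
  "triple_forms b c d = slices k b \<Gamma> \<union> slices k c \<Gamma> \<union> slices k d \<Gamma> \<union>
     {({1..k}, slice k b \<rho>), ({1..k}, slice k c \<rho>)}"

lemma form_slice_\<rho>: "b \<in> W \<Longrightarrow> form k {1..k} (slice k b \<rho>)"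
proof -
  assume "b \<in> W"
  moreover have "{1..Suc k} - {Suc k} = {1..k}" by auto
  ultimately show ?thesis using form_slice[OF form_\<rho>] by metis
qed

lemma forms_triple: "b \<in> W \<Longrightarrow> c \<in> W \<Longrightarrow> d \<in> W \<Longrightarrow> forms k (triple_forms b c d)"
  unfolding triple_forms_def using forms_slices[OF forms_\<Gamma>] form_slice_\<rho>
  by (simp only: forms_Un forms_insert) (simp add: forms_def)

lemma card_triple: "card (triple_forms b c d) \<le> 3 * m + 2"
proof -
  have "card (slices k b \<Gamma>) \<le> m" for b
    using card_slices[OF finite_\<Gamma>] card_\<Gamma> order_trans by blast
  then have "card (slices k b \<Gamma> \<union> slices k c \<Gamma> \<union> slices k d \<Gamma>) \<le> m + m + m"
    using card_Un_le[of "slices k b \<Gamma> \<union> slices k c \<Gamma>" "slices k d \<Gamma>"]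
      card_Un_le[of "slices k b \<Gamma>" "slices k c \<Gamma>"] by (meson add_le_mono order_trans)
  moreover have "card {({1..k}, slice k b \<rho>), ({1..k}, slice k c \<rho>)} \<le> 2"
    by (simp add: card_insert_if)
  ultimately show ?thesis unfolding triple_forms_def
    using card_Un_le[of "slices k b \<Gamma> \<union> slices k c \<Gamma> \<union> slices k d \<Gamma>"
        "{({1..k}, slice k b \<rho>), ({1..k}, slice k c \<rho>)}"] by linarith
qed

lemma full_slices:
  assumes "f \<in> full k (slices k b \<Gamma>)"
  obtains g where "f = slice k b g" "g \<in> full (Suc k) \<Gamma> \<or> ({1..k}, g) \<in> \<Gamma>"
proof -
  obtain I g where g: "(I, g) \<in> \<Gamma>" "I - {Suc k} = {1..k}" "f = slice k b g"
    using assms by (auto simp: full_def slices_def)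
  have "form (Suc k) I g" using g(1) forms_\<Gamma> by (auto simp: forms_def)
  then have "I \<subseteq> {1..Suc k}" by (rule form_index)
  then have "I = {1..Suc k} \<or> I = {1..k}" using g(2)
    by (cases "Suc k \<in> I") (auto simp: atLeastAtMostSuc_conv)
  then show ?thesis using that g by (auto simp: full_def)
qed

text \<open>On points, every element of the span is a relation between the three slices in which the
  slice of \<open>\<rho>\<close> at \<open>d\<close> has coefficient 0. Adding that slice makes the
  coefficient 1, so independence applies.\<close>

lemma ind_rank_cond:
  assumes ind: "ind b c d" and W: "b \<in> W" "c \<in> W" "d \<in> W"
  shows "rank_cond k (req k (3 * m + 2)) (triple_forms b c d) (slice k d \<rho>)"
  unfolding rank_cond_def
proof
  fix \<gamma> assume \<gamma>: "\<gamma> \<in> fun_space.span (full k (triple_forms b c d))"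
  \<comment> \<open>Equality is asked on \<open>points k\<close> only: a form with index set
    \<open>{1..k}\<close> may be moved to last coordinate 0 there, but not as a function on all
    arguments.\<close>
  define rep where "rep \<gamma> t1 t2 a1 a2 a3 g \<longleftrightarrow> a1 \<in> A \<and> a2 \<in> A \<and> a3 \<in> A \<and> g \<in> C \<and>
      (\<forall>x\<in>points k. \<gamma> x = comb t1 a1 b x + comb t2 a2 c x + comb 0 a3 d x + g (x(Suc k := 0)))"
    for \<gamma> t1 t2 a1 a2 a3 g
  define U where "U = {\<gamma>. \<exists>t1 t2 a1 a2 a3 g. rep \<gamma> t1 t2 a1 a2 a3 g}"
  have UI: "\<gamma> \<in> U" if "rep \<gamma> t1 t2 a1 a2 a3 g" for \<gamma> t1 t2 a1 a2 a3 g
    using that unfolding U_def by blast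
  have "fun_space.subspace U"
    unfolding fun_space.subspace_def
  proof (intro conjI allI ballI)
    show "0 \<in> U" by (rule UI[of _ 0 0 0 0 0 0]) (simp add: rep_def A_simps C_simps comb_def)
    fix x y assume "x \<in> U" "y \<in> U"
    then obtain t1 t2 a1 a2 a3 g t1' t2' a1' a2' a3' g'
      where "rep x t1 t2 a1 a2 a3 g" "rep y t1' t2' a1' a2' a3' g'" by (auto simp: U_def)
    then have "rep (x + y) (t1 + t1') (t2 + t2') (a1 + a1') (a2 + a2') (a3 + a3') (g + g')"
      by (simp add: rep_def A_simps C_simps comb_def algebra_simps)
    then show "x + y \<in> U" by (rule UI)
  next
    fix s x assume "x \<in> U"
    then obtain t1 t2 a1 a2 a3 g where "rep x t1 t2 a1 a2 a3 g" by (auto simp: U_def)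
    then have "rep (\<lambda>y. s * x y) (s * t1) (s * t2) (\<lambda>y. s * a1 y) (\<lambda>y. s * a2 y) (\<lambda>y. s * a3 y) (\<lambda>y. s * g y)"
      by (simp add: rep_def A_simps C_simps comb_def algebra_simps)
    then show "(\<lambda>y. s * x y) \<in> U" by (rule UI)
  qed
  moreover have "full k (triple_forms b c d) \<subseteq> U"
  proof
    fix f assume "f \<in> full k (triple_forms b c d)"
    then consider "f \<in> full k (slices k b \<Gamma>)" | "f \<in> full k (slices k c \<Gamma>)" | "f \<in> full k (slices k d \<Gamma>)"
      | "f = slice k b \<rho>" | "f = slice k c \<rho>"
      by (auto simp: triple_forms_def full_def)
    moreover have low: "slice k v g x = g (x(Suc k := 0))"
      if "({1..k}, g) \<in> \<Gamma>" "v \<in> W" "x \<in> points k" for g v x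
      using that forms_\<Gamma> points_Suc form_indep[of "Suc k" "{1..k}" g "Suc k" x v 0]
      by (auto simp: slice_def forms_def)
    have AC: "g \<in> full (Suc k) \<Gamma> \<Longrightarrow> g \<in> A" "({1..k}, g) \<in> \<Gamma> \<Longrightarrow> g \<in> C" for g
      by (auto simp: A_def C_def intro: fun_space.span_base)
    ultimately show "f \<in> U"
    proof cases
      case 1
      then obtain g where g: "f = slice k b g" "g \<in> full (Suc k) \<Gamma> \<or> ({1..k}, g) \<in> \<Gamma>"
        using full_slices by metis
      from g(2) show ?thesis
      proof
        assume "g \<in> full (Suc k) \<Gamma>"
        then show ?thesis using g(1) AC
          by (intro UI[of _ 0 0 g 0 0 0]) (simp add: rep_def A_simps C_simps comb_def slice_def)
      next
        assume "({1..k}, g) \<in> \<Gamma>"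
        then show ?thesis using g(1) AC low W
          by (intro UI[of _ 0 0 0 0 0 g]) (simp add: rep_def A_simps C_simps comb_def)
      qed
    next
      case 2
      then obtain g where g: "f = slice k c g" "g \<in> full (Suc k) \<Gamma> \<or> ({1..k}, g) \<in> \<Gamma>"
        using full_slices by metis
      from g(2) show ?thesis
      proof
        assume "g \<in> full (Suc k) \<Gamma>"
        then show ?thesis using g(1) AC
          by (intro UI[of _ 0 0 0 g 0 0]) (simp add: rep_def A_simps C_simps comb_def slice_def)
      next
        assume "({1..k}, g) \<in> \<Gamma>"
        then show ?thesis using g(1) AC low W
          by (intro UI[of _ 0 0 0 0 0 g]) (simp add: rep_def A_simps C_simps comb_def)
      qed
    next
      case 3
      then obtain g where g: "f = slice k d g" "g \<in> full (Suc k) \<Gamma> \<or> ({1..k}, g) \<in> \<Gamma>"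
        using full_slices by metis
      from g(2) show ?thesis
      proof
        assume "g \<in> full (Suc k) \<Gamma>"
        then show ?thesis using g(1) AC
          by (intro UI[of _ 0 0 0 0 g 0]) (simp add: rep_def A_simps C_simps comb_def slice_def)
      next
        assume "({1..k}, g) \<in> \<Gamma>"
        then show ?thesis using g(1) AC low W
          by (intro UI[of _ 0 0 0 0 0 g]) (simp add: rep_def A_simps C_simps comb_def)
      qed
    next
      case 4
      then show ?thesis
        by (intro UI[of _ 1 0 0 0 0 0]) (simp add: rep_def A_simps C_simps comb_def slice_def)
    next
      case 5
      then show ?thesis
        by (intro UI[of _ 0 1 0 0 0 0]) (simp add: rep_def A_simps C_simps comb_def slice_def)
    qed
  qed
  ultimately have "\<gamma> \<in> U" using \<gamma> fun_space.span_minimal by blast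
  then obtain t1 t2 a1 a2 a3 g where r: "rep \<gamma> t1 t2 a1 a2 a3 g" by (auto simp: U_def)
  have "high_rank (\<lambda>x. comb t1 a1 b x + comb t2 a2 c x + comb 1 a3 d x + g (x(Suc k := 0)))"
    using r by (intro indD[OF ind]) (auto simp: rep_def)
  then have "high_rank (slice k d \<rho> + \<gamma>)"
    by (rule high_rank_cong[rotated]) (use r in \<open>simp add: rep_def comb_def slice_def\<close>)
  then show "CARD('f) ^ req k (3 * m + 2) * null_count k (slice k d \<rho> + \<gamma>) < total_count k"
    by (simp add: high_rank_def)
qed

lemma variety_triple:
  assumes "b \<in> W" "c \<in> W" "d \<in> W" "x \<in> variety k (triple_forms b c d)"
  shows "x \<in> points k" "b \<in> fib x" "c \<in> fib x" "d \<in> fib x"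
    "\<rho> (x(Suc k := b)) = 0" "\<rho> (x(Suc k := c)) = 0"
proof -
  show x: "x \<in> points k" using assms(4) by (rule variety_points)
  have *: "x \<in> variety k (slices k b \<Gamma>)" "x \<in> variety k (slices k c \<Gamma>)" "x \<in> variety k (slices k d \<Gamma>)"
    "slice k b \<rho> x = 0" "slice k c \<rho> x = 0"
    using assms(4) by (simp_all add: triple_forms_def variety_Un variety_insert)
  show "b \<in> fib x" "c \<in> fib x" "d \<in> fib x" using * x assms(1-3) fib_slices by blast+
  show "\<rho> (x(Suc k := b)) = 0" "\<rho> (x(Suc k := c)) = 0" using * by (simp_all add: slice_def)
qed

lemma zero_pt_triple:
  assumes "b \<in> fib (zero_pt k)" "c \<in> fib (zero_pt k)" "d \<in> fib (zero_pt k)"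
  shows "zero_pt k \<in> variety k (triple_forms b c d)"
proof -
  have "slice k b \<rho> (zero_pt k) = 0" if "b \<in> W" for b
    using form_zero_pt[OF form_slice_\<rho>[OF that]] k_pos by auto
  moreover have "zero_pt k \<in> variety k (slices k b \<Gamma>)" if "b \<in> fib (zero_pt k)" for b
    using that fib_slices fib_W zero_pt_points by blast
  ultimately show ?thesis using assms fib_W
    by (simp add: triple_forms_def variety_Un variety_insert)
qed

end

section \<open>Uniqueness of extensions\<close>

text \<open>Multiplication by a nonzero \<open>t\<close> permutes the nonzero elements, so comparing
  their products shows that \<open>t\<close> to the power \<open>CARD('f) - 1\<close> is 1. Used
  with the next lemma for homogeneity in the last coordinate.\<close>

lemma finite_field_power_card:
  fixes t :: "'f::{field,finite}"
  shows "t ^ CARD('f) = t"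
proof (cases "t = 0")
  case False
  let ?U = "UNIV - {0 :: 'f}"
  have "bij_betw ((*) t) ?U ?U"
    by (rule bij_betwI[where g = "\<lambda>x. x / t"]) (use False in auto)
  then have "(\<Prod>x\<in>?U. t * x) = \<Prod>?U" by (rule prod.reindex_bij_betw)
  then have "t ^ card ?U * \<Prod>?U = \<Prod>?U" by (simp add: prod.distrib)
  then have "(t ^ card ?U - 1) * \<Prod>?U = 0" by (simp only: left_diff_distrib mult_1 diff_self)
  moreover have "\<Prod>?U \<noteq> 0" by (subst prod_zero_iff) auto
  ultimately have "t ^ card ?U = 1" using mult_eq_0_iff right_minus_eq by blast
  moreover have "CARD('f) = Suc (card ?U)"
    using card_Suc_Diff1[of "UNIV :: 'f set" 0] by simp
  ultimately show ?thesis by (simp only: power_Suc mult_1_right)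
qed simp

lemma of_nat_card_eq_0: "(of_nat CARD('f) :: 'f::{field,finite}) = 0"
  using CHAR_dvd_CARD[where 'a = 'f] by (simp add: of_nat_eq_0_iff_char_dvd)

context finite_spaces
begin

section \<open>Multilinear maps, and the case of one coordinate\<close>

lemma ml_add:
  "ml D S \<phi> \<Longrightarrow> d \<in> D \<Longrightarrow> x(d := u) \<in> S \<Longrightarrow> x(d := v) \<in> S \<Longrightarrow>
    \<phi> (x(d := u + v)) = \<phi> (x(d := u)) + \<phi> (x(d := v))"
  unfolding mlin_def by blast

lemma ml_scale:
  "ml D S \<phi> \<Longrightarrow> d \<in> D \<Longrightarrow> x(d := u) \<in> S \<Longrightarrow> \<phi> (x(d := sG c u)) = sH c (\<phi> (x(d := u)))"
  unfolding mlin_def by blast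

lemma ml_fun_diff:
  assumes f: "ml D S f" and g: "ml D S g"
  shows "ml D S (\<lambda>x. f x - g x)"
  unfolding mlin_def
  by (intro conjI ballI allI impI)
    (simp_all add: ml_add[OF f] ml_add[OF g] ml_scale[OF f] ml_scale[OF g] H.scale_right_diff_distrib)

lemma ml_form:
  assumes "form k {1..k} \<rho>" "S \<subseteq> points k"
  shows "ml {1..k} S (\<lambda>x. sH (\<rho> x) h)"
  unfolding mlin_def
proof (intro conjI ballI allI impI)
  fix d x u v assume "d \<in> {1..k}" "x(d := u) \<in> S" "x(d := v) \<in> S"
  then have "\<rho> (x(d := u + v)) = \<rho> (x(d := u)) + \<rho> (x(d := v))"
    using assms(2) by (intro form_add[OF assms(1)]) auto
  then show "sH (\<rho> (x(d := u + v))) h = sH (\<rho> (x(d := u))) h + sH (\<rho> (x(d := v))) h"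
    by (simp add: H.scale_left_distrib)
next
  fix d x u c assume "d \<in> {1..k}" "x(d := u) \<in> S"
  then have "\<rho> (x(d := sG c u)) = c * \<rho> (x(d := u))"
    using assms(2) by (intro form_scale[OF assms(1)]) auto
  then show "sH (\<rho> (x(d := sG c u))) h = sH c (sH (\<rho> (x(d := u))) h)" by simp
qed

lemma points_0: "points 0 = {zero_pt 0}"
  by (auto simp: points_def zero_pt_def)

lemma points_1E:
  assumes "x \<in> points (Suc 0)"
  obtains u where "u \<in> V (Suc 0)" "x = (zero_pt 0)(Suc 0 := u)"
  using points_SucE[OF assms] points_0 by auto

lemma points_1: "u \<in> V (Suc 0) \<Longrightarrow> (zero_pt 0)(Suc 0 := u) \<in> points (Suc 0)"
  using points_Suc zero_pt_points by blast

text \<open>Linearity is expressed along a parametrisation \<open>e\<close>, so that forms remain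
  elements of the function space in which the span of \<open>full k \<Gamma>\<close> is
  taken.\<close>

definition linear_along :: "('v \<Rightarrow> 'p) \<Rightarrow> 'v set \<Rightarrow> ('p \<Rightarrow> 'f) \<Rightarrow> bool" where
  "linear_along e S f \<longleftrightarrow> (\<forall>u\<in>S. \<forall>v\<in>S. f (e (u + v)) = f (e u) + f (e v)) \<and>
     (\<forall>u\<in>S. \<forall>c. f (e (sG c u)) = c * f (e u))"

lemma linear_along_diff:
  assumes "linear_along e S f" "G.subspace S" "u \<in> S" "v \<in> S"
  shows "f (e (u - sG c v)) = f (e u) - c * f (e v)"
proof -
  have "f (e (u + sG (- c) v)) = f (e u) + f (e (sG (- c) v))"
    using assms G.subspace_scale[OF assms(2,4)] unfolding linear_along_def by blast
  also have "f (e (sG (- c) v)) = - c * f (e v)"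
    using assms unfolding linear_along_def by blast
  finally show ?thesis by simp
qed

lemma linear_along_span:
  assumes "\<And>f. f \<in> F \<Longrightarrow> linear_along e S f" "\<gamma> \<in> fun_space.span F"
  shows "linear_along e S \<gamma>"
proof -
  have "fun_space.subspace {f. linear_along e S f}"
    by (simp add: fun_space.subspace_def linear_along_def algebra_simps)
  then show ?thesis using assms fun_space.span_minimal[of F "{f. linear_along e S f}"] by blast
qed

text \<open>The standard fact that a functional vanishing on a common kernel lies in the span. The
  induction replaces \<open>S\<close> by the kernel of \<open>f\<close> in it; the sign matches
  \<open>\<rho> + \<gamma>\<close> in \<open>rank_cond\<close>.\<close>

lemma functional_in_span:
  assumes "finite F" "G.subspace S" "linear_along e S \<rho>" "\<And>f. f \<in> F \<Longrightarrow> linear_along e S f"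
    and "\<And>u. u \<in> S \<Longrightarrow> (\<And>f. f \<in> F \<Longrightarrow> f (e u) = 0) \<Longrightarrow> \<rho> (e u) = 0"
  shows "\<exists>\<gamma>\<in>fun_space.span F. \<forall>u\<in>S. \<rho> (e u) + \<gamma> (e u) = 0"
  using assms
proof (induction F arbitrary: S rule: finite_induct)
  case empty
  then show ?case by (intro bexI[of _ 0]) auto
next
  case (insert f F)
  define S' where "S' = {u \<in> S. f (e u) = 0}"
  have f: "linear_along e S f" using insert.prems by blast
  have sub': "G.subspace S'"
    unfolding G.subspace_def
  proof (intro conjI ballI allI)
    have "f (e (sG 0 0)) = 0 * f (e 0)"
      using f G.subspace_0[OF insert.prems(1)] unfolding linear_along_def by blast
    then show "0 \<in> S'" using G.subspace_0[OF insert.prems(1)] by (simp add: S'_def)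
    show "x + y \<in> S'" if "x \<in> S'" "y \<in> S'" for x y
      using that f G.subspace_add[OF insert.prems(1)] by (simp add: S'_def linear_along_def)
    show "sG c x \<in> S'" if "x \<in> S'" for c x
      using that f G.subspace_scale[OF insert.prems(1)] by (simp add: S'_def linear_along_def)
  qed
  have "\<exists>\<gamma>\<in>fun_space.span F. \<forall>u\<in>S'. \<rho> (e u) + \<gamma> (e u) = 0"
  proof (rule insert.IH[OF sub'])
    show "linear_along e S' \<rho>" using insert.prems(2) by (simp add: S'_def linear_along_def)
    show "linear_along e S' g" if "g \<in> F" for g
      using insert.prems(3)[of g] that by (simp add: S'_def linear_along_def)
    show "\<rho> (e u) = 0" if "u \<in> S'" "\<And>g. g \<in> F \<Longrightarrow> g (e u) = 0" for u
      using that by (intro insert.prems(4)) (auto simp: S'_def)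
  qed
  then obtain \<gamma> where \<gamma>: "\<gamma> \<in> fun_space.span F" "\<And>u. u \<in> S' \<Longrightarrow> \<rho> (e u) + \<gamma> (e u) = 0" by blast
  have \<gamma>': "\<gamma> \<in> fun_space.span (insert f F)"
    using \<gamma>(1) fun_space.span_mono[of F "insert f F"] by blast
  show ?case
  proof (cases "\<forall>u\<in>S. f (e u) = 0")
    case True
    then have "S' = S" by (auto simp: S'_def)
    then show ?thesis using \<gamma> \<gamma>' by blast
  next
    case False
    then obtain u0 where u0: "u0 \<in> S" "f (e u0) \<noteq> 0" by blast
    have lin: "linear_along e S \<gamma>"
      using \<gamma>(1) insert.prems(3) linear_along_span by blast
    \<comment> \<open>This makes \<open>\<rho> + \<gamma> + c * f\<close> vanish at
      \<open>u0\<close>. It also vanishes on the kernel of \<open>f\<close>, and the two span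
      \<open>S\<close>.\<close>
    define c where "c = - (\<rho> (e u0) + \<gamma> (e u0)) / f (e u0)"
    have "\<rho> (e u) + (\<gamma> + (\<lambda>x. c * f x)) (e u) = 0" if u: "u \<in> S" for u
    proof -
      let ?s = "f (e u) / f (e u0)"
      have "f (e (u - sG ?s u0)) = 0"
        using linear_along_diff[OF f insert.prems(1) u u0(1), of ?s] u0 by simp
      moreover have "u - sG ?s u0 \<in> S"
        using insert.prems(1) u u0(1) by (simp add: G.subspace_diff G.subspace_scale)
      ultimately have "\<rho> (e (u - sG ?s u0)) + \<gamma> (e (u - sG ?s u0)) = 0"
        using \<gamma>(2) by (simp add: S'_def)
      then have 1: "\<rho> (e u) + \<gamma> (e u) = ?s * (\<rho> (e u0) + \<gamma> (e u0))"
        using linear_along_diff[OF insert.prems(2,1) u u0(1), of ?s]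
          linear_along_diff[OF lin insert.prems(1) u u0(1), of ?s] by (simp add: algebra_simps)
      have 2: "c * f (e u) = - (?s * (\<rho> (e u0) + \<gamma> (e u0)))"
        by (simp add: c_def algebra_simps add_divide_distrib diff_divide_distrib)
      have "\<rho> (e u) + (\<gamma> + (\<lambda>x. c * f x)) (e u) = (\<rho> (e u) + \<gamma> (e u)) + c * f (e u)"
        by (simp add: add.assoc)
      also have "\<dots> = 0" by (simp only: 1 2 add.right_inverse)
      finally show ?thesis .
    qed
    moreover have "\<gamma> + (\<lambda>x. c * f x) \<in> fun_space.span (insert f F)"
      using fun_space.span_add[OF \<gamma>' fun_space.span_scale[OF fun_space.span_base[of f "insert f F"]]] by blast
    ultimately show ?thesis by blast
  qed
qed

lemma form_1_linear_along:
  assumes "form (Suc 0) {1..Suc 0} f"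
  shows "linear_along (\<lambda>u. (zero_pt 0)(Suc 0 := u)) (V (Suc 0)) f"
  using form_add[OF assms, of "Suc 0" "zero_pt 0"] form_scale[OF assms, of "Suc 0" "zero_pt 0"] points_1
  by (simp add: linear_along_def)

text \<open>If there were no such point, some \<open>\<rho> + \<gamma>\<close> would vanish
  identically and its null count would be the total count, against the rank condition.\<close>

lemma ex_nonzero_1:
  assumes "forms (Suc 0) \<Gamma>" "form (Suc 0) {1..Suc 0} \<rho>" "rank_cond (Suc 0) e \<Gamma> \<rho>"
    and zero: "zero_pt (Suc 0) \<in> variety (Suc 0) \<Gamma>"
  shows "\<exists>x\<in>variety (Suc 0) \<Gamma>. \<rho> x \<noteq> 0"
proof (rule ccontr)
  assume *: "\<not> ?thesis"
  let ?e = "\<lambda>u. (zero_pt 0)(Suc 0 := u)"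
  have "full (Suc 0) \<Gamma> \<subseteq> snd ` \<Gamma>" by (force simp: full_def)
  then have fin: "finite (full (Suc 0) \<Gamma>)"
    using assms(1) finite_subset by (auto simp: forms_def)
  have "\<exists>\<gamma>\<in>fun_space.span (full (Suc 0) \<Gamma>). \<forall>u\<in>V (Suc 0). \<rho> (?e u) + \<gamma> (?e u) = 0"
  proof (rule functional_in_span[OF fin subspace_V form_1_linear_along[OF assms(2)]])
    show "linear_along ?e (V (Suc 0)) f" if "f \<in> full (Suc 0) \<Gamma>" for f
      using that assms(1) by (intro form_1_linear_along) (auto simp: full_def forms_def)
    fix u assume u: "u \<in> V (Suc 0)" "\<And>f. f \<in> full (Suc 0) \<Gamma> \<Longrightarrow> f (?e u) = 0"
    have "f (?e u) = 0" if f: "(I, f) \<in> \<Gamma>" for I f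
    proof -
      have form: "form (Suc 0) I f" using f assms(1) by (auto simp: forms_def)
      then have "I = {1..Suc 0} \<or> I = {}" using form_index by fastforce
      then show ?thesis
      proof
        assume "I = {1..Suc 0}"
        then show ?thesis using u(2) f by (simp add: full_def)
      next
        assume "I = {}"
        then have "f (?e u) = f (zero_pt (Suc 0))"
          using form form_empty_const points_1[OF u(1)] zero_pt_points by blast
        then show ?thesis using zero f by (auto simp: variety_def)
      qed
    qed
    then have "?e u \<in> variety (Suc 0) \<Gamma>" using points_1[OF u(1)] by (auto simp: variety_def)
    then show "\<rho> (?e u) = 0" using * by blast
  qed
  then obtain \<gamma> where \<gamma>: "\<gamma> \<in> fun_space.span (full (Suc 0) \<Gamma>)"
    "\<And>u. u \<in> V (Suc 0) \<Longrightarrow> \<rho> (?e u) + \<gamma> (?e u) = 0" by blast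
  \<comment> \<open>\<open>{2..Suc 0}\<close> is empty, so \<open>null_count\<close> ranges over a
    single function, the everywhere undefined one.\<close>
  have z: "zero_pt 0 = (\<lambda>_. undefined)" by (simp add: zero_pt_def fun_eq_iff)
  have "{y \<in> Pi\<^sub>E {2..Suc 0} V. \<forall>a\<in>V 1. (\<rho> + \<gamma>) (y(1 := a)) = 0} = Pi\<^sub>E {2..Suc 0} V"
    using \<gamma>(2) by (auto simp: z)
  then have "null_count (Suc 0) (\<rho> + \<gamma>) = total_count (Suc 0)"
    by (simp only: null_count_def total_count_def)
  moreover have "CARD('f) ^ e * null_count (Suc 0) (\<rho> + \<gamma>) < total_count (Suc 0)"
    using assms(3) \<gamma>(1) by (simp add: rank_cond_def)
  moreover have "1 * null_count (Suc 0) (\<rho> + \<gamma>) \<le> CARD('f) ^ e * null_count (Suc 0) (\<rho> + \<gamma>)"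
    using card_field_ge_2 by (intro mult_le_mono1) simp
  ultimately show False by linarith
qed

end

context rank_step
begin

text \<open>Relative to a base \<open>b0\<close> that is fixed for the whole step, genericity is a
  condition on one last coordinate; \<open>ex_generic\<close> makes its failures a small
  set.\<close>

definition generic :: "'v \<Rightarrow> 'v \<Rightarrow> bool" where
  "generic b0 b \<longleftrightarrow> small {c \<in> W. \<not> ind b0 b c}"

lemma generic_pick:
  assumes "generic b0 b" "x \<in> points k" "fib x \<noteq> {}"
  obtains c where "c \<in> fib x" "ind b0 b c"
proof -
  have sub: "{c \<in> W. \<not> ind b0 b c} \<subseteq> W" by blast
  show ?thesis
  proof (rule fib_pick[OF assms(2,3,2,3) assms(1)[unfolded generic_def] small_empty small_empty small_empty
        sub empty_subsetI empty_subsetI empty_subsetI])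
    fix c assume "c \<in> fib x" "c \<notin> {c \<in> W. \<not> ind b0 b c}"
    then show ?thesis using that fib_W by blast
  qed
qed

text \<open>Prepares the transport to arbitrary last coordinates: \<open>b\<close> and its
  translates must be generic at once, and two points \<open>x\<close>, \<open>y\<close> must be
  comparable through the same \<open>b\<close>.\<close>

lemma generic_pair_pick:
  assumes small: "small {b \<in> W. \<not> generic b0 b}" and "a \<in> W" "a' \<in> W"
    and x: "x \<in> points k" "fib x \<noteq> {}" and y: "y \<in> points k" "fib y \<noteq> {}"
  obtains b where "b \<in> fib x" "b \<in> fib y" "\<rho> (x(Suc k := b)) = 0"
    "generic b0 b" "generic b0 (a + b)" "generic b0 (a' + b)"
proof -
  let ?X = "\<lambda>a. {b \<in> W. \<not> generic b0 (a + b)}"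
  have s: "small (?X a)" "small (?X a')" using small_shift[OF small] assms by auto
  have sub: "?X a \<subseteq> W" "?X a' \<subseteq> W" "{b \<in> W. \<not> generic b0 b} \<subseteq> W" by auto
  show ?thesis
  proof (rule fib_pick[OF x y small s small_empty sub(3,1,2) empty_subsetI])
    fix b assume "b \<in> fib x" "b \<in> fib y" "\<rho> (x(Suc k := b)) = 0"
      "b \<notin> {b \<in> W. \<not> generic b0 b}" "b \<notin> ?X a" "b \<notin> ?X a'"
    then show ?thesis using that fib_W by blast
  qed
qed

lemma ex_generic:
  assumes "zero_pt (Suc k) \<in> variety (Suc k) \<Gamma>"
  obtains b0 where "b0 \<in> fib (zero_pt k)" "small {b \<in> W. \<not> generic b0 b}"
  using ex_generic_base[OF assms] unfolding generic_def by blast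

lemma ex_ind:
  assumes "zero_pt (Suc k) \<in> variety (Suc k) \<Gamma>"
  obtains b c d where "b \<in> fib (zero_pt k)" "c \<in> fib (zero_pt k)" "d \<in> fib (zero_pt k)" "ind b c d"
proof -
  obtain b0 where b0: "b0 \<in> fib (zero_pt k)" "small {b \<in> W. \<not> generic b0 b}"
    using ex_generic[OF assms] .
  then have ne: "fib (zero_pt k) \<noteq> {}" by blast
  obtain b where b: "b \<in> fib (zero_pt k)" "generic b0 b"
    using generic_pair_pick[OF b0(2) V_simps(1) V_simps(1) zero_pt_points ne zero_pt_points ne] by metis
  obtain c where "c \<in> fib (zero_pt k)" "ind b0 b c"
    using generic_pick[OF b(2) zero_pt_points ne] .
  then show ?thesis using that b0 b by blast
qed

end

context finite_spaces
begin

text \<open>The rank condition passes to the slice at \<open>d\<close> of an independent triple, and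
  a point found there lifts with last coordinate \<open>d\<close>. Applied to
  \<open>triple_forms\<close>, the lemma yields the coefficient-isolating points of
  \<open>ind0_point\<close>.\<close>

lemma ex_nonzero:
  assumes "k \<ge> 1" "forms k \<Gamma>" "card \<Gamma> \<le> m" "form k {1..k} \<rho>" "rank_cond k (req k m) \<Gamma> \<rho>"
    and "zero_pt k \<in> variety k \<Gamma>"
  shows "\<exists>x\<in>variety k \<Gamma>. \<rho> x \<noteq> 0"
  using assms
proof (induction k arbitrary: \<Gamma> m \<rho> rule: nat_induct_at_least)
  case base
  then show ?case using ex_nonzero_1 by simp
next
  case (Suc k)
  interpret rank_step sG sH V k m \<Gamma> \<rho>
    using Suc by unfold_locales auto
  obtain b c d where *: "b \<in> fib (zero_pt k)" "c \<in> fib (zero_pt k)" "d \<in> fib (zero_pt k)" "ind b c d"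
    using ex_ind Suc.prems by blast
  then have W: "b \<in> W" "c \<in> W" "d \<in> W" using fib_W by blast+
  obtain x where x: "x \<in> variety k (triple_forms b c d)" "slice k d \<rho> x \<noteq> 0"
    using Suc.IH[OF forms_triple[OF W] card_triple form_slice_\<rho>[OF W(3)] ind_rank_cond[OF *(4) W] zero_pt_triple[OF *(1-3)]]
    by blast
  then have "x(Suc k := d) \<in> variety (Suc k) \<Gamma>"
    using variety_triple(4)[OF W x(1)] by (simp add: fib_def)
  then show ?case using x(2) by (auto simp: slice_def)
qed

section \<open>Induction for uniqueness\<close>

text \<open>Uniqueness in homogeneous form, for the difference of two extensions. Quantification
  over \<open>m\<close> lets the induction apply it to \<open>3 * m + 2\<close> forms.\<close>

definition unique_at :: "nat \<Rightarrow> bool" where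
  "unique_at k \<longleftrightarrow> (\<forall>m \<Gamma> \<rho> \<theta>. forms k \<Gamma> \<longrightarrow> card \<Gamma> \<le> m \<longrightarrow> form k {1..k} \<rho> \<longrightarrow> rank_cond k (req k m) \<Gamma> \<rho> \<longrightarrow>
     ml {1..k} (variety k \<Gamma>) \<theta> \<longrightarrow> (\<forall>x\<in>variety k \<Gamma>. \<rho> x = 0 \<longrightarrow> \<theta> x = 0) \<longrightarrow>
     (\<exists>h. \<forall>x\<in>variety k \<Gamma>. \<theta> x = sH (\<rho> x) h))"

text \<open>Neither a value at \<open>z\<close> nor a subspace for the values is prescribed;
  \<open>unique_extension\<close> arranges both at the end.\<close>

definition extension_at :: "nat \<Rightarrow> bool" where
  "extension_at k \<longleftrightarrow> (\<forall>m \<Gamma> \<rho> \<phi>. forms k \<Gamma> \<longrightarrow> card \<Gamma> \<le> m \<longrightarrow> form k {1..k} \<rho> \<longrightarrow> rank_cond k (req k m) \<Gamma> \<rho> \<longrightarrow>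
     ml {1..k} {x \<in> variety k \<Gamma>. \<rho> x = 0} \<phi> \<longrightarrow>
     (\<exists>\<psi>. ml {1..k} (variety k \<Gamma>) \<psi> \<and> (\<forall>x\<in>variety k \<Gamma>. \<rho> x = 0 \<longrightarrow> \<psi> x = \<phi> x)))"

end

context rank_step
begin

abbreviation zfib :: "'v set" where "zfib \<equiv> fib (zero_pt k)"

text \<open>Independence does not by itself make the slices of the variety inhabited; membership in
  \<open>zfib\<close> puts the zero point into them.\<close>

definition ind0 :: "'v \<Rightarrow> 'v \<Rightarrow> 'v \<Rightarrow> bool" where
  "ind0 b c d \<longleftrightarrow> b \<in> zfib \<and> c \<in> zfib \<and> d \<in> zfib \<and> ind b c d"

lemma ind0_W: "ind0 b c d \<Longrightarrow> b \<in> W \<and> c \<in> W \<and> d \<in> W"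
  using fib_W by (auto simp: ind0_def)

lemma ind0_swap12: "ind0 b c d \<Longrightarrow> ind0 c b d"
  and ind0_swap23: "ind0 b c d \<Longrightarrow> ind0 b d c"
  unfolding ind0_def using ind_swap12 ind_swap23 by blast+

lemma ind0_add1: "ind0 b c d \<Longrightarrow> ind0 (b + c) c d"
  unfolding ind0_def using ind_add1 fib_W fib_add by blast

lemma ind0_diff2: "ind0 b c d \<Longrightarrow> ind0 b (c - b) d"
  unfolding ind0_def using ind_diff2 fib_W fib_diff by blast

lemma ind0_scale1: "ind0 b c d \<Longrightarrow> s \<noteq> 0 \<Longrightarrow> ind0 (sG s b) c d"
  unfolding ind0_def using ind_scale1 fib_W fib_scale by blast

text \<open>The device for reading off coefficients: at this point an identity between the three
  slices of \<open>\<rho>\<close> keeps only its term at \<open>d\<close>.\<close>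

lemma ind0_point:
  assumes "ind0 b c d"
  obtains x where "x \<in> points k" "b \<in> fib x" "c \<in> fib x" "d \<in> fib x"
    "\<rho> (x(Suc k := b)) = 0" "\<rho> (x(Suc k := c)) = 0" "\<rho> (x(Suc k := d)) \<noteq> 0"
proof -
  have W: "b \<in> W" "c \<in> W" "d \<in> W" using ind0_W[OF assms] by auto
  obtain x where x: "x \<in> variety k (triple_forms b c d)" "slice k d \<rho> x \<noteq> 0"
    using ex_nonzero[OF k_pos forms_triple[OF W] card_triple form_slice_\<rho>[OF W(3)] ind_rank_cond zero_pt_triple]
      assms W unfolding ind0_def by blast
  then show ?thesis using that variety_triple[OF W x(1)] by (simp add: slice_def)
qed

text \<open>The rank condition passes to subsets, so uniqueness holds on any variety cut out by part
  of the triple forms. In particular a slice of \<open>\<rho>\<close> may be required to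
  vanish.\<close>

lemma ind0_unique:
  assumes "unique_at k" "ind0 b c d" "\<Delta> \<subseteq> triple_forms b c d" "ml {1..k} (variety k \<Delta>) \<theta>"
    "\<And>x. x \<in> variety k \<Delta> \<Longrightarrow> \<rho> (x(Suc k := d)) = 0 \<Longrightarrow> \<theta> x = 0"
  shows "\<exists>h. \<forall>x\<in>variety k \<Delta>. \<theta> x = sH (\<rho> (x(Suc k := d))) h"
proof -
  have W: "b \<in> W" "c \<in> W" "d \<in> W" using ind0_W[OF assms(2)] by auto
  have "forms k \<Delta>" "finite (triple_forms b c d)"
    using forms_triple[OF W] assms(3) finite_subset by (auto simp: forms_def)
  moreover then have "card \<Delta> \<le> 3 * m + 2"
    using card_mono[OF _ assms(3)] card_triple order_trans by blast
  moreover have "rank_cond k (req k (3 * m + 2)) \<Delta> (slice k d \<rho>)"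
    using ind_rank_cond[OF _ W] assms(2,3) rank_cond_mono unfolding ind0_def by blast
  ultimately have "\<exists>h. \<forall>x\<in>variety k \<Delta>. \<theta> x = sH (slice k d \<rho> x) h"
    using assms(1,4,5) form_slice_\<rho>[OF W(3)] unfolding unique_at_def by (simp add: slice_def)
  then show ?thesis by (simp add: slice_def)
qed

lemma slices_triple: "slices k d \<Gamma> \<subseteq> triple_forms b c d"
  by (auto simp: triple_forms_def)

lemma slice_ml:
  assumes "ml {1..Suc k} S \<phi>" "\<And>x. x \<in> S' \<Longrightarrow> x(Suc k := b) \<in> S"
  shows "ml {1..k} S' (slice k b \<phi>)"
  by (rule slice_mlin[OF assms(1)]) (use assms in auto)

text \<open>On a generic slice \<open>\<theta>\<close> is a multiple of the slice of
  \<open>\<rho>\<close>. Comparison at \<open>b\<close>, \<open>c\<close> and \<open>b + c\<close>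
  shows that the coefficients agree, and an arbitrary last coordinate \<open>a\<close> is the
  difference of the generic \<open>a + b\<close> and \<open>b\<close>.\<close>

lemma unique_step:
  assumes uniq: "unique_at k" and \<theta>: "ml {1..Suc k} (variety (Suc k) \<Gamma>) \<theta>"
    and vanish: "\<And>x. x \<in> variety (Suc k) \<Gamma> \<Longrightarrow> \<rho> x = 0 \<Longrightarrow> \<theta> x = 0"
  shows "\<exists>h. \<forall>x\<in>variety (Suc k) \<Gamma>. \<theta> x = sH (\<rho> x) h"
proof (cases "variety (Suc k) \<Gamma> = {}")
  case False
  then have zero: "zero_pt (Suc k) \<in> variety (Suc k) \<Gamma>"
    using zero_pt_variety[OF forms_\<Gamma>] by blast
  define is_coeff where "is_coeff b h \<longleftrightarrow>
    (\<forall>x\<in>points k. b \<in> fib x \<longrightarrow> \<theta> (x(Suc k := b)) = sH (\<rho> (x(Suc k := b))) h)" for b h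
  have ex: "\<exists>h. is_coeff d h" if "ind0 b c d" for b c d
  proof -
    have d: "d \<in> W" using ind0_W[OF that] by blast
    have "\<exists>h. \<forall>x\<in>variety k (slices k d \<Gamma>). slice k d \<theta> x = sH (\<rho> (x(Suc k := d))) h"
    proof (rule ind0_unique[OF uniq that slices_triple])
      show "ml {1..k} (variety k (slices k d \<Gamma>)) (slice k d \<theta>)"
        by (rule slice_ml[OF \<theta>]) (use d variety_slices in blast)
      fix x assume "x \<in> variety k (slices k d \<Gamma>)" "\<rho> (x(Suc k := d)) = 0"
      then show "slice k d \<theta> x = 0"
        using vanish d variety_slices by (auto simp: slice_def)
    qed
    then show ?thesis using fib_slices[OF d] by (auto simp: is_coeff_def slice_def)
  qed
  have same: "is_coeff c h" if ind: "ind0 b c d" and h: "is_coeff b h" for b c d h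
  proof -
    obtain hc where hc: "is_coeff c hc" using ex[OF ind0_swap23[OF ind]] by blast
    have "ind0 d c (b + c)" using ind0_add1[OF ind] ind0_swap12 ind0_swap23 by blast
    then obtain hs where hs: "is_coeff (b + c) hs" using ex by blast
    have sum: "sH (\<rho> (x(Suc k := b))) hs + sH (\<rho> (x(Suc k := c))) hs =
        sH (\<rho> (x(Suc k := b))) h + sH (\<rho> (x(Suc k := c))) hc"
      if x: "x \<in> points k" "b \<in> fib x" "c \<in> fib x" for x
    proof -
      have "\<theta> (x(Suc k := b + c)) = \<theta> (x(Suc k := b)) + \<theta> (x(Suc k := c))"
        using x by (intro ml_add[OF \<theta>]) (auto simp: fib_def)
      moreover have "\<rho> (x(Suc k := b + c)) = \<rho> (x(Suc k := b)) + \<rho> (x(Suc k := c))"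
        using x variety_points by (intro form_add[OF form_\<rho>]) (auto simp: fib_def)
      moreover have "\<theta> (x(Suc k := b + c)) = sH (\<rho> (x(Suc k := b + c))) hs"
        using hs x fib_add unfolding is_coeff_def by blast
      ultimately show ?thesis using h hc x unfolding is_coeff_def by (simp add: H.scale_left_distrib)
    qed
    \<comment> \<open>Here only the slice at \<open>b\<close> survives in the sum, so the
      coefficients at \<open>b + c\<close> and \<open>b\<close> agree; the second point does the
      same for \<open>c\<close>.\<close>
    obtain x where "x \<in> points k" "b \<in> fib x" "c \<in> fib x" "\<rho> (x(Suc k := b)) \<noteq> 0" "\<rho> (x(Suc k := c)) = 0"
      using ind0_point[of d c b] ind ind0_swap12 ind0_swap23 by metis
    then have "hs = h" using sum by fastforce
    moreover obtain x where "x \<in> points k" "b \<in> fib x" "c \<in> fib x" "\<rho> (x(Suc k := b)) = 0" "\<rho> (x(Suc k := c)) \<noteq> 0"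
      using ind0_point[of d b c] ind ind0_swap12 ind0_swap23 by metis
    then have "hs = hc" using sum by fastforce
    ultimately show ?thesis using hc by simp
  qed
  obtain b0 where b0: "b0 \<in> zfib" "small {b \<in> W. \<not> generic b0 b}" using ex_generic[OF zero] .
  then have ne: "zfib \<noteq> {}" by blast
  have gen: "\<exists>c. ind0 b0 b c" if "b \<in> zfib" "generic b0 b" for b
    using generic_pick[OF that(2) zero_pt_points ne] that b0(1) unfolding ind0_def by metis
  obtain b where "b \<in> zfib" "generic b0 b"
    using generic_pair_pick[OF b0(2) V_simps(1) V_simps(1) zero_pt_points ne zero_pt_points ne] .
  then obtain c where "ind0 b0 b c" using gen by blast
  then obtain h where h: "is_coeff b0 h" using ex ind0_swap12 ind0_swap23 by blast
  have coeff: "is_coeff b h" if "b \<in> zfib" "generic b0 b" for b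
    using gen[OF that] same h by blast
  have "\<theta> x = sH (\<rho> x) h" if x: "x \<in> variety (Suc k) \<Gamma>" for x
  proof -
    obtain y a where y: "y \<in> points k" "a \<in> W" "x = y(Suc k := a)"
      using points_SucE[OF variety_points[OF x]] .
    then have a: "a \<in> fib y" using x by (simp add: fib_def)
    then obtain b where b: "b \<in> fib y" "generic b0 b" "generic b0 (a + b)"
      using generic_pair_pick[OF b0(2) y(2) y(2) y(1) _ y(1)] by blast
    have p: "y(Suc k := a) \<in> points (Suc k)" "y(Suc k := b) \<in> points (Suc k)"
      using a b y points_Suc fib_W by blast+
    have "\<theta> (y(Suc k := a + b)) = sH (\<rho> (y(Suc k := a + b))) h"
      "\<theta> (y(Suc k := b)) = sH (\<rho> (y(Suc k := b))) h"
      using coeff[of b] coeff[of "a + b"] a b y fib_add fib_zero unfolding is_coeff_def by blast+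
    moreover have "\<theta> (y(Suc k := a + b)) = \<theta> (y(Suc k := a)) + \<theta> (y(Suc k := b))"
      using a b by (intro ml_add[OF \<theta>]) (auto simp: fib_def)
    moreover have "\<rho> (y(Suc k := a + b)) = \<rho> (y(Suc k := a)) + \<rho> (y(Suc k := b))"
      using p by (intro form_add[OF form_\<rho>]) auto
    ultimately show ?thesis using y(3) by (simp add: H.scale_left_distrib)
  qed
  then show ?thesis by blast
qed blast

end

context finite_spaces
begin

text \<open>A point \<open>u0\<close> outside the kernel of \<open>\<rho>\<close> determines the
  coefficient, and subtracting a multiple of \<open>u0\<close> moves any point into the
  kernel.\<close>

lemma unique_at_1: "unique_at 1"
  unfolding unique_at_def One_nat_def
proof (intro allI impI)
  fix m :: nat and \<Gamma> \<rho> \<theta>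
  assume forms: "forms (Suc 0) \<Gamma>" and \<rho>: "form (Suc 0) {Suc 0..Suc 0} \<rho>"
    and \<theta>: "ml {Suc 0..Suc 0} (variety (Suc 0) \<Gamma>) \<theta>"
    and vanish: "\<forall>x\<in>variety (Suc 0) \<Gamma>. \<rho> x = 0 \<longrightarrow> \<theta> x = 0"
  show "\<exists>h. \<forall>x\<in>variety (Suc 0) \<Gamma>. \<theta> x = sH (\<rho> x) h"
  proof (cases "\<forall>x\<in>variety (Suc 0) \<Gamma>. \<rho> x = 0")
    case True
    then show ?thesis using vanish by (intro exI[of _ 0]) auto
  next
    case False
    let ?e = "\<lambda>u. (zero_pt 0)(Suc 0 := u)"
    obtain u0 where u0: "?e u0 \<in> variety (Suc 0) \<Gamma>" "\<rho> (?e u0) \<noteq> 0"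
      using False variety_points points_1E by metis
    define h where "h = sH (1 / \<rho> (?e u0)) (\<theta> (?e u0))"
    have "\<theta> x = sH (\<rho> x) h" if x: "x \<in> variety (Suc 0) \<Gamma>" for x
    proof -
      obtain u where u: "x = ?e u" using x variety_points points_1E by metis
      let ?s = "\<rho> x / \<rho> (?e u0)"
      have s: "?e (sG (- ?s) u0) \<in> variety (Suc 0) \<Gamma>"
        by (rule variety_scale[OF forms _ u0(1)]) simp
      have "\<rho> (?e (u + sG (- ?s) u0)) = \<rho> x + - ?s * \<rho> (?e u0)"
        using form_add[OF \<rho>, of "Suc 0" "zero_pt 0" u "sG (- ?s) u0"]
          form_scale[OF \<rho>, of "Suc 0" "zero_pt 0" u0 "- ?s"] s x u u0 variety_points
        by fastforce
      then have "\<rho> (?e (u + sG (- ?s) u0)) = 0" using u0(2) by simp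
      moreover have "?e (u + sG (- ?s) u0) \<in> variety (Suc 0) \<Gamma>"
        by (rule variety_add[OF forms]) (use x u s in auto)
      ultimately have "\<theta> (?e (u + sG (- ?s) u0)) = 0" using vanish by blast
      moreover have "\<theta> (?e (u + sG (- ?s) u0)) = \<theta> x + sH (- ?s) (\<theta> (?e u0))"
        using ml_add[OF \<theta>, of "Suc 0" "zero_pt 0" u "sG (- ?s) u0"]
          ml_scale[OF \<theta>, of "Suc 0" "zero_pt 0" u0 "- ?s"] s x u u0 by simp
      ultimately show ?thesis by (simp add: h_def H.scale_minus_left)
    qed
    then show ?thesis by blast
  qed
qed

lemma unique_at: "k \<ge> 1 \<Longrightarrow> unique_at k"
proof (induction k rule: nat_induct_at_least)
  case base
  show ?case by (rule unique_at_1)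
next
  case (Suc k)
  show ?case
    unfolding unique_at_def
  proof (intro allI impI)
    fix m \<Gamma> \<rho> \<theta>
    assume *: "forms (Suc k) \<Gamma>" "card \<Gamma> \<le> m" "form (Suc k) {1..Suc k} \<rho>"
      "rank_cond (Suc k) (req (Suc k) m) \<Gamma> \<rho>"
    interpret rank_step sG sH V k m \<Gamma> \<rho>
      using Suc.hyps * by unfold_locales auto
    assume "ml {1..Suc k} (variety (Suc k) \<Gamma>) \<theta>" "\<forall>x\<in>variety (Suc k) \<Gamma>. \<rho> x = 0 \<longrightarrow> \<theta> x = 0"
    then show "\<exists>h. \<forall>x\<in>variety (Suc k) \<Gamma>. \<theta> x = sH (\<rho> x) h"
      using unique_step[OF Suc.IH] by blast
  qed
qed

end

section \<open>Existence of extensions\<close>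

locale extension_step = rank_step sG sH V k m \<Gamma> \<rho>
  for sG :: "'f::{field,finite} \<Rightarrow> 'v::ab_group_add \<Rightarrow> 'v"
    and sH :: "'f \<Rightarrow> 'w::ab_group_add \<Rightarrow> 'w" and V k m \<Gamma> \<rho> +
  fixes \<phi> :: "(nat \<Rightarrow> 'v) \<Rightarrow> 'w" and b0 :: 'v
  assumes ext: "extension_at k"
    and \<phi>_ml: "ml {1..Suc k} {x \<in> variety (Suc k) \<Gamma>. \<rho> x = 0} \<phi>"
    and b0: "b0 \<in> zfib" "small {b \<in> W. \<not> generic b0 b}"
begin

lemma uniq: "unique_at k"
  using unique_at k_pos by blast

definition extends_slice :: "'v \<Rightarrow> ((nat \<Rightarrow> 'v) \<Rightarrow> 'w) \<Rightarrow> bool" where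
  "extends_slice b f \<longleftrightarrow> ml {1..k} (variety k (slices k b \<Gamma>)) f \<and>
     (\<forall>x\<in>points k. b \<in> fib x \<longrightarrow> \<rho> (x(Suc k := b)) = 0 \<longrightarrow> f x = \<phi> (x(Suc k := b)))"

text \<open>An arbitrary choice for each \<open>b\<close>, with nothing to relate different
  \<open>b\<close>. It is meaningful where an extension exists, hence for members of independent
  triples.\<close>

definition \<psi> :: "'v \<Rightarrow> (nat \<Rightarrow> 'v) \<Rightarrow> 'w" where
  "\<psi> b = (SOME f. extends_slice b f)"

lemma \<psi>_extends:
  assumes "ind0 c d b"
  shows "extends_slice b (\<psi> b)"
proof -
  have W: "c \<in> W" "d \<in> W" "b \<in> W" using ind0_W[OF assms] by auto
  have 1: "card (slices k b \<Gamma>) \<le> 3 * m + 2"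
    using card_slices[OF finite_\<Gamma>, of k b] card_\<Gamma> by linarith
  have 2: "rank_cond k (req k (3 * m + 2)) (slices k b \<Gamma>) (slice k b \<rho>)"
    using ind_rank_cond[OF _ W] assms rank_cond_mono[OF _ order_refl slices_triple] unfolding ind0_def by blast
  have 3: "ml {1..k} {x \<in> variety k (slices k b \<Gamma>). slice k b \<rho> x = 0} (slice k b \<phi>)"
    by (rule slice_ml[OF \<phi>_ml]) (use variety_slices[OF W(3)] in \<open>auto simp: slice_def\<close>)
  obtain f where "ml {1..k} (variety k (slices k b \<Gamma>)) f"
    "\<forall>x\<in>variety k (slices k b \<Gamma>). slice k b \<rho> x = 0 \<longrightarrow> f x = slice k b \<phi> x"
    using ext[unfolded extension_at_def, rule_format,
        OF forms_slices[OF forms_\<Gamma> W(3)] 1 form_slice_\<rho>[OF W(3)] 2 3] by blast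
  then have "extends_slice b f"
    using fib_slices[OF W(3)] by (auto simp: extends_slice_def slice_def)
  then show ?thesis unfolding \<psi>_def by (rule someI[of "extends_slice b"])
qed

lemma \<rho>_add:
  assumes "x \<in> points k" "b \<in> W" "c \<in> W"
  shows "\<rho> (x(Suc k := b + c)) = \<rho> (x(Suc k := b)) + \<rho> (x(Suc k := c))"
  using assms points_Suc by (intro form_add[OF form_\<rho>]) auto

lemma \<rho>_scale:
  assumes "x \<in> points k" "b \<in> W"
  shows "\<rho> (x(Suc k := sG t b)) = t * \<rho> (x(Suc k := b))"
  using assms points_Suc by (intro form_scale[OF form_\<rho>]) auto

lemma \<phi>_add:
  assumes "b \<in> fib x" "c \<in> fib x" "\<rho> (x(Suc k := b)) = 0" "\<rho> (x(Suc k := c)) = 0"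
  shows "\<phi> (x(Suc k := b + c)) = \<phi> (x(Suc k := b)) + \<phi> (x(Suc k := c))"
  using assms by (intro ml_add[OF \<phi>_ml]) (auto simp: fib_def)

lemma \<phi>_scale:
  assumes "b \<in> fib x" "\<rho> (x(Suc k := b)) = 0"
  shows "\<phi> (x(Suc k := sG t b)) = sH t (\<phi> (x(Suc k := b)))"
  using assms by (intro ml_scale[OF \<phi>_ml]) (auto simp: fib_def)

lemma ml_slice_\<rho>: "b \<in> W \<Longrightarrow> S \<subseteq> points k \<Longrightarrow> ml {1..k} S (\<lambda>x. sH (\<rho> (x(Suc k := b))) h)"
  using ml_form[OF form_slice_\<rho>] by (simp add: slice_def)

text \<open>Each slice extension is determined only up to a multiple of the slice of \<open>\<rho>\<close>, so additivity
  in the last coordinate holds up to multiples of the two slices of \<open>\<rho>\<close>.\<close>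

definition defect :: "'v \<Rightarrow> 'v \<Rightarrow> 'w \<Rightarrow> 'w \<Rightarrow> bool" where
  "defect b c h1 h2 \<longleftrightarrow> (\<forall>x\<in>points k. b \<in> fib x \<longrightarrow> c \<in> fib x \<longrightarrow>
     \<psi> (b + c) x - \<psi> b x - \<psi> c x = sH (\<rho> (x(Suc k := b))) h1 + sH (\<rho> (x(Suc k := c))) h2)"

lemma defect_swap: "defect b c h1 h2 \<Longrightarrow> defect c b h2 h1"
  unfolding defect_def by (simp add: algebra_simps)

text \<open>Uniqueness is used twice. Where \<open>\<rho>\<close> vanishes at \<open>b\<close>, the
  defect vanishes together with \<open>\<rho>\<close> at \<open>c\<close>, so it is a multiple of
  the slice at \<open>c\<close>. Once this multiple is subtracted, the rest vanishes together with
  \<open>\<rho>\<close> at \<open>b\<close>, so it is a multiple of the slice at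
  \<open>b\<close>.\<close>

lemma defect_exists:
  assumes ind: "ind0 b c d"
  shows "\<exists>h1 h2. defect b c h1 h2"
proof -
  have W: "b \<in> W" "c \<in> W" "b + c \<in> W" using ind0_W[OF ind] by auto
  have e: "extends_slice b (\<psi> b)" "extends_slice c (\<psi> c)" "extends_slice (b + c) (\<psi> (b + c))"
    using \<psi>_extends ind ind0_add1[OF ind] ind0_swap12 ind0_swap23 by meson+
  let ?D = "\<lambda>x. \<psi> (b + c) x - \<psi> b x - \<psi> c x"
  let ?S = "variety k (slices k b \<Gamma> \<union> slices k c \<Gamma>)"
  have S: "x \<in> ?S \<longleftrightarrow> x \<in> points k \<and> b \<in> fib x \<and> c \<in> fib x" for x
    using fib_slices[OF W(1), of x] fib_slices[OF W(2), of x] variety_points unfolding variety_Un by blast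
  have sub: "?S \<subseteq> variety k (slices k b \<Gamma>)" "?S \<subseteq> variety k (slices k c \<Gamma>)"
    "?S \<subseteq> variety k (slices k (b + c) \<Gamma>)"
    using S fib_slices W fib_add by blast+
  have D: "ml {1..k} ?S ?D"
    using e sub mlin_subset[OF _ order_refl] unfolding extends_slice_def
    by (intro ml_fun_diff) blast+
  have D0: "?D x = 0" if "x \<in> ?S" "\<rho> (x(Suc k := b)) = 0" "\<rho> (x(Suc k := c)) = 0" for x
  proof -
    have x: "x \<in> points k" "b \<in> fib x" "c \<in> fib x" using that S by auto
    then have "\<rho> (x(Suc k := b + c)) = 0" using \<rho>_add W that by simp
    then have "\<psi> (b + c) x = \<phi> (x(Suc k := b + c))"
      using e(3) x fib_add unfolding extends_slice_def by blast
    moreover have "\<psi> b x = \<phi> (x(Suc k := b))" "\<psi> c x = \<phi> (x(Suc k := c))"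
      using e(1,2) x that unfolding extends_slice_def by blast+
    ultimately show ?thesis using \<phi>_add[OF x(2,3) that(2,3)] by simp
  qed
  let ?\<Delta> = "insert ({1..k}, slice k b \<rho>) (slices k b \<Gamma> \<union> slices k c \<Gamma>)"
  have T: "x \<in> variety k ?\<Delta> \<longleftrightarrow> x \<in> ?S \<and> \<rho> (x(Suc k := b)) = 0" for x
    by (auto simp: variety_insert slice_def)
  have "\<exists>h. \<forall>x\<in>variety k ?\<Delta>. ?D x = sH (\<rho> (x(Suc k := c))) h"
  proof (rule ind0_unique[OF uniq ind0_swap23[OF ind]])
    show "?\<Delta> \<subseteq> triple_forms b d c" by (auto simp: triple_forms_def)
    show "ml {1..k} (variety k ?\<Delta>) ?D"
      by (rule mlin_subset[OF D order_refl]) (use T in blast)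
    show "?D x = 0" if "x \<in> variety k ?\<Delta>" "\<rho> (x(Suc k := c)) = 0" for x
      using that T D0 by blast
  qed
  then obtain h2 where h2: "\<And>x. x \<in> ?S \<Longrightarrow> \<rho> (x(Suc k := b)) = 0 \<Longrightarrow> ?D x = sH (\<rho> (x(Suc k := c))) h2"
    using T by blast
  have "\<exists>h. \<forall>x\<in>?S. ?D x - sH (\<rho> (x(Suc k := c))) h2 = sH (\<rho> (x(Suc k := b))) h"
  proof (rule ind0_unique[OF uniq])
    show "ind0 c d b" using ind ind0_swap12 ind0_swap23 by blast
    show "slices k b \<Gamma> \<union> slices k c \<Gamma> \<subseteq> triple_forms c d b" by (auto simp: triple_forms_def)
    show "ml {1..k} ?S (\<lambda>x. ?D x - sH (\<rho> (x(Suc k := c))) h2)"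
      using S by (intro ml_fun_diff[OF D] ml_slice_\<rho> W) blast
    show "?D x - sH (\<rho> (x(Suc k := c))) h2 = 0" if "x \<in> ?S" "\<rho> (x(Suc k := b)) = 0" for x
      using h2[OF that] by simp
  qed
  then obtain h1 where "\<forall>x\<in>?S. ?D x - sH (\<rho> (x(Suc k := c))) h2 = sH (\<rho> (x(Suc k := b))) h1" by blast
  then have "defect b c h1 h2" unfolding defect_def using S by (metis diff_add_cancel)
  then show ?thesis by blast
qed

lemma defect_unique:
  assumes "ind0 b c d" "defect b c h1 h2" "defect b c h1' h2'"
  shows "h1 = h1'"
proof -
  obtain x where x: "x \<in> points k" "b \<in> fib x" "c \<in> fib x" "\<rho> (x(Suc k := b)) \<noteq> 0" "\<rho> (x(Suc k := c)) = 0"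
    using ind0_point[of c d b] assms(1) ind0_swap12 ind0_swap23 by metis
  then have "sH (\<rho> (x(Suc k := b))) h1 = sH (\<rho> (x(Suc k := b))) h1'"
    using assms(2,3) unfolding defect_def by force
  then show ?thesis using x by simp
qed

text \<open>One function supplies both coefficients: by symmetry of the defect, that of the slice at
  \<open>c\<close> is \<open>\<kappa> c b\<close>.\<close>

definition \<kappa> :: "'v \<Rightarrow> 'v \<Rightarrow> 'w" where
  "\<kappa> b c = (SOME h1. \<exists>h2. defect b c h1 h2)"

lemma defect_\<kappa>:
  assumes "ind0 b c d"
  shows "defect b c (\<kappa> b c) (\<kappa> c b)"
proof -
  have "\<exists>h2. defect b c (\<kappa> b c) h2"
    unfolding \<kappa>_def by (rule someI_ex) (rule defect_exists[OF assms])
  then obtain h2 where h2: "defect b c (\<kappa> b c) h2" ..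
  have swap: "ind0 c b d" using assms ind0_swap12 by blast
  have "\<exists>h1. defect c b (\<kappa> c b) h1"
    unfolding \<kappa>_def by (rule someI_ex) (rule defect_exists[OF swap])
  then obtain h1 where "defect c b (\<kappa> c b) h1" ..
  then have "\<kappa> c b = h2" using defect_unique[OF swap] defect_swap[OF h2] by blast
  then show ?thesis using h2 by simp
qed

text \<open>Both bracketings of \<open>b + c + d\<close> are expanded at a point where
  \<open>\<rho>\<close> vanishes at \<open>c\<close> and \<open>d\<close> but not at
  \<open>b\<close>; only the coefficients of the slice at \<open>b\<close> remain.\<close>

lemma \<kappa>_cocycle:
  assumes ind: "ind0 b c d"
  shows "\<kappa> (b + c) d + \<kappa> b c = \<kappa> b (c + d)"
proof -
  obtain x where x: "x \<in> points k" "b \<in> fib x" "c \<in> fib x" "d \<in> fib x"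
    "\<rho> (x(Suc k := b)) \<noteq> 0" "\<rho> (x(Suc k := c)) = 0" "\<rho> (x(Suc k := d)) = 0"
    using ind0_point[of c d b] ind ind0_swap12 ind0_swap23 by metis
  have W: "b \<in> W" "c \<in> W" "d \<in> W" using ind0_W[OF ind] by auto
  have "ind0 (c + d) b d"
    using ind ind0_swap12 ind0_swap23 ind0_add1 by blast
  then have "defect b (c + d) (\<kappa> b (c + d)) (\<kappa> (c + d) b)" using defect_\<kappa> ind0_swap12 by blast
  then have 1: "\<psi> (b + (c + d)) x - \<psi> b x - \<psi> (c + d) x = sH (\<rho> (x(Suc k := b))) (\<kappa> b (c + d))"
    using x fib_add \<rho>_add[OF x(1) W(2,3)] unfolding defect_def by simp
  have "ind0 (b + c) d c"
    using ind ind0_swap23 ind0_add1 by blast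
  then have "defect (b + c) d (\<kappa> (b + c) d) (\<kappa> d (b + c))" using defect_\<kappa> by blast
  then have 2: "\<psi> (b + c + d) x - \<psi> (b + c) x - \<psi> d x = sH (\<rho> (x(Suc k := b))) (\<kappa> (b + c) d)"
    using x fib_add \<rho>_add[OF x(1) W(1,2)] unfolding defect_def by simp
  have "ind0 c d b" using ind ind0_swap12 ind0_swap23 by blast
  then have "defect c d (\<kappa> c d) (\<kappa> d c)" using defect_\<kappa> by blast
  then have 3: "\<psi> (c + d) x - \<psi> c x - \<psi> d x = 0"
    using x unfolding defect_def by simp
  have "defect b c (\<kappa> b c) (\<kappa> c b)" using defect_\<kappa> ind by blast
  then have 4: "\<psi> (b + c) x - \<psi> b x - \<psi> c x = sH (\<rho> (x(Suc k := b))) (\<kappa> b c)"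
    using x unfolding defect_def by simp
  have "sH (\<rho> (x(Suc k := b))) (\<kappa> (b + c) d + \<kappa> b c) =
      (\<psi> (b + c + d) x - \<psi> (b + c) x - \<psi> d x) + (\<psi> (b + c) x - \<psi> b x - \<psi> c x)"
    using 2 4 by (simp add: H.scale_right_distrib)
  also have "\<dots> = (\<psi> (b + (c + d)) x - \<psi> b x - \<psi> (c + d) x) + (\<psi> (c + d) x - \<psi> c x - \<psi> d x)"
    by (simp add: algebra_simps)
  also have "\<dots> = sH (\<rho> (x(Suc k := b))) (\<kappa> b (c + d))" using 1 3 by simp
  finally show ?thesis using x(5) by simp
qed

text \<open>The cocycle identity exhibits \<open>\<kappa>\<close> as the coboundary of \<open>b \<mapsto> \<kappa> b0 (b - b0)\<close>, and subtracting
  this correction makes the slice extensions additive.\<close>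

definition \<psi>' :: "'v \<Rightarrow> (nat \<Rightarrow> 'v) \<Rightarrow> 'w" where
  "\<psi>' b x = \<psi> b x - sH (\<rho> (x(Suc k := b))) (\<kappa> b0 (b - b0))"

text \<open>The cocycle identity taken at the triple \<open>b0\<close>, \<open>b - b0\<close>,
  \<open>c\<close>.\<close>

lemma \<kappa>_coboundary:
  assumes "ind0 b0 b c"
  shows "\<kappa> b c = \<kappa> b0 (b + c - b0) - \<kappa> b0 (b - b0)"
  using \<kappa>_cocycle[OF ind0_diff2[OF assms]] by (simp add: algebra_simps)

lemma \<psi>'_add:
  assumes ind: "ind0 b0 b c" and x: "x \<in> points k" "b \<in> fib x" "c \<in> fib x"
  shows "\<psi>' (b + c) x = \<psi>' b x + \<psi>' c x"
proof -
  have ind': "ind0 b c b0" using ind ind0_swap12 ind0_swap23 by blast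
  have W: "b \<in> W" "c \<in> W" using ind0_W[OF ind] by auto
  have "\<psi> (b + c) x - \<psi> b x - \<psi> c x = sH (\<rho> (x(Suc k := b))) (\<kappa> b c) + sH (\<rho> (x(Suc k := c))) (\<kappa> c b)"
    using defect_\<kappa>[OF ind'] x unfolding defect_def by blast
  then have "\<psi> (b + c) x = \<psi> b x + \<psi> c x + (sH (\<rho> (x(Suc k := b))) (\<kappa> b c) + sH (\<rho> (x(Suc k := c))) (\<kappa> c b))"
    by (simp add: algebra_simps)
  moreover have "\<kappa> b c = \<kappa> b0 (b + c - b0) - \<kappa> b0 (b - b0)" "\<kappa> c b = \<kappa> b0 (b + c - b0) - \<kappa> b0 (c - b0)"
    using \<kappa>_coboundary[OF ind] \<kappa>_coboundary[OF ind0_swap23[OF ind]] by (simp_all add: add.commute)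
  ultimately show ?thesis
    by (simp add: \<psi>'_def \<rho>_add[OF x(1) W] H.scale_left_distrib H.scale_right_diff_distrib algebra_simps)
qed

lemma \<psi>'_extends:
  assumes "ind0 c d b"
  shows "extends_slice b (\<psi>' b)"
  unfolding extends_slice_def
proof
  have e: "extends_slice b (\<psi> b)" using \<psi>_extends[OF assms] .
  have "b \<in> W" using ind0_W[OF assms] by auto
  then show "ml {1..k} (variety k (slices k b \<Gamma>)) (\<psi>' b)"
    unfolding \<psi>'_def using e variety_points unfolding extends_slice_def
    by (intro ml_fun_diff ml_slice_\<rho>) auto
  show "\<forall>x\<in>points k. b \<in> fib x \<longrightarrow> \<rho> (x(Suc k := b)) = 0 \<longrightarrow> \<psi>' b x = \<phi> (x(Suc k := b))"
    using e unfolding extends_slice_def \<psi>'_def by simp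
qed

section \<open>Homogeneity in the last coordinate\<close>

definition scale_defect :: "'f \<Rightarrow> 'v \<Rightarrow> 'w \<Rightarrow> bool" where
  "scale_defect t b h \<longleftrightarrow> (\<forall>x\<in>points k. b \<in> fib x \<longrightarrow>
     \<psi>' (sG t b) x - sH t (\<psi>' b x) = sH (\<rho> (x(Suc k := b))) h)"

text \<open>The slices of \<open>\<rho>\<close> at \<open>b\<close> and at \<open>sG t b\<close>
  have the same zeros. There both values come from \<open>\<phi>\<close>, which is homogeneous, so
  uniqueness turns the difference into a multiple of the slice.\<close>

lemma scale_defect_exists:
  assumes ind: "ind0 c d b" and t: "t \<noteq> 0"
  shows "\<exists>h. scale_defect t b h"
proof -
  have W: "b \<in> W" using ind0_W[OF ind] by auto
  have "ind0 d c (sG t b)" using ind t ind0_scale1 ind0_swap12 ind0_swap23 by blast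
  then have e: "extends_slice b (\<psi>' b)" "extends_slice (sG t b) (\<psi>' (sG t b))"
    using \<psi>'_extends ind by blast+
  let ?S = "variety k (slices k b \<Gamma>)"
  have S: "x \<in> ?S \<longleftrightarrow> x \<in> points k \<and> b \<in> fib x" for x
    using fib_slices W variety_points by blast
  have sub: "?S \<subseteq> variety k (slices k (sG t b) \<Gamma>)"
    using S fib_slices W fib_scale by (meson V_simps(4) subsetI)
  have "ml {1..k} ?S (\<lambda>x. sH t (\<psi>' b x))"
    using e(1) unfolding extends_slice_def mlin_def by (simp add: H.scale_right_distrib mult.commute)
  then have ml: "ml {1..k} ?S (\<lambda>x. \<psi>' (sG t b) x - sH t (\<psi>' b x))"
    using e(2) mlin_subset[OF _ order_refl sub] unfolding extends_slice_def by (intro ml_fun_diff) blast+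
  have "\<exists>h. \<forall>x\<in>?S. \<psi>' (sG t b) x - sH t (\<psi>' b x) = sH (\<rho> (x(Suc k := b))) h"
  proof (rule ind0_unique[OF uniq ind slices_triple ml])
    fix x assume "x \<in> ?S" and \<rho>: "\<rho> (x(Suc k := b)) = 0"
    then have x: "x \<in> points k" "b \<in> fib x" using S by auto
    have "\<psi>' b x = \<phi> (x(Suc k := b))" using e(1) x \<rho> unfolding extends_slice_def by blast
    moreover have "\<psi>' (sG t b) x = \<phi> (x(Suc k := sG t b))"
      using e(2) x \<rho> fib_scale \<rho>_scale[OF x(1) W] unfolding extends_slice_def by simp
    ultimately show "\<psi>' (sG t b) x - sH t (\<psi>' b x) = 0" using \<phi>_scale[OF x(2) \<rho>] by simp
  qed
  then show ?thesis unfolding scale_defect_def using S by blast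
qed

text \<open>Additivity of \<open>\<psi>'\<close> makes the defect at \<open>b + c\<close> the sum of
  those at \<open>b\<close> and \<open>c\<close>. Points at which just one of the two slices
  survives then identify all three coefficients.\<close>

lemma scale_defect_same:
  assumes ind: "ind0 b0 b c" and t: "t \<noteq> 0" and h: "scale_defect t b h"
  shows "scale_defect t c h"
proof -
  have W: "b \<in> W" "c \<in> W" using ind0_W[OF ind] by auto
  obtain hc where hc: "scale_defect t c hc" using scale_defect_exists[OF ind t] by blast
  have inds: "ind0 b0 c (b + c)" using ind ind0_add1 ind0_swap12 ind0_swap23 by blast
  obtain hs where hs: "scale_defect t (b + c) hs" using scale_defect_exists[OF inds t] by blast
  have indt: "ind0 b0 (sG t b) (sG t c)" using ind t ind0_scale1 ind0_swap12 ind0_swap23 by meson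
  have sum: "sH (\<rho> (x(Suc k := b))) hs + sH (\<rho> (x(Suc k := c))) hs =
      sH (\<rho> (x(Suc k := b))) h + sH (\<rho> (x(Suc k := c))) hc"
    if x: "x \<in> points k" "b \<in> fib x" "c \<in> fib x" for x
  proof -
    have "\<psi>' (sG t (b + c)) x = \<psi>' (sG t b) x + \<psi>' (sG t c) x"
      using \<psi>'_add[OF indt x(1)] x fib_scale by (simp add: G.scale_right_distrib)
    moreover have "\<psi>' (b + c) x = \<psi>' b x + \<psi>' c x" by (rule \<psi>'_add[OF ind x])
    moreover have "\<psi>' (sG t (b + c)) x - sH t (\<psi>' (b + c) x) = sH (\<rho> (x(Suc k := b + c))) hs"
      using hs x fib_add unfolding scale_defect_def by blast
    ultimately have "(\<psi>' (sG t b) x - sH t (\<psi>' b x)) + (\<psi>' (sG t c) x - sH t (\<psi>' c x)) =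
        sH (\<rho> (x(Suc k := b))) hs + sH (\<rho> (x(Suc k := c))) hs"
      by (simp add: \<rho>_add[OF x(1) W] H.scale_left_distrib H.scale_right_distrib algebra_simps)
    moreover have "\<psi>' (sG t b) x - sH t (\<psi>' b x) = sH (\<rho> (x(Suc k := b))) h"
      "\<psi>' (sG t c) x - sH t (\<psi>' c x) = sH (\<rho> (x(Suc k := c))) hc"
      using h hc x unfolding scale_defect_def by blast+
    ultimately show ?thesis by simp
  qed
  obtain x where "x \<in> points k" "b \<in> fib x" "c \<in> fib x" "\<rho> (x(Suc k := b)) \<noteq> 0" "\<rho> (x(Suc k := c)) = 0"
    using ind0_point[of b0 c b] ind ind0_swap23 by metis
  then have "hs = h" using sum by fastforce
  moreover obtain x where "x \<in> points k" "b \<in> fib x" "c \<in> fib x" "\<rho> (x(Suc k := b)) = 0" "\<rho> (x(Suc k := c)) \<noteq> 0"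
    using ind0_point[OF ind] by metis
  then have "hs = hc" using sum by fastforce
  ultimately show ?thesis using hc by simp
qed

text \<open>The homogeneity defect is a derivation of the finite field, and \<open>t ^ CARD('f) = t\<close> kills those.\<close>

lemma \<psi>'_scale:
  assumes ind: "ind0 b0 b c" and t: "t \<noteq> 0" and x: "x \<in> points k" "b \<in> fib x"
  shows "\<psi>' (sG t b) x = sH t (\<psi>' b x)"
proof -
  have W: "b \<in> W" "c \<in> W" using ind0_W[OF ind] by auto
  have indb: "ind0 b0 c b" using ind ind0_swap23 by blast
  obtain h where h: "scale_defect t b h" using scale_defect_exists[OF indb t] by blast
  \<comment> \<open>With \<open>D t = h\<close>, the product rule
    \<open>D (t * s) = t * D s + s * D t\<close> gives
    \<open>D (t ^ n) = n * t ^ (n - 1) * D t\<close>; writing \<open>t ^ n\<close> and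
    \<open>1 / t\<close> avoids the exponent \<open>n - 1\<close>. At \<open>n = CARD('f)\<close>
    the factor \<open>n\<close> becomes 0.\<close>
  have "scale_defect (t ^ n) b (sH (of_nat n * t ^ n) (sH (1 / t) h))" for n
  proof (induction n)
    case 0
    show ?case by (simp add: scale_defect_def)
  next
    case (Suc n)
    let ?s = "t ^ n"
    have s: "?s \<noteq> 0" using t by simp
    \<comment> \<open>\<open>b\<close> and its multiple \<open>sG ?s b\<close> are never
      independent, so the coefficient is carried from one to the other by way of
      \<open>c\<close>.\<close>
    have "scale_defect t c h" by (rule scale_defect_same[OF ind t h])
    moreover have "ind0 b0 c (sG ?s b)" using ind s ind0_scale1 ind0_swap12 ind0_swap23 by meson
    ultimately have hs: "scale_defect t (sG ?s b) h" using scale_defect_same t by blast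
    show ?case
      unfolding scale_defect_def
    proof (intro ballI impI)
      fix y assume y: "y \<in> points k" "b \<in> fib y"
      let ?r = "\<rho> (y(Suc k := b))"
      have "\<psi>' (sG ?s b) y - sH ?s (\<psi>' b y) = sH ?r (sH (of_nat n * ?s) (sH (1 / t) h))"
        using Suc y unfolding scale_defect_def by blast
      then have 1: "\<psi>' (sG ?s b) y = sH ?s (\<psi>' b y) + sH ?r (sH (of_nat n * ?s) (sH (1 / t) h))"
        by (simp add: algebra_simps)
      have "\<psi>' (sG t (sG ?s b)) y - sH t (\<psi>' (sG ?s b) y) = sH (\<rho> (y(Suc k := sG ?s b))) h"
        using hs y fib_scale unfolding scale_defect_def by blast
      then have "\<psi>' (sG t (sG ?s b)) y = sH t (\<psi>' (sG ?s b) y) + sH (?s * ?r) h"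
        using \<rho>_scale[OF y(1) W(1)] by (simp add: algebra_simps)
      then have "\<psi>' (sG (t ^ Suc n) b) y - sH (t ^ Suc n) (\<psi>' b y) =
          sH t (sH ?r (sH (of_nat n * ?s) (sH (1 / t) h))) + sH (?s * ?r) h"
        by (simp add: 1 H.scale_right_distrib)
      also have "\<dots> = sH (t * ?r * (of_nat n * ?s) * (1 / t) + ?s * ?r) h"
        by (simp add: H.scale_left_distrib)
      also have "t * ?r * (of_nat n * ?s) * (1 / t) + ?s * ?r = ?r * (of_nat (Suc n) * t ^ Suc n) * (1 / t)"
        using t by (simp add: field_simps)
      also have "sH \<dots> h = sH ?r (sH (of_nat (Suc n) * t ^ Suc n) (sH (1 / t) h))"
        by simp
      finally show "\<psi>' (sG (t ^ Suc n) b) y - sH (t ^ Suc n) (\<psi>' b y) =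
          sH ?r (sH (of_nat (Suc n) * t ^ Suc n) (sH (1 / t) h))" .
    qed
  qed
  from this[of "CARD('f)"] have "scale_defect t b 0"
    by (simp only: finite_field_power_card of_nat_card_eq_0 mult_zero_left H.scale_zero_left)
  then show ?thesis using x unfolding scale_defect_def by simp
qed

section \<open>Transport to arbitrary last coordinates\<close>

lemma generic_ind0:
  assumes "generic b0 b" "b \<in> zfib"
  obtains c where "ind0 b0 b c"
proof -
  have "zfib \<noteq> {}" using b0 by blast
  then obtain c where "c \<in> zfib" "ind b0 b c" using generic_pick[OF assms(1) zero_pt_points] by blast
  then show ?thesis using that assms b0 unfolding ind0_def by blast
qed

lemma generic_scale:
  assumes "generic b0 b" "b \<in> W" "t \<noteq> 0"
  shows "generic b0 (sG t b)"
proof -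
  have "{c \<in> W. \<not> ind b0 (sG t b) c} \<subseteq> {c \<in> W. \<not> ind b0 b c}"
    using ind_scale2 assms by blast
  then have "card {c \<in> W. \<not> ind b0 (sG t b) c} \<le> card {c \<in> W. \<not> ind b0 b c}"
    by (intro card_mono) auto
  then show ?thesis using assms(1) unfolding generic_def small_def by (meson mult_le_mono1 order_trans)
qed

text \<open>Both sides equal \<open>\<psi>' (a + d) x - \<psi>' d x\<close> for a further
  \<open>d\<close>, because \<open>(a + b) + d = b + (a + d)\<close> and \<open>\<psi>'\<close> is
  additive on each side. Each of \<open>b\<close> and \<open>c\<close> asks \<open>d\<close> to
  avoid two exceptional sets.\<close>

lemma \<psi>'_difference_const:
  assumes x: "x \<in> points k" "a \<in> fib x" "b \<in> fib x" "c \<in> fib x"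
    and gen: "generic b0 b" "generic b0 (a + b)" "generic b0 c" "generic b0 (a + c)"
  shows "\<psi>' (a + b) x - \<psi>' b x = \<psi>' (a + c) x - \<psi>' c x"
proof -
  have a: "a \<in> W" using x fib_W by blast
  let ?X = "\<lambda>b. {d \<in> W. \<not> ind b0 b d}" and ?Y = "\<lambda>b. {d \<in> W. \<not> ind b0 b (a + d)}"
  have small: "small (?X (a + b))" "small (?Y b)" "small (?X (a + c))" "small (?Y c)"
    using gen a small_shift[of "ind b0 _" a] unfolding generic_def by auto
  have sub: "?X (a + b) \<subseteq> W" "?Y b \<subseteq> W" "?X (a + c) \<subseteq> W" "?Y c \<subseteq> W" by auto
  have ne: "fib x \<noteq> {}" using x by blast
  obtain d where d: "d \<in> fib x" "d \<notin> ?X (a + b)" "d \<notin> ?Y b" "d \<notin> ?X (a + c)" "d \<notin> ?Y c"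
    by (rule fib_pick[OF x(1) ne x(1) ne small sub]) (rule that)
  have eq: "\<psi>' (a + b) x - \<psi>' b x = \<psi>' (a + d) x - \<psi>' d x"
    if b: "b \<in> fib x" "d \<notin> ?X (a + b)" "d \<notin> ?Y b" for b
  proof -
    have z: "a \<in> zfib" "b \<in> zfib" "d \<in> zfib" using x b d fib_zero by blast+
    have "ind0 b0 (a + b) d" "ind0 b0 b (a + d)"
      using b z fib_W fib_add b0(1) unfolding ind0_def by blast+
    then have "\<psi>' (a + b + d) x = \<psi>' (a + b) x + \<psi>' d x" "\<psi>' (b + (a + d)) x = \<psi>' b x + \<psi>' (a + d) x"
      using x b d fib_add by (auto intro!: \<psi>'_add)
    moreover have "a + b + d = b + (a + d)" by (simp add: algebra_simps)
    ultimately have "\<psi>' (a + b) x + \<psi>' d x = \<psi>' b x + \<psi>' (a + d) x" by metis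
    then show ?thesis by (simp add: algebra_simps)
  qed
  show ?thesis using eq[OF x(3) d(2,3)] eq[OF x(4) d(4,5)] by simp
qed

text \<open>The choice of \<open>b\<close> is immaterial by \<open>\<psi>'_difference_const\<close>;
  each lemma below picks a \<open>b\<close> suited to its purpose.\<close>

definition val :: "(nat \<Rightarrow> 'v) \<Rightarrow> 'v \<Rightarrow> 'w" where
  "val y a = (SOME w. \<exists>b. b \<in> fib y \<and> generic b0 b \<and> generic b0 (a + b) \<and> w = \<psi>' (a + b) y - \<psi>' b y)"

lemma val_eq:
  assumes "y \<in> points k" "a \<in> fib y" "b \<in> fib y" "generic b0 b" "generic b0 (a + b)"
  shows "val y a = \<psi>' (a + b) y - \<psi>' b y"
proof -
  have "\<exists>w b. b \<in> fib y \<and> generic b0 b \<and> generic b0 (a + b) \<and> w = \<psi>' (a + b) y - \<psi>' b y"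
    using assms by blast
  from someI_ex[OF this] obtain c where "c \<in> fib y" "generic b0 c" "generic b0 (a + c)"
    "val y a = \<psi>' (a + c) y - \<psi>' c y"
    unfolding val_def by blast
  then show ?thesis using \<psi>'_difference_const assms by metis
qed

lemma generic_in_fib_pick:
  assumes "x \<in> points k" "a \<in> fib x" "y \<in> points k" "fib y \<noteq> {}" "a' \<in> W"
  obtains b where "b \<in> fib x" "b \<in> fib y" "\<rho> (x(Suc k := b)) = 0"
    "generic b0 b" "generic b0 (a + b)" "generic b0 (a' + b)"
  using generic_pair_pick[OF b0(2) fib_W[OF assms(2)] assms(5) assms(1) _ assms(3,4)] assms(2) by blast

text \<open>With \<open>b\<close>, \<open>v + b\<close> and \<open>u + v + b\<close> all generic,
  the differences telescope.\<close>

lemma val_add: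
  assumes y: "y \<in> points k" and uv: "u \<in> fib y" "v \<in> fib y"
  shows "val y (u + v) = val y u + val y v"
proof -
  have ne: "fib y \<noteq> {}" using uv by blast
  obtain b where b: "b \<in> fib y" "generic b0 b" "generic b0 (v + b)" "generic b0 (u + v + b)"
    using generic_in_fib_pick[OF y uv(2) y ne fib_W[OF fib_add[OF uv]]] .
  have "val y v = \<psi>' (v + b) y - \<psi>' b y" using y uv b by (intro val_eq) auto
  moreover have "val y u = \<psi>' (u + (v + b)) y - \<psi>' (v + b) y"
    using y uv b fib_add by (intro val_eq) (auto simp: add.assoc)
  moreover have "val y (u + v) = \<psi>' (u + v + b) y - \<psi>' b y"
    using y uv b fib_add by (intro val_eq) auto
  ultimately show ?thesis by (simp add: add.assoc)
qed

text \<open>The auxiliary point is scaled along with \<open>u\<close>. At \<open>t = 0\<close> it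
  would cease to be generic, whence the separate case.\<close>

lemma val_scale:
  assumes y: "y \<in> points k" and u: "u \<in> fib y"
  shows "val y (sG t u) = sH t (val y u)"
proof (cases "t = 0")
  case True
  have "0 \<in> fib y" using fib_diff[OF u u] by simp
  then have "val y (0 + 0) = val y 0 + val y 0" using val_add y by blast
  then show ?thesis using True by simp
next
  case False
  have uW: "u \<in> W" using u fib_W by blast
  obtain b where b: "b \<in> fib y" "generic b0 b" "generic b0 (u + b)"
    using generic_in_fib_pick[OF y u y _ uW] u by blast
  have bW: "b \<in> W" "u + b \<in> W" using b uW fib_W by auto
  have g: "generic b0 (sG t b)" "generic b0 (sG t u + sG t b)"
    using generic_scale[OF b(2) bW(1) False] generic_scale[OF b(3) bW(2) False]
    by (simp_all add: G.scale_right_distrib)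
  have z: "b \<in> zfib" "u + b \<in> zfib" using y b u fib_zero fib_add by blast+
  have "\<psi>' (sG t b) y = sH t (\<psi>' b y)"
    using generic_ind0[OF b(2) z(1)] \<psi>'_scale False y b(1) by metis
  moreover have "\<psi>' (sG t (u + b)) y = sH t (\<psi>' (u + b) y)"
    using generic_ind0[OF b(3) z(2)] \<psi>'_scale False y fib_add[OF u b(1)] by metis
  moreover have "val y (sG t u) = \<psi>' (sG t u + sG t b) y - \<psi>' (sG t b) y"
    using y u b g fib_scale by (intro val_eq) auto
  moreover have "val y u = \<psi>' (u + b) y - \<psi>' b y" using y u b by (intro val_eq) auto
  ultimately show ?thesis by (simp add: G.scale_right_distrib H.scale_right_diff_distrib)
qed

lemma fib_slice_iff: "a \<in> W \<Longrightarrow> a \<in> fib x \<and> x \<in> points k \<longleftrightarrow> x \<in> variety k (slices k a \<Gamma>)"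
  using fib_slices variety_points by blast

lemma generic_\<psi>'_ml:
  assumes "generic b0 b" "b \<in> zfib"
  shows "ml {1..k} (variety k (slices k b \<Gamma>)) (\<psi>' b)"
  using generic_ind0[OF assms] \<psi>'_extends ind0_swap23 unfolding extends_slice_def by metis

text \<open>The points that differ in the coordinate \<open>d\<close> are evaluated with one common
  \<open>b\<close>, which lies in both fibres and therefore in that of the sum. Linearity is then
  that of the generic slices at \<open>b\<close> and \<open>a + b\<close>.\<close>

lemma val_ml:
  assumes a: "a \<in> W"
  shows "ml {1..k} (variety k (slices k a \<Gamma>)) (\<lambda>y. val y a)"
  unfolding mlin_def
proof (intro conjI ballI allI impI)
  fix d y u v assume d: "d \<in> {1..k}"
    and u: "y(d := u) \<in> variety k (slices k a \<Gamma>)" and v: "y(d := v) \<in> variety k (slices k a \<Gamma>)"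
  have s: "y(d := u + v) \<in> variety k (slices k a \<Gamma>)"
    using variety_add[OF forms_slices[OF forms_\<Gamma> a] d u v] .
  have u': "y(d := u) \<in> points k" "a \<in> fib (y(d := u))" and v': "y(d := v) \<in> points k" "a \<in> fib (y(d := v))"
    and s': "y(d := u + v) \<in> points k" "a \<in> fib (y(d := u + v))"
    using u v s fib_slice_iff[OF a] by blast+
  obtain b where b: "b \<in> fib (y(d := u))" "b \<in> fib (y(d := v))" "generic b0 b" "generic b0 (a + b)"
    using generic_in_fib_pick[OF u' v'(1) _ a] v'(2) by blast
  then have W: "b \<in> W" "a + b \<in> W" using fib_W a by auto
  have z: "b \<in> zfib" "a + b \<in> zfib" using b u' fib_zero fib_add by blast+
  have "y(d := u) \<in> variety k (slices k b \<Gamma>)" "y(d := v) \<in> variety k (slices k b \<Gamma>)"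
    using u' v' b W fib_slice_iff by blast+
  moreover have "y(d := u) \<in> variety k (slices k (a + b) \<Gamma>)" "y(d := v) \<in> variety k (slices k (a + b) \<Gamma>)"
    using u' v' b W fib_slice_iff fib_add by blast+
  ultimately have "\<psi>' b (y(d := u + v)) = \<psi>' b (y(d := u)) + \<psi>' b (y(d := v))"
    "\<psi>' (a + b) (y(d := u + v)) = \<psi>' (a + b) (y(d := u)) + \<psi>' (a + b) (y(d := v))"
    and "y(d := u + v) \<in> variety k (slices k b \<Gamma>)"
    using ml_add[OF generic_\<psi>'_ml d] b z variety_add[OF forms_slices[OF forms_\<Gamma> W(1)] d] by blast+
  moreover from this(3) have "b \<in> fib (y(d := u + v))" using fib_slice_iff W by blast
  ultimately show "val (y(d := u + v)) a = val (y(d := u)) a + val (y(d := v)) a"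
    using val_eq[OF u' b(1,3,4)] val_eq[OF v' b(2,3,4)] val_eq[OF s' _ b(3,4)] by simp
next
  fix d y u t assume d: "d \<in> {1..k}" and u: "y(d := u) \<in> variety k (slices k a \<Gamma>)"
  have s: "y(d := sG t u) \<in> variety k (slices k a \<Gamma>)"
    using variety_scale[OF forms_slices[OF forms_\<Gamma> a] d u] .
  have u': "y(d := u) \<in> points k" "a \<in> fib (y(d := u))"
    and s': "y(d := sG t u) \<in> points k" "a \<in> fib (y(d := sG t u))"
    using u s fib_slice_iff[OF a] by blast+
  obtain b where b: "b \<in> fib (y(d := u))" "generic b0 b" "generic b0 (a + b)"
    using generic_in_fib_pick[OF u' u'(1) _ a] u'(2) by blast
  then have W: "b \<in> W" "a + b \<in> W" using fib_W a by auto
  have z: "b \<in> zfib" "a + b \<in> zfib" using b u' fib_zero fib_add by blast+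
  have "y(d := u) \<in> variety k (slices k b \<Gamma>)" "y(d := u) \<in> variety k (slices k (a + b) \<Gamma>)"
    using u' b W fib_slice_iff fib_add by blast+
  then have "\<psi>' b (y(d := sG t u)) = sH t (\<psi>' b (y(d := u)))"
    "\<psi>' (a + b) (y(d := sG t u)) = sH t (\<psi>' (a + b) (y(d := u)))"
    and "y(d := sG t u) \<in> variety k (slices k b \<Gamma>)"
    using ml_scale[OF generic_\<psi>'_ml d] b z variety_scale[OF forms_slices[OF forms_\<Gamma> W(1)] d] by blast+
  moreover from this(3) have "b \<in> fib (y(d := sG t u))" using fib_slice_iff W by blast
  ultimately show "val (y(d := sG t u)) a = sH t (val (y(d := u)) a)"
    using val_eq[OF u' b] val_eq[OF s' _ b(2,3)] by (simp add: H.scale_right_diff_distrib)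
qed

text \<open>The auxiliary \<open>b\<close> is taken in the zero set of \<open>\<rho>\<close> as
  well, so that \<open>a\<close>, \<open>b\<close> and \<open>a + b\<close> all complete
  \<open>y\<close> to points of the domain of \<open>\<phi>\<close>.\<close>

lemma val_extends:
  assumes y: "y \<in> points k" and a: "a \<in> fib y" and \<rho>: "\<rho> (y(Suc k := a)) = 0"
  shows "val y a = \<phi> (y(Suc k := a))"
proof -
  have aW: "a \<in> W" using a fib_W by blast
  obtain b where b: "b \<in> fib y" "\<rho> (y(Suc k := b)) = 0" "generic b0 b" "generic b0 (a + b)"
    using generic_in_fib_pick[OF y a y _ aW] a by blast
  have z: "b \<in> zfib" "a + b \<in> zfib" using b a y fib_zero fib_add by blast+
  have e: "extends_slice b (\<psi>' b)" "extends_slice (a + b) (\<psi>' (a + b))"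
    using generic_ind0[OF b(3) z(1)] generic_ind0[OF b(4) z(2)] \<psi>'_extends ind0_swap23 by metis+
  have "\<rho> (y(Suc k := a + b)) = 0" using \<rho>_add[OF y aW fib_W[OF b(1)]] b \<rho> by simp
  then have "\<psi>' b y = \<phi> (y(Suc k := b))" "\<psi>' (a + b) y = \<phi> (y(Suc k := a + b))"
    using e b a y fib_add unfolding extends_slice_def by blast+
  then show ?thesis using val_eq[OF y a b(1,3,4)] \<phi>_add[OF a b(1) \<rho> b(2)] by simp
qed

lemma extension_step:
  "\<exists>\<Psi>. ml {1..Suc k} (variety (Suc k) \<Gamma>) \<Psi> \<and> (\<forall>x\<in>variety (Suc k) \<Gamma>. \<rho> x = 0 \<longrightarrow> \<Psi> x = \<phi> x)"
proof (intro exI conjI ballI impI)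
  let ?\<Psi> = "\<lambda>x. val (restrict x {1..k}) (x (Suc k))"
  have decomp: "restrict x {1..k} \<in> points k" "x (Suc k) \<in> fib (restrict x {1..k})"
    "(restrict x {1..k})(Suc k := x (Suc k)) = x" if x: "x \<in> variety (Suc k) \<Gamma>" for x
  proof -
    obtain y a where y: "y \<in> points k" "a \<in> W" "x = y(Suc k := a)"
      using points_SucE[OF variety_points[OF x]] .
    have r: "restrict x {1..k} = y" "x (Suc k) = a" using y points_restrict by auto
    show "restrict x {1..k} \<in> points k" using y r by simp
    show "x (Suc k) \<in> fib (restrict x {1..k})" using x y r by (simp add: fib_def)
    show "(restrict x {1..k})(Suc k := x (Suc k)) = x" using y r by simp
  qed
  have last: "restrict (x(Suc k := u)) {1..k} = restrict x {1..k}" for x :: "nat \<Rightarrow> 'v" and u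
    by auto
  have inner: "restrict (x(d := u)) {1..k} = (restrict x {1..k})(d := u)" if "d \<in> {1..k}"
    for x :: "nat \<Rightarrow> 'v" and d u
    using that by auto
  show "?\<Psi> x = \<phi> x" if "x \<in> variety (Suc k) \<Gamma>" "\<rho> x = 0" for x
    using val_extends[of "restrict x {1..k}" "x (Suc k)"] decomp[OF that(1)] that(2) by simp
  have slice: "(restrict x {1..k})(d := u) \<in> variety k (slices k (x (Suc k)) \<Gamma>) \<and> x (Suc k) \<in> W"
    if "x(d := u) \<in> variety (Suc k) \<Gamma>" "d \<in> {1..k}" for x d u
  proof -
    have d: "Suc k \<noteq> d" using that(2) by auto
    then have "x (Suc k) \<in> fib ((restrict x {1..k})(d := u))" "(restrict x {1..k})(d := u) \<in> points k"
      using decomp(1,2)[OF that(1)] inner[OF that(2), of x u] by simp_all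
    then show ?thesis using fib_slice_iff fib_W by blast
  qed
  show "ml {1..Suc k} (variety (Suc k) \<Gamma>) ?\<Psi>"
    unfolding mlin_def
  proof (intro conjI ballI allI impI)
    fix d x u v assume d: "d \<in> {1..Suc k}"
      and u: "x(d := u) \<in> variety (Suc k) \<Gamma>" and v: "x(d := v) \<in> variety (Suc k) \<Gamma>"
    show "?\<Psi> (x(d := u + v)) = ?\<Psi> (x(d := u)) + ?\<Psi> (x(d := v))"
    proof (cases "d = Suc k")
      case True
      then show ?thesis
        using val_add[of "restrict x {1..k}" u v] decomp(1,2)[OF u] decomp(2)[OF v] by (simp add: last)
    next
      case False
      then have d': "d \<in> {1..k}" using d by auto
      have W: "x (Suc k) \<in> W" using slice[OF u d'] by blast
      show ?thesis
        using ml_add[OF val_ml[OF W] d', of "restrict x {1..k}" u v] slice[OF u d'] slice[OF v d'] False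
        by (simp only: inner[OF d'] fun_upd_other[OF not_sym[OF False]])
    qed
  next
    fix d x u t assume d: "d \<in> {1..Suc k}" and u: "x(d := u) \<in> variety (Suc k) \<Gamma>"
    show "?\<Psi> (x(d := sG t u)) = sH t (?\<Psi> (x(d := u)))"
    proof (cases "d = Suc k")
      case True
      then show ?thesis
        using val_scale[of "restrict x {1..k}" u t] decomp(1,2)[OF u] by (simp add: last)
    next
      case False
      then have d': "d \<in> {1..k}" using d by auto
      have W: "x (Suc k) \<in> W" using slice[OF u d'] by blast
      show ?thesis
        using ml_scale[OF val_ml[OF W] d', of "restrict x {1..k}" u t] slice[OF u d'] False
        by (simp only: inner[OF d'] fun_upd_other[OF not_sym[OF False]])
    qed
  qed
qed

end

context finite_spaces
begin

section \<open>Induction for existence\<close>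

text \<open>Composes \<open>\<phi>\<close> with the projection onto the kernel of
  \<open>\<rho>\<close> along a vector \<open>u0\<close> outside it.\<close>

lemma extension_at_1: "extension_at 1"
  unfolding extension_at_def One_nat_def
proof (intro allI impI)
  fix m :: nat and \<Gamma> \<rho> \<phi>
  assume forms: "forms (Suc 0) \<Gamma>" and \<rho>: "form (Suc 0) {Suc 0..Suc 0} \<rho>"
    and \<phi>: "ml {Suc 0..Suc 0} {x \<in> variety (Suc 0) \<Gamma>. \<rho> x = 0} \<phi>"
  let ?B = "variety (Suc 0) \<Gamma>"
  show "\<exists>\<psi>. ml {Suc 0..Suc 0} ?B \<psi> \<and> (\<forall>x\<in>?B. \<rho> x = 0 \<longrightarrow> \<psi> x = \<phi> x)"
  proof (cases "\<forall>x\<in>?B. \<rho> x = 0")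
    case True
    then have "{x \<in> ?B. \<rho> x = 0} = ?B" by blast
    then show ?thesis using \<phi> by auto
  next
    case False
    let ?e = "\<lambda>u. (zero_pt 0)(Suc 0 := u)"
    obtain u0 where u0: "?e u0 \<in> ?B" "\<rho> (?e u0) \<noteq> 0"
      using False variety_points points_1E by metis
    define p where "p x = ?e (x (Suc 0) - sG (\<rho> x / \<rho> (?e u0)) u0)" for x
    have e: "x = ?e (x (Suc 0))" if x: "x \<in> ?B" for x
    proof -
      obtain u where u: "x = ?e u" using points_1E[OF variety_points[OF x]] .
      then have "x (Suc 0) = u" by simp
      then show ?thesis using u by (simp only:)
    qed
    have upd: "x(Suc 0 := u) = ?e u" if "x(Suc 0 := u) \<in> ?B" for x u
      using e[OF that] by (simp only: fun_upd_same)
    have B: "?e (u + v) \<in> ?B" "?e (sG c u) \<in> ?B" "?e (u - v) \<in> ?B"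
      if "?e u \<in> ?B" "?e v \<in> ?B" for u v c
      using that forms variety_add[OF forms, of "Suc 0"] variety_scale[OF forms, of "Suc 0"]
        variety_diff[OF forms, of "Suc 0"] by auto
    have \<rho>_lin: "\<rho> (?e (u + v)) = \<rho> (?e u) + \<rho> (?e v)" "\<rho> (?e (sG c u)) = c * \<rho> (?e u)"
      "\<rho> (?e (u - v)) = \<rho> (?e u) - \<rho> (?e v)"
      if "?e u \<in> ?B" "?e v \<in> ?B" for u v c
      using that variety_points form_add[OF \<rho>, of "Suc 0"] form_scale[OF \<rho>, of "Suc 0"]
        form_diff[OF \<rho>, of "Suc 0"] by auto
    have p: "p x \<in> {x \<in> ?B. \<rho> x = 0}" if x: "x \<in> ?B" for x
    proof -
      have ex: "?e (x (Suc 0)) \<in> ?B" using x e by metis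
      have s: "?e (sG (\<rho> x / \<rho> (?e u0)) u0) \<in> ?B" using B(2) u0 by blast
      have "\<rho> (p x) = \<rho> x - \<rho> x / \<rho> (?e u0) * \<rho> (?e u0)"
        unfolding p_def \<rho>_lin(3)[OF ex s] \<rho>_lin(2)[OF u0(1) u0(1)] by (simp only: e[OF x, symmetric])
      moreover have "p x \<in> ?B" unfolding p_def using B(3)[OF ex s] .
      ultimately show ?thesis using u0 by simp
    qed
    show ?thesis
    proof (intro exI[of _ "\<lambda>x. \<phi> (p x)"] conjI ballI impI)
      show "\<phi> (p x) = \<phi> x" if "x \<in> ?B" "\<rho> x = 0" for x
        using that e[OF that(1)] by (simp add: p_def)
      show "ml {Suc 0..Suc 0} ?B (\<lambda>x. \<phi> (p x))"
        unfolding mlin_def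
      proof (intro conjI ballI allI impI)
        fix d x u v assume "d \<in> {Suc 0..Suc 0}" "x(d := u) \<in> ?B" "x(d := v) \<in> ?B"
        then have d: "d = Suc 0" and uv: "?e u \<in> ?B" "?e v \<in> ?B" "x(d := u) = ?e u" "x(d := v) = ?e v"
          using upd by auto
        then have s: "x(d := u + v) = ?e (u + v)" by (metis fun_upd_upd)
        have "p (?e (u + v)) = (zero_pt 0)(Suc 0 := (p (?e u)) (Suc 0) + (p (?e v)) (Suc 0))"
          using \<rho>_lin(1)[OF uv(1,2)] by (simp add: p_def add_divide_distrib G.scale_left_distrib algebra_simps)
        then show "\<phi> (p (x(d := u + v))) = \<phi> (p (x(d := u))) + \<phi> (p (x(d := v)))"
          using ml_add[OF \<phi>, of "Suc 0" "zero_pt 0" "(p (?e u)) (Suc 0)" "(p (?e v)) (Suc 0)"]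
            p[OF uv(1)] p[OF uv(2)] e[of "p (?e u)"] e[of "p (?e v)"] uv s by simp
      next
        fix d x u c assume "d \<in> {Suc 0..Suc 0}" "x(d := u) \<in> ?B"
        then have d: "d = Suc 0" and u: "?e u \<in> ?B" "x(d := u) = ?e u"
          using upd by auto
        then have s: "x(d := sG c u) = ?e (sG c u)" by (metis fun_upd_upd)
        have "p (?e (sG c u)) = (zero_pt 0)(Suc 0 := sG c ((p (?e u)) (Suc 0)))"
          using \<rho>_lin(2)[OF u(1) u(1)] by (simp add: p_def G.scale_right_diff_distrib)
        then show "\<phi> (p (x(d := sG c u))) = sH c (\<phi> (p (x(d := u))))"
          using ml_scale[OF \<phi>, of "Suc 0" "zero_pt 0" "(p (?e u)) (Suc 0)"]
            p[OF u(1)] e[of "p (?e u)"] u s by simp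
      qed
    qed
  qed
qed

lemma extension_at: "k \<ge> 1 \<Longrightarrow> extension_at k"
proof (induction k rule: nat_induct_at_least)
  case base
  show ?case by (rule extension_at_1)
next
  case (Suc k)
  show ?case
    unfolding extension_at_def
  proof (intro allI impI)
    fix m \<Gamma> \<rho> \<phi>
    assume *: "forms (Suc k) \<Gamma>" "card \<Gamma> \<le> m" "form (Suc k) {1..Suc k} \<rho>"
      "rank_cond (Suc k) (req (Suc k) m) \<Gamma> \<rho>"
      and \<phi>: "ml {1..Suc k} {x \<in> variety (Suc k) \<Gamma>. \<rho> x = 0} \<phi>"
    interpret rank_step sG sH V k m \<Gamma> \<rho>
      using Suc.hyps * by unfold_locales auto
    show "\<exists>\<psi>. ml {1..Suc k} (variety (Suc k) \<Gamma>) \<psi> \<and> (\<forall>x\<in>variety (Suc k) \<Gamma>. \<rho> x = 0 \<longrightarrow> \<psi> x = \<phi> x)"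
    proof (cases "variety (Suc k) \<Gamma> = {}")
      \<comment> \<open>A form with empty index set can be a nonzero constant. The variety is then
        empty and there is no generic base to work with.\<close>
      case True
      then show ?thesis by (auto simp: mlin_def)
    next
      case False
      then have zero: "zero_pt (Suc k) \<in> variety (Suc k) \<Gamma>"
        using zero_pt_variety[OF *(1)] by blast
      obtain b0 where "b0 \<in> zfib" "small {b \<in> W. \<not> generic b0 b}" using ex_generic[OF zero] .
      then interpret extension_step sG sH V k m \<Gamma> \<rho> \<phi> b0
        using Suc.IH \<phi> by unfold_locales auto
      show ?thesis by (rule extension_step)
    qed
  qed
qed

end

section \<open>From characters to counting\<close>

text \<open>A sum is recovered from the subtraction identity as \<open>u - (- v)\<close>, with
  \<open>- v\<close> supplied by homogeneity; \<open>closed\<close> keeps the second point in the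
  domain.\<close>

lemma multilinear_on_imp_mlin:
  assumes "vector_space s" "vector_space t" and \<phi>: "multilinear_on s t J S \<phi>" and D: "D \<subseteq> J"
    and closed: "\<And>d x u c. d \<in> D \<Longrightarrow> x(d := u) \<in> S \<Longrightarrow> x(d := s c u) \<in> S"
  shows "mlin s t D S \<phi>"
  unfolding mlin_def
proof (intro conjI ballI allI impI)
  interpret s: vector_space s by fact
  interpret t: vector_space t by fact
  show scale: "\<phi> (x(d := s c u)) = t c (\<phi> (x(d := u)))" if "d \<in> D" "x(d := u) \<in> S" for d x u c
  proof -
    have "\<phi> ((x(d := u))(d := s c ((x(d := u)) d))) = t c (\<phi> (x(d := u)))"
      using \<phi> D that unfolding multilinear_on_def by blast
    then show ?thesis by simp
  qed
  fix d x u v assume d: "d \<in> D" and uv: "x(d := u) \<in> S" "x(d := v) \<in> S"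
  let ?y = "x(d := s (-1) v)"
  have "?y \<in> S" using closed d uv by blast
  moreover have "\<forall>i\<in>J - {d}. (x(d := u)) i = ?y i" by simp
  ultimately have "\<phi> (ominus d (x(d := u)) ?y) = \<phi> (x(d := u)) - \<phi> ?y"
    using \<phi> d D uv unfolding multilinear_on_def multiadditive_on_def by blast
  then show "\<phi> (x(d := u + v)) = \<phi> (x(d := u)) + \<phi> (x(d := v))"
    using scale[OF d uv(2), of "-1"] by (simp add: ominus_def)
qed

text \<open>Extensionality turns agreement off \<open>d\<close> into \<open>y = x(d := y d)\<close>,
  the way in which \<open>mlin\<close> varies a coordinate.\<close>

lemma mlin_imp_multilinear_on:
  assumes "vector_space s" "vector_space t" and \<phi>: "mlin s t J S \<phi>" and S: "S \<subseteq> extensional J"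
    and closed: "\<And>d x u c. d \<in> J \<Longrightarrow> x(d := u) \<in> S \<Longrightarrow> x(d := s c u) \<in> S"
  shows "multilinear_on s t J S \<phi>"
  unfolding multilinear_on_def multiadditive_on_def
proof (intro conjI ballI allI impI)
  interpret s: vector_space s by fact
  interpret t: vector_space t by fact
  show "\<phi> (x(d := s c (x d))) = t c (\<phi> x)" if "d \<in> J" "x \<in> S" for d x c
  proof -
    have "x(d := x d) \<in> S" using that by simp
    then have "\<phi> (x(d := s c (x d))) = t c (\<phi> (x(d := x d)))"
      using \<phi> that(1) unfolding mlin_def by blast
    then show ?thesis by simp
  qed
  fix d x y assume d: "d \<in> J" and xy: "x \<in> S" "y \<in> S" and eq: "\<forall>i\<in>J - {d}. x i = y i"
  have y: "y = x(d := y d)"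
  proof
    fix i
    have ext: "x \<in> extensional J" "y \<in> extensional J" using xy S by auto
    have "x i = y i" if "i \<notin> J" using extensional_arb[OF ext(1) that] extensional_arb[OF ext(2) that] by simp
    then have "x i = y i" if "i \<noteq> d" using that eq by blast
    then show "y i = (x(d := y d)) i" by (cases "i = d") simp_all
  qed
  then have yS: "x(d := y d) \<in> S" using xy by simp
  have xS: "x(d := x d) \<in> S" using xy by simp
  have "\<phi> (x(d := x d + s (-1) (y d))) = \<phi> (x(d := x d)) + \<phi> (x(d := s (-1) (y d)))"
    using \<phi> d xS closed[OF d yS] unfolding mlin_def by blast
  moreover have "\<phi> (x(d := s (-1) (y d))) = t (-1) (\<phi> (x(d := y d)))"
    using \<phi> d yS unfolding mlin_def by blast
  ultimately show "\<phi> (ominus d x y) = \<phi> x - \<phi> y"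
    using y by (simp add: ominus_def)
qed

lemma character_0:
  assumes "nontrivial_additive_character \<chi>" shows "\<chi> 0 = 1"
proof -
  have "\<chi> 0 * \<chi> 0 = \<chi> 0" "norm (\<chi> 0) = 1"
    using assms unfolding nontrivial_additive_character_def by (metis add_0)+
  then show ?thesis by (metis mult_cancel_right1 norm_zero zero_neq_one)
qed

text \<open>Orthogonality of characters: the shift by \<open>w\<close> permutes \<open>S\<close> and
  multiplies the sum by \<open>\<chi> c\<close>, which is not 1.\<close>

lemma (in vector_space) sum_character_linear:
  assumes \<chi>: "nontrivial_additive_character \<chi>" and S: "subspace S" "finite S"
    and add: "\<And>u v. u \<in> S \<Longrightarrow> v \<in> S \<Longrightarrow> g (u + v) = g u + g v"
    and scale: "\<And>u c. u \<in> S \<Longrightarrow> g (scale c u) = c * g u"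
  shows "(\<Sum>u\<in>S. \<chi> (g u)) = (if \<forall>u\<in>S. g u = 0 then of_nat (card S) else 0)"
proof (cases "\<forall>u\<in>S. g u = 0")
  case True
  then show ?thesis using character_0[OF \<chi>] by simp
next
  case False
  then obtain u where u: "u \<in> S" "g u \<noteq> 0" by blast
  obtain c where c: "\<chi> c \<noteq> 1" using \<chi> by (auto simp: nontrivial_additive_character_def)
  define w where "w = scale (c / g u) u"
  have w: "w \<in> S" "g w = c" using u S scale by (simp_all add: w_def subspace_scale)
  have "bij_betw (\<lambda>v. w + v) S S"
    by (rule bij_betwI[where g = "\<lambda>v. v - w"]) (use w S in \<open>auto simp: subspace_add subspace_diff\<close>)
  then have "(\<Sum>v\<in>S. \<chi> (g v)) = (\<Sum>v\<in>S. \<chi> (g (w + v)))"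
    by (rule sum.reindex_bij_betw[symmetric])
  also have "\<dots> = \<chi> c * (\<Sum>v\<in>S. \<chi> (g v))"
    using add[OF w(1)] w(2) \<chi> by (simp add: nontrivial_additive_character_def sum_distrib_left)
  finally have "(\<chi> c - 1) * (\<Sum>v\<in>S. \<chi> (g v)) = 0" by (simp add: algebra_simps)
  then have "(\<Sum>v\<in>S. \<chi> (g v)) = 0" using c by simp
  then show ?thesis using False by (simp only: if_False)
qed

context finite_spaces
begin

lemma points_bij:
  assumes "k \<ge> 1"
  shows "bij_betw (\<lambda>(y, a). y(1 := a)) (Pi\<^sub>E {2..k} V \<times> V 1) (points k)"
proof (rule bij_betwI[where g = "\<lambda>x. (restrict x {2..k}, x 1)"])
  show "(\<lambda>(y, a). y(1 := a)) \<in> Pi\<^sub>E {2..k} V \<times> V 1 \<rightarrow> points k"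
    using PiE_point[OF assms] by auto
  show "(\<lambda>x. (restrict x {2..k}, x 1)) \<in> points k \<rightarrow> Pi\<^sub>E {2..k} V \<times> V 1"
    using assms by (auto simp: points_def PiE_iff)
  show "(\<lambda>x. (restrict x {2..k}, x 1)) ((\<lambda>(y, a). y(1 := a)) p) = p"
    if p: "p \<in> Pi\<^sub>E {2..k} V \<times> V 1" for p
    using p by (auto simp: PiE_iff extensional_def fun_eq_iff)
  show "(\<lambda>(y, a). y(1 := a)) ((\<lambda>x. (restrict x {2..k}, x 1)) x) = x" if "x \<in> points k" for x
  proof -
    have "x i = undefined" if "i \<noteq> 1" "i \<notin> {2..k}" for i
      using \<open>x \<in> points k\<close> that by (auto simp: points_def PiE_iff extensional_def)
    then show ?thesis by (auto simp: fun_eq_iff)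
  qed
qed

text \<open>Summation over the first coordinate alone leaves \<open>card (V 1)\<close> where the
  form vanishes identically in it and 0 elsewhere. The average is thus a nonnegative real, and the
  real part taken in the hypothesis loses nothing.\<close>

lemma avg_character_form:
  assumes \<chi>: "nontrivial_additive_character \<chi>" and k: "k \<ge> 1" and f: "form k {1..k} f"
  shows "avg (points k) (\<lambda>x. \<chi> (f x)) = of_nat (null_count k f) / of_nat (total_count k)"
proof -
  let ?Y = "Pi\<^sub>E {2..k} V"
  have finY: "finite ?Y" by (auto intro!: finite_PiE)
  have one: "1 \<in> {1..k}" using k by simp
  have inner: "(\<Sum>a\<in>V 1. \<chi> (f (y(1 := a)))) = (if \<forall>a\<in>V 1. f (y(1 := a)) = 0 then of_nat (card (V 1)) else 0)"
    if "y \<in> ?Y" for y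
    by (rule G.sum_character_linear[OF \<chi> subspace_V finite_V])
      (use PiE_point[OF k that] form_add[OF f one] form_scale[OF f one] in auto)
  have "(\<Sum>x\<in>points k. \<chi> (f x)) = (\<Sum>p\<in>?Y \<times> V 1. \<chi> (f ((\<lambda>(y, a). y(1 := a)) p)))"
    by (rule sum.reindex_bij_betw[OF points_bij[OF k], symmetric])
  also have "\<dots> = (\<Sum>y\<in>?Y. \<Sum>a\<in>V 1. \<chi> (f (y(1 := a))))"
    by (simp add: sum.cartesian_product split_def)
  also have "\<dots> = (\<Sum>y\<in>?Y. if \<forall>a\<in>V 1. f (y(1 := a)) = 0 then of_nat (card (V 1)) else 0)"
    by (intro sum.cong refl inner)
  also have "\<dots> = of_nat (null_count k f) * of_nat (card (V 1))"
    using finY by (simp add: null_count_def sum.If_cases Int_def)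
  finally have sum: "(\<Sum>x\<in>points k. \<chi> (f x)) = of_nat (null_count k f) * of_nat (card (V 1))" .
  have card: "card (points k) = total_count k * card (V 1)"
    using bij_betw_same_card[OF points_bij[OF k]] by (simp add: total_count_def card_cartesian_product)
  have "card (V 1) > 0" using V_simps(1) finite_V by (metis card_gt_0_iff empty_iff)
  then have nz: "(of_nat (card (V 1)) :: complex) \<noteq> 0" by (simp only: of_nat_eq_0_iff)
  show ?thesis
    unfolding avg_def sum card of_nat_mult by (rule nonzero_mult_divide_mult_cancel_right[OF nz])
qed

section \<open>Values in a subspace and at a prescribed point\<close>

text \<open>The map from \<open>extension_at\<close> may leave the subspace \<open>S\<close>; a
  projection brings its values back and fixes those already prescribed by
  \<open>\<phi>\<close>.\<close>

lemma linear_projection: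
  assumes "H.subspace S"
  obtains \<pi> where "\<And>x. \<pi> x \<in> S" "\<And>x. x \<in> S \<Longrightarrow> \<pi> x = x"
    "\<And>x y. \<pi> (x + y) = \<pi> x + \<pi> y" "\<And>c x. \<pi> (sH c x) = sH c (\<pi> x)"
proof -
  interpret HH: vector_space_pair sH sH ..
  have "\<exists>g. range g \<subseteq> S \<and> Vector_Spaces.linear sH sH g \<and> (\<forall>v\<in>S. g (id v) = v)"
    by (rule HH.linear_exists_left_inverse_on) (use assms H.linear_id in \<open>auto simp: id_def\<close>)
  then obtain g where g: "range g \<subseteq> S" "Vector_Spaces.linear sH sH g" "\<forall>v\<in>S. g v = v" by auto
  interpret g: Vector_Spaces.linear sH sH g by fact
  show ?thesis by (rule that[of g]) (use g g.add g.scale in auto)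
qed

lemma ml_fun_add:
  assumes f: "ml D S f" and g: "ml D S g"
  shows "ml D S (\<lambda>x. f x + g x)"
  unfolding mlin_def
  by (intro conjI ballI allI impI)
    (simp_all add: ml_add[OF f] ml_add[OF g] ml_scale[OF f] ml_scale[OF g] H.scale_right_distrib)

text \<open>Adding a multiple of \<open>\<rho>\<close> corrects the value at \<open>z\<close> and
  changes nothing where \<open>\<rho>\<close> vanishes. By \<open>unique_at\<close> this is all the
  freedom there is, and the value at \<open>z\<close> removes it.\<close>

lemma unique_extension:
  assumes k: "k \<ge> 1" and forms: "forms k \<Gamma>" "card \<Gamma> \<le> m" and \<rho>: "form k {1..k} \<rho>"
    and rank: "rank_cond k (req k m) \<Gamma> \<rho>"
    and S: "H.subspace S" and \<phi>: "ml {1..k} {x \<in> variety k \<Gamma>. \<rho> x = 0} \<phi>"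
    and \<phi>S: "\<And>x. x \<in> variety k \<Gamma> \<Longrightarrow> \<rho> x = 0 \<Longrightarrow> \<phi> x \<in> S"
    and z: "z \<in> variety k \<Gamma>" "\<rho> z \<noteq> 0" and h: "h \<in> S"
  shows "\<exists>!\<psi>. \<psi> \<in> variety k \<Gamma> \<rightarrow>\<^sub>E S \<and> ml {1..k} (variety k \<Gamma>) \<psi> \<and>
    (\<forall>x\<in>variety k \<Gamma>. \<rho> x = 0 \<longrightarrow> \<psi> x = \<phi> x) \<and> \<psi> z = h"
proof (rule ex_ex1I)
  let ?B = "variety k \<Gamma>"
  obtain \<pi> where \<pi>: "\<And>x. \<pi> x \<in> S" "\<And>x. x \<in> S \<Longrightarrow> \<pi> x = x"
    "\<And>x y. \<pi> (x + y) = \<pi> x + \<pi> y" "\<And>c x. \<pi> (sH c x) = sH c (\<pi> x)"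
    using linear_projection[OF S] by metis
  obtain \<psi> where \<psi>: "ml {1..k} ?B \<psi>" "\<And>x. x \<in> ?B \<Longrightarrow> \<rho> x = 0 \<Longrightarrow> \<psi> x = \<phi> x"
    using extension_at[OF k, unfolded extension_at_def, rule_format, OF forms \<rho> rank \<phi>] by blast
  define \<psi>1 where "\<psi>1 x = \<pi> (\<psi> x) + sH (\<rho> x) (sH (1 / \<rho> z) (h - \<pi> (\<psi> z)))" for x
  have "ml {1..k} ?B (\<lambda>x. \<pi> (\<psi> x))"
    using \<psi>(1) unfolding mlin_def by (simp add: \<pi>)
  then have ml1: "ml {1..k} ?B \<psi>1"
    unfolding \<psi>1_def using variety_points by (intro ml_fun_add ml_form[OF \<rho>]) auto
  have "ml {1..k} ?B (restrict \<psi>1 ?B)"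
    unfolding mlin_def using ml_add[OF ml1] ml_scale[OF ml1] variety_add[OF forms(1)] variety_scale[OF forms(1)]
    by (simp add: restrict_apply)
  moreover have "\<psi>1 x \<in> S" for x
    unfolding \<psi>1_def using S \<pi>(1) h by (intro H.subspace_add H.subspace_scale H.subspace_diff) auto
  moreover have "\<psi>1 x = \<phi> x" if "x \<in> ?B" "\<rho> x = 0" for x
    using that \<psi>(2) \<phi>S \<pi>(2) by (simp add: \<psi>1_def)
  moreover have "\<psi>1 z = h" using z by (simp add: \<psi>1_def)
  ultimately show "\<exists>\<psi>. \<psi> \<in> ?B \<rightarrow>\<^sub>E S \<and> ml {1..k} ?B \<psi> \<and> (\<forall>x\<in>?B. \<rho> x = 0 \<longrightarrow> \<psi> x = \<phi> x) \<and> \<psi> z = h"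
    using z by (intro exI[of _ "restrict \<psi>1 ?B"]) auto
  fix \<psi> \<psi>'
  assume 1: "\<psi> \<in> ?B \<rightarrow>\<^sub>E S \<and> ml {1..k} ?B \<psi> \<and> (\<forall>x\<in>?B. \<rho> x = 0 \<longrightarrow> \<psi> x = \<phi> x) \<and> \<psi> z = h"
    and 2: "\<psi>' \<in> ?B \<rightarrow>\<^sub>E S \<and> ml {1..k} ?B \<psi>' \<and> (\<forall>x\<in>?B. \<rho> x = 0 \<longrightarrow> \<psi>' x = \<phi> x) \<and> \<psi>' z = h"
  have "ml {1..k} ?B (\<lambda>x. \<psi> x - \<psi>' x)" using 1 2 by (intro ml_fun_diff) auto
  moreover have "\<forall>x\<in>?B. \<rho> x = 0 \<longrightarrow> \<psi> x - \<psi>' x = 0" using 1 2 by simp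
  ultimately obtain w where w: "\<And>x. x \<in> ?B \<Longrightarrow> \<psi> x - \<psi>' x = sH (\<rho> x) w"
    using unique_at[OF k, unfolded unique_at_def, rule_format, OF forms \<rho> rank] by blast
  have "sH (\<rho> z) w = 0" using w[OF z(1)] 1 2 by simp
  then have "w = 0" using z(2) by simp
  then have "\<psi> x = \<psi>' x" if "x \<in> ?B" for x using w[OF that] by simp
  then show "\<psi> = \<psi>'" using 1 2 by (intro PiE_ext[of \<psi> ?B "\<lambda>_. S" \<psi>']) auto
qed

end

theorem theorem3p1:
  fixes \<chi> :: "'f::{field,finite} \<Rightarrow> complex"
    and sG :: "'f \<Rightarrow> 'v::ab_group_add \<Rightarrow> 'v"
    and sH :: "'f \<Rightarrow> 'w::ab_group_add \<Rightarrow> 'w"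
    and k m :: nat
    and G :: "nat \<Rightarrow> 'v set"
    and H :: "'w set"
    and I :: "nat \<Rightarrow> nat set"
    and \<rho> :: "(nat \<Rightarrow> 'v) \<Rightarrow> 'f"
    and \<beta> :: "nat \<Rightarrow> (nat \<Rightarrow> 'v) \<Rightarrow> 'f"
    and \<I> :: "nat set"
    and B B0 :: "(nat \<Rightarrow> 'v) set"
    and \<phi> :: "(nat \<Rightarrow> 'v) \<Rightarrow> 'w"
  assumes "nontrivial_additive_character \<chi>"
    and "vector_space sG" and "vector_space sH"
    and "k \<ge> 1"
    and "\<forall>j\<in>{1..k}. fin_dim_subspace sG (G j)"
    and "fin_dim_subspace sH H"
    and "multilinear_on sG (*) {1..k} (Pi\<^sub>E {1..k} G) \<rho>"
    and "\<forall>i\<in>{1..m}. I i \<subseteq> {1..k}"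
    and "\<forall>i\<in>{1..m}. multilinear_on sG (*) (I i) (Pi\<^sub>E (I i) G) (\<beta> i)"
    and "\<I> = {i \<in> {1..m}. I i = {1..k}}"
    and "B = {x \<in> Pi\<^sub>E {1..k} G. \<forall>i\<in>{1..m}. \<beta> i (restrict x (I i)) = 0}"
    and "B0 = {x \<in> B. \<rho> x = 0}"
    and "\<phi> \<in> B0 \<rightarrow> H"
    and "multilinear_on sG sH {1..k} B0 \<phi>"
    and "\<forall>\<mu> \<in> \<I> \<rightarrow>\<^sub>E (UNIV :: 'f set).
           Re (avg (Pi\<^sub>E {1..k} G) (\<lambda>x. \<chi> (\<rho> x + (\<Sum>i\<in>\<I>. \<mu> i * \<beta> i x))))
           < 1 / (2 * real k ^ 2) *
             real CARD('f) powi (- int ((2 * k\<^sup>2 + k + 1) * (m + 1) * 2 ^ (2 * k + 3)))"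
  shows "\<forall>z \<in> B - B0. \<forall>h0 \<in> H.
           \<exists>!\<psi>. \<psi> \<in> B \<rightarrow>\<^sub>E H \<and> multilinear_on sG sH {1..k} B \<psi> \<and>
                (\<forall>x\<in>B0. \<psi> x = \<phi> x) \<and> \<psi> z = h0"
proof (intro ballI)
  interpret sG: vector_space sG by fact
  interpret sH: vector_space sH by fact
  define V where "V j = (if j \<in> {1..k} then G j else {0})" for j
  have V: "sG.subspace (V j)" "finite (V j)" for j
  proof -
    have "sG.subspace (G j) \<and> finite (G j)" if "j \<in> {1..k}"
      using assms(5) that sG.card_span_le[OF finite_class.finite_UNIV] unfolding fin_dim_subspace_def by metis
    then show "sG.subspace (V j)" "finite (V j)" by (auto simp: V_def sG.subspace_def)
  qed
  interpret finite_spaces sG sH V by unfold_locales (use V in auto)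
  have PiE: "Pi\<^sub>E J V = Pi\<^sub>E J G" if "J \<subseteq> {1..k}" for J
    using that by (intro PiE_cong) (auto simp: V_def)
  have points: "points k = Pi\<^sub>E {1..k} G" by (simp add: points_def PiE)
  have mult: "vector_space ((*) :: 'f \<Rightarrow> 'f \<Rightarrow> 'f)"
    by unfold_locales (auto simp: algebra_simps)
  have closed: "x(d := sG c u) \<in> Pi\<^sub>E J G" if "d \<in> J" "J \<subseteq> {1..k}" "x(d := u) \<in> Pi\<^sub>E J G" for d J x u c
  proof -
    have "u \<in> V d" using that(1,3) unfolding PiE[OF that(2), symmetric] by (metis PiE_mem fun_upd_same)
    then have "(x(d := u))(d := sG c u) \<in> Pi\<^sub>E J V"
      using that(1,3) unfolding PiE[OF that(2), symmetric] by (auto simp: PiE_iff extensional_def)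
    then show ?thesis using PiE[OF that(2)] by simp
  qed
  have \<rho>_mlin: "mlin sG (*) {1..k} (points k) \<rho>"
    unfolding points
    by (rule multilinear_on_imp_mlin[OF assms(2) mult assms(7) order_refl]) (use closed in blast)
  then have \<rho>: "form k {1..k} \<rho>"
    unfolding form_def points using PiE_ext by blast
  \<comment> \<open>The forms are pulled back to all \<open>k\<close> coordinates, the common domain
    that \<open>form\<close> expects.\<close>
  define f where "f i x = \<beta> i (restrict x (I i))" for i x
  have f: "form k (I i) (f i)" if i: "i \<in> {1..m}" for i
    unfolding form_def
  proof (intro conjI ballI impI)
    show I: "I i \<subseteq> {1..k}" using assms(8) i by blast
    have \<beta>: "mlin sG (*) (I i) (Pi\<^sub>E (I i) G) (\<beta> i)"
      by (rule multilinear_on_imp_mlin[OF assms(2) mult _ order_refl]) (use assms(9) i I closed in blast)+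
    have r: "restrict (x(d := u)) (I i) = (restrict x (I i))(d := u)" if "d \<in> I i"
      for x :: "nat \<Rightarrow> 'v" and d u using that by auto
    have p: "(restrict x (I i))(d := u) \<in> Pi\<^sub>E (I i) G" if "d \<in> I i" "x(d := u) \<in> points k" for x d u
    proof -
      have "\<forall>j\<in>I i. (x(d := u)) j \<in> G j"
        using that(2) I unfolding points PiE_iff by blast
      then have "restrict (x(d := u)) (I i) \<in> Pi\<^sub>E (I i) G"
        by (simp only: restrict_PiE_iff)
      then show ?thesis using r[OF that(1)] by simp
    qed
    show "mlin sG (*) (I i) (points k) (f i)"
      unfolding mlin_def f_def
    proof (intro conjI ballI allI impI)
      fix d x u v assume d: "d \<in> I i" and "x(d := u) \<in> points k" "x(d := v) \<in> points k"
      then have "(restrict x (I i))(d := u) \<in> Pi\<^sub>E (I i) G" "(restrict x (I i))(d := v) \<in> Pi\<^sub>E (I i) G"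
        using p by blast+
      then show "\<beta> i (restrict (x(d := u + v)) (I i)) = \<beta> i (restrict (x(d := u)) (I i)) + \<beta> i (restrict (x(d := v)) (I i))"
        using \<beta> d unfolding r[OF d] mlin_def by blast
    next
      fix d x u c assume d: "d \<in> I i" and "x(d := u) \<in> points k"
      then have "(restrict x (I i))(d := u) \<in> Pi\<^sub>E (I i) G" using p by blast
      then show "\<beta> i (restrict (x(d := sG c u)) (I i)) = c * \<beta> i (restrict (x(d := u)) (I i))"
        using \<beta> d unfolding r[OF d] mlin_def by blast
    qed
    fix x y assume "x \<in> points k" "y \<in> points k" "\<forall>j\<in>I i. x j = y j"
    then have "restrict x (I i) = restrict y (I i)" by auto
    then show "f i x = f i y" by (simp add: f_def)
  qed
  define \<Gamma> where "\<Gamma> = (\<lambda>i. (I i, f i)) ` {1..m}"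
  have \<Gamma>: "forms k \<Gamma>" using f by (auto simp: forms_def \<Gamma>_def)
  have card_\<Gamma>: "card \<Gamma> \<le> m" unfolding \<Gamma>_def using card_image_le[of "{1..m}"] by fastforce
  have B: "B = variety k \<Gamma>"
    using assms(11) by (auto simp: variety_def \<Gamma>_def points f_def)
  have B0: "B0 = {x \<in> variety k \<Gamma>. \<rho> x = 0}" using assms(12) B by simp
  have rank: "rank_cond k (req k m) \<Gamma> \<rho>"
    unfolding rank_cond_def
  proof
    fix \<gamma> assume \<gamma>: "\<gamma> \<in> fun_space.span (full k \<Gamma>)"
    have fin: "finite \<I>" using assms(10) by simp
    \<comment> \<open>The hypothesis runs over coefficient vectors on \<open>\<I>\<close>, the rank
      condition over the span of a set of functions. \<open>?U\<close> links the two, also when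
      several indices give the same function.\<close>
    let ?U = "{\<gamma>. \<exists>\<mu>. \<gamma> = (\<lambda>x. \<Sum>i\<in>\<I>. \<mu> i * f i x)}"
    have "fun_space.subspace ?U"
      unfolding fun_space.subspace_def
    proof (intro conjI allI ballI)
      show "0 \<in> ?U" by (auto intro!: exI[of _ "\<lambda>_. 0"])
      fix x y assume "x \<in> ?U" "y \<in> ?U"
      then obtain \<mu> \<nu> where "x = (\<lambda>x. \<Sum>i\<in>\<I>. \<mu> i * f i x)" "y = (\<lambda>x. \<Sum>i\<in>\<I>. \<nu> i * f i x)" by blast
      then have "x + y = (\<lambda>x. \<Sum>i\<in>\<I>. (\<mu> i + \<nu> i) * f i x)"
        by (simp add: fun_eq_iff sum.distrib algebra_simps)
      then show "x + y \<in> ?U" by (intro CollectI exI)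
    next
      fix c x assume "x \<in> ?U"
      then obtain \<mu> where "x = (\<lambda>x. \<Sum>i\<in>\<I>. \<mu> i * f i x)" by blast
      then have "(\<lambda>y. c * x y) = (\<lambda>x. \<Sum>i\<in>\<I>. (c * \<mu> i) * f i x)"
        by (simp add: fun_eq_iff sum_distrib_left algebra_simps)
      then show "(\<lambda>y. c * x y) \<in> ?U" by (intro CollectI exI)
    qed
    moreover have "full k \<Gamma> \<subseteq> ?U"
    proof
      fix g assume "g \<in> full k \<Gamma>"
      then obtain j where j: "j \<in> \<I>" "g = f j" using assms(10) by (auto simp: full_def \<Gamma>_def)
      have "g x = (\<Sum>i\<in>\<I>. (if i = j then 1 else 0) * f i x)" for x
      proof -
        have "(\<Sum>i\<in>\<I>. (if i = j then 1 else 0) * f i x) = (\<Sum>i\<in>\<I>. if i = j then f i x else 0)"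
          by (intro sum.cong) auto
        then show ?thesis using j fin by simp
      qed
      then show "g \<in> ?U" by (intro CollectI exI ext)
    qed
    ultimately obtain \<nu> where \<nu>: "\<gamma> = (\<lambda>x. \<Sum>i\<in>\<I>. \<nu> i * f i x)"
      using \<gamma> fun_space.span_minimal[of "full k \<Gamma>" ?U] by blast
    define \<mu> where "\<mu> = restrict \<nu> \<I>"
    have eq: "\<rho> x + (\<Sum>i\<in>\<I>. \<mu> i * \<beta> i x) = (\<rho> + \<gamma>) x" if "x \<in> points k" for x
    proof -
      have "restrict x {1..k} = x" using that unfolding points by (auto simp: PiE_iff extensional_def fun_eq_iff)
      then have "\<beta> i x = f i x" if "i \<in> \<I>" for i using that assms(10) by (simp add: f_def)
      then show ?thesis by (simp add: \<nu> \<mu>_def)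
    qed
    have "\<mu> \<in> \<I> \<rightarrow>\<^sub>E UNIV" by (simp add: \<mu>_def)
    then have less: "Re (avg (Pi\<^sub>E {1..k} G) (\<lambda>x. \<chi> (\<rho> x + (\<Sum>i\<in>\<I>. \<mu> i * \<beta> i x))))
        < 1 / (2 * real k ^ 2) * real CARD('f) powi (- int ((2 * k\<^sup>2 + k + 1) * (m + 1) * 2 ^ (2 * k + 3)))"
      using assms(15) by blast
    have avg: "avg (Pi\<^sub>E {1..k} G) (\<lambda>x. \<chi> (\<rho> x + (\<Sum>i\<in>\<I>. \<mu> i * \<beta> i x))) = avg (points k) (\<lambda>x. \<chi> ((\<rho> + \<gamma>) x))"
      unfolding points[symmetric] avg_def using eq by (metis (no_types, lifting) sum.cong)
    have form: "form k {1..k} (\<rho> + \<gamma>)"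
    proof (rule form_fun_add[OF \<rho>])
      show "form k {1..k} \<gamma>"
        by (rule form_span[OF _ order_refl \<gamma>]) (use \<Gamma> in \<open>auto simp: full_def forms_def\<close>)
    qed
    have "avg (points k) (\<lambda>x. \<chi> ((\<rho> + \<gamma>) x)) =
        complex_of_real (real (null_count k (\<rho> + \<gamma>)) / real (total_count k))"
      unfolding avg_character_form[OF assms(1,4) form] by simp
    then have less: "real (null_count k (\<rho> + \<gamma>)) / real (total_count k) <
        1 / (2 * real k ^ 2) * real CARD('f) powi (- int ((2 * k\<^sup>2 + k + 1) * (m + 1) * 2 ^ (2 * k + 3)))"
      using less unfolding avg by (simp only: Re_complex_of_real)
    let ?E = "(2 * k\<^sup>2 + k + 1) * (m + 1) * 2 ^ (2 * k + 3)"
    let ?q = "real CARD('f)"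
    have q: "?q \<ge> 2" using card_field_ge_2 by simp
    have pow: "?q powi (- int ?E) = 1 / ?q ^ ?E"
      by (simp only: power_int_minus power_int_of_nat inverse_eq_divide)
    have "real k ^ 2 \<ge> 1" using assms(4) by simp
    then have "2 * real k ^ 2 \<ge> 1" by linarith
    then have "1 / (2 * real k ^ 2) \<le> 1" by (intro iffD2[OF divide_le_eq_1_pos]) linarith+
    then have "1 / (2 * real k ^ 2) * (1 / ?q ^ ?E) \<le> 1 * (1 / ?q ^ ?E)"
      using q by (intro mult_right_mono) auto
    then have "real (null_count k (\<rho> + \<gamma>)) / real (total_count k) < 1 / ?q ^ ?E"
      using less unfolding pow by linarith
    then have "?q ^ ?E * real (null_count k (\<rho> + \<gamma>)) < real (total_count k)"
      using q total_count_pos[of k] by (simp add: field_simps)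
    then have "CARD('f) ^ ?E * null_count k (\<rho> + \<gamma>) < total_count k"
      by (metis of_nat_less_iff of_nat_mult of_nat_power)
    moreover have "req k m \<le> ?E"
    proof -
      have "(4::nat) ^ Suc k = 2 ^ (2 * k + 2)" by (simp add: power_add power_mult)
      also have "\<dots> \<le> 2 ^ (2 * k + 3)" by (intro power_increasing) auto
      finally have "4 ^ Suc k * (m + 1) \<le> 2 ^ (2 * k + 3) * (m + 1)" by (rule mult_le_mono1)
      then have "req k m \<le> (m + 1) * 2 ^ (2 * k + 3)" by (simp only: req_def mult.commute)
      also have "\<dots> \<le> (2 * k\<^sup>2 + k + 1) * ((m + 1) * 2 ^ (2 * k + 3))" by simp
      finally show ?thesis by (simp only: mult.assoc)
    qed
    then have "CARD('f) ^ req k m \<le> CARD('f) ^ ?E"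
      using card_field_ge_2 by (intro power_increasing) auto
    ultimately show "CARD('f) ^ req k m * null_count k (\<rho> + \<gamma>) < total_count k"
      by (meson le_less_trans mult_le_mono1)
  qed
  have closed_B: "x(d := sG c u) \<in> B" if "d \<in> {1..k}" "x(d := u) \<in> B" for d x u c
    using variety_scale[OF \<Gamma>] that unfolding B by blast
  have closed_B0: "x(d := sG c u) \<in> B0" if "d \<in> {1..k}" "x(d := u) \<in> B0" for d x u c
  proof -
    have "\<rho> (x(d := sG c u)) = c * \<rho> (x(d := u))"
      using form_scale[OF \<rho> that(1)] that(2) variety_points unfolding B0 by blast
    then show ?thesis using variety_scale[OF \<Gamma> that(1)] that(2) unfolding B0 by simp
  qed
  have "ml {1..k} B0 \<phi>"
    by (rule multilinear_on_imp_mlin[OF assms(2,3,14) order_refl]) (use closed_B0 in blast)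
  then have \<phi>: "ml {1..k} {x \<in> variety k \<Gamma>. \<rho> x = 0} \<phi>" by (simp only: B0)
  have ext: "B \<subseteq> extensional {1..k}" using assms(11) by (auto simp: PiE_def)
  have iff: "multilinear_on sG sH {1..k} B \<psi> \<longleftrightarrow> ml {1..k} B \<psi>" for \<psi>
    using multilinear_on_imp_mlin[OF assms(2,3) _ order_refl] mlin_imp_multilinear_on[OF assms(2,3) _ ext] closed_B
    by blast
  have H: "sH.subspace H" using assms(6) by (simp add: fin_dim_subspace_def)
  fix z h0 assume "z \<in> B - B0" "h0 \<in> H"
  then have z: "z \<in> variety k \<Gamma>" "\<rho> z \<noteq> 0" and h0: "h0 \<in> H" unfolding B0 B by auto
  have \<phi>H: "\<phi> x \<in> H" if "x \<in> variety k \<Gamma>" "\<rho> x = 0" for x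
    using that assms(13) unfolding B0 by blast
  have ball: "(\<forall>x\<in>B0. \<psi> x = \<phi> x) \<longleftrightarrow> (\<forall>x\<in>B. \<rho> x = 0 \<longrightarrow> \<psi> x = \<phi> x)" for \<psi>
    using assms(12) by blast
  show "\<exists>!\<psi>. \<psi> \<in> B \<rightarrow>\<^sub>E H \<and> multilinear_on sG sH {1..k} B \<psi> \<and> (\<forall>x\<in>B0. \<psi> x = \<phi> x) \<and> \<psi> z = h0"
    unfolding iff ball
    using unique_extension[OF assms(4) \<Gamma> card_\<Gamma> \<rho> rank H \<phi> \<phi>H z h0] unfolding B .
qed

end
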